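(* Let $\xi\in\mathbb{R}$ with $[\mathbb{Q}(\xi):\mathbb{Q}]>3$, and let $c$ and $\lambda$ be positive real numbers. Suppose that, for every sufficiently large real number $X$, the inequalities \[ |x_0|\le X,\qquad \max_{1\le i\le 3}|x_0\xi^i-x_i|\le cX^{-\lambda} \] admit a non-zero solution $\mathbf{x}=(x_0,x_1,x_2,x_3)\in\mathbb{Z}^4$. Then $\lambda<\lambda_3$.
   Context: $\gamma=(1+\sqrt5)/2$ is the golden ratio and $\lambda_3\approx 0.4245$ denotes the smallest positive root of the polynomial $T^2-\gamma^3T+\gamma$. *)

theory Defs
  imports "HOL-Analysis.Analysis" "HOL-Library.Extended_Nat"
begin

definition is_subfield :: "real set \<Rightarrow> bool" where
  "is_subfield K \<longleftrightarrow>
     0 \<in> K \<and> 1 \<in> K \<and>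
     (\<forall>x\<in>K. \<forall>y\<in>K. x - y \<in> K \<and> x * y \<in> K) \<and>
     (\<forall>x\<in>K. x \<noteq> 0 \<longrightarrow> inverse x \<in> K)"

text \<open>The field \<open>\<rat>(\<xi>)\<close>, as the smallest subfield of the reals containing \<open>\<rat>\<close> and \<open>\<xi>\<close>.\<close>

definition rat_adjoin :: "real \<Rightarrow> real set" where
  "rat_adjoin \<xi> = is_subfield hull (insert \<xi> \<rat>)"

interpretation rat_vs: vector_space "\<lambda>(q::rat) (x::real). of_rat q * x"
  by unfold_locales (simp_all add: of_rat_add of_rat_mult algebra_simps)

text \<open>The degree \<open>[K : \<rat>]\<close>. The library's \<^term>\<open>rat_vs.dim\<close> is \<open>0\<close> on
  infinite-dimensional spaces, so the value \<open>\<infinity>\<close> is assigned separately.\<close>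

definition degree_over_rat :: "real set \<Rightarrow> enat" where
  "degree_over_rat K =
     (if \<exists>B. finite B \<and> K \<subseteq> rat_vs.span B then enat (rat_vs.dim K) else \<infinity>)"

definition golden_ratio :: real where
  "golden_ratio = (1 + sqrt 5) / 2"

definition lambda3 :: real where
  "lambda3 = (LEAST T. T > 0 \<and> T ^ 2 - golden_ratio ^ 3 * T + golden_ratio = 0)"

text \<open>\<open>LEAST\<close> is only meaningful on the reals if a minimum exists; it does here.\<close>

lemma lambda3_closed_form:
  "lambda3 = (golden_ratio ^ 3 - sqrt (golden_ratio ^ 6 - 4 * golden_ratio)) / 2"
proof -
  let ?g = golden_ratio
  define s where "s = sqrt (?g ^ 6 - 4 * ?g)"
  have "sqrt 5 \<ge> sqrt 4" by (subst real_sqrt_le_iff) simp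
  then have s5: "sqrt 5 \<ge> 2" by simp
  then have g: "?g \<ge> 3 / 2" by (simp add: golden_ratio_def)
  have "?g ^ 5 \<ge> (3 / 2) ^ 5" using g by (intro power_mono) auto
  then have "?g ^ 5 \<ge> 4" by (simp add: power_divide)
  then have "?g * ?g ^ 5 \<ge> ?g * 4" using g by (intro mult_left_mono) auto
  then have disc: "?g ^ 6 - 4 * ?g \<ge> 0"
    by (simp add: power_Suc[symmetric] del: power_Suc)
  then have s0: "s \<ge> 0" and s2: "s ^ 2 = ?g ^ 6 - 4 * ?g"
    by (auto simp: s_def)
  have "s ^ 2 < (?g ^ 3) ^ 2" using g s2 by (simp flip: power_mult)
  then have lt: "s < ?g ^ 3"
    by (rule power_less_imp_less_base) (use g in simp)
  have fac: "T ^ 2 - ?g ^ 3 * T + ?g = (T - (?g ^ 3 - s) / 2) * (T - (?g ^ 3 + s) / 2)" for T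
  proof -
    have "(?g ^ 3 - s) * (?g ^ 3 + s) = 4 * ?g"
      using s2 by (simp add: algebra_simps power2_eq_square flip: power_add)
    then show ?thesis by (simp add: field_simps power2_eq_square)
  qed
  have "(LEAST T. T > 0 \<and> T ^ 2 - ?g ^ 3 * T + ?g = 0) = (?g ^ 3 - s) / 2"
  proof (rule Least_equality)
    show "(?g ^ 3 - s) / 2 > 0 \<and>
      ((?g ^ 3 - s) / 2) ^ 2 - ?g ^ 3 * ((?g ^ 3 - s) / 2) + ?g = 0"
      unfolding fac using lt by simp
  next
    fix y assume "y > 0 \<and> y ^ 2 - ?g ^ 3 * y + ?g = 0"
    then show "(?g ^ 3 - s) / 2 \<le> y" unfolding fac using s0 by auto
  qed
  then show ?thesis by (simp add: lambda3_def s_def)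
qed

end

theory Submission
  imports Defs
begin

text \<open>Suppose the exponent is at least \<open>\<lambda>\<^sub>3 > 849/2000\<close>. Among the minimal points of \<open>(1, \<xi>, \<xi>\<^sup>2, \<xi>\<^sup>3)\<close> one selects those
  \<open>y\<^sub>k\<close> that are independent of their two neighbours \<open>v\<^sub>k\<close> and \<open>u\<^sub>k\<close>, and writes \<open>W\<^sub>k\<close> for the span of the three. For two points,
  \<open>C(x, y) = (det (x\<^sup>-, x\<^sup>+, y\<^sup>-), det (x\<^sup>-, x\<^sup>+, y\<^sup>+))\<close> is a pair of integers that is small and whose ratio is close to \<open>\<xi>\<close>;
  two such pairs that are short enough must be parallel. Bounding heights of subspaces and of these pairs gives, up to bounded
  errors, linear inequalities between the logarithms of the norms and of the errors of the points.

  If \<open>W\<^sub>k \<noteq> W\<^sub>k\<^sub>+\<^sub>1\<close> for all large \<open>k\<close>, then all lines spanned by \<open>C(y\<^sub>k, y\<^sub>k\<^sub>+\<^sub>1)\<close> agree eventually, although the distance from the primitive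
  vector of the line to slope \<open>\<xi>\<close> tends to \<open>0\<close>. Hence \<open>W\<^sub>k = W\<^sub>k\<^sub>+\<^sub>1\<close> infinitely often, and for such \<open>k\<close> the inequalities leave almost no
  freedom: the logarithms around \<open>k\<close> are determined up to a factor. The four points \<open>y\<^sub>k\<^sub>-\<^sub>1, \<dots>, y\<^sub>k\<^sub>+\<^sub>2\<close> satisfy a linear relation, whose
  consequences for the pairs \<open>C(y\<^sub>i, y\<^sub>j)\<close> imply first that \<open>W\<^sub>k\<^sub>-\<^sub>2 = W\<^sub>k\<^sub>-\<^sub>1\<close>, so that the same pattern repeats backwards, and then,
  over several repetitions of the pattern, that two short pairs are parallel with incompatible lengths.\<close>

section \<open>Integer points and their contractions\<close>

text \<open>Origin of \<open>lambda3\<close>: suppose that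
  \<open>W\<^sub>j\<^sub>+\<^sub>1 = W\<^sub>j\<^sub>+\<^sub>2\<close>, that all estimates nearby
  are equalities with exponent L, and measure logarithms in units of that of the norm of
  \<open>u\<^sub>j\<close>. If r is the logarithm for \<open>u\<^sub>j\<^sub>+\<^sub>2\<close>, the
  two lower bounds for heights that remain read r(1 - 2L) = L(1 - L) and 1 - 2L = r(3L - 1 - L^2).
  They hold for r = \<gamma> and L = \<open>lambda3\<close>. So size estimates alone are consistent
  at this exponent, and the contradiction has to come from integrality: contents of pairs, primitive
  vectors of lines, and the fact that a nonzero multiple of a primitive vector is at least as long
  as the vector. The arguments that use this leave room to spare. Therefore the exponent can be
  lowered to the rational number 849/2000, every comparison becomes a linear inequality with
  rational coefficients, and bounded errors disappear because the norms are huge. A sum is compared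
  with its dominant term, hence the recurring alternatives, which are treated one by one.\<close>

datatype pt = Pt (c0: int) (c1: int) (c2: int) (c3: int)

definition cmb :: "int \<Rightarrow> pt \<Rightarrow> int \<Rightarrow> pt \<Rightarrow> pt" where
  "cmb r x s y = Pt (r * c0 x + s * c0 y) (r * c1 x + s * c1 y) (r * c2 x + s * c2 y) (r * c3 x + s * c3 y)"

lemma cmb_sel [simp]:
  "c0 (cmb r x s y) = r * c0 x + s * c0 y" "c1 (cmb r x s y) = r * c1 x + s * c1 y"
  "c2 (cmb r x s y) = r * c2 x + s * c2 y" "c3 (cmb r x s y) = r * c3 x + s * c3 y"
  by (simp_all add: cmb_def)

lemma pt_eq_iff: "x = y \<longleftrightarrow> c0 x = c0 y \<and> c1 x = c1 y \<and> c2 x = c2 y \<and> c3 x = c3 y"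
  by (auto intro: pt.expand)

definition dot :: "pt \<Rightarrow> pt \<Rightarrow> int" where
  "dot f x = c0 f * c0 x + c1 f * c1 x + c2 f * c2 x + c3 f * c3 x"

definition det3 :: "'a::comm_ring \<Rightarrow> 'a \<Rightarrow> 'a \<Rightarrow> 'a \<Rightarrow> 'a \<Rightarrow> 'a \<Rightarrow> 'a \<Rightarrow> 'a \<Rightarrow> 'a \<Rightarrow> 'a" where
  "det3 a b c d e f g h i = a * (e * i - f * h) - b * (d * i - f * g) + c * (d * h - e * g)"

text \<open>\<open>dot (nrm x y z) t\<close> is the determinant with rows \<open>x, y, z, t\<close>.\<close>

definition nrm :: "pt \<Rightarrow> pt \<Rightarrow> pt \<Rightarrow> pt" where
  "nrm x y z = Pt
     (- det3 (c1 x) (c2 x) (c3 x) (c1 y) (c2 y) (c3 y) (c1 z) (c2 z) (c3 z))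
     (det3 (c0 x) (c2 x) (c3 x) (c0 y) (c2 y) (c3 y) (c0 z) (c2 z) (c3 z))
     (- det3 (c0 x) (c1 x) (c3 x) (c0 y) (c1 y) (c3 y) (c0 z) (c1 z) (c3 z))
     (det3 (c0 x) (c1 x) (c2 x) (c0 y) (c1 y) (c2 y) (c0 z) (c1 z) (c2 z))"

definition nul :: pt where "nul = Pt 0 0 0 0"

lemma nul_sel [simp]: "c0 nul = 0" "c1 nul = 0" "c2 nul = 0" "c3 nul = 0"
  by (simp_all add: nul_def)

lemma dot_cmb: "dot f (cmb r x s y) = r * dot f x + s * dot f y"
  by (simp add: dot_def algebra_simps)

lemma dot_nrm [simp]: "dot (nrm x y z) x = 0" "dot (nrm x y z) y = 0" "dot (nrm x y z) z = 0"
  by (simp_all add: dot_def nrm_def det3_def algebra_simps)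

text \<open>The vector \<open>(wa x, wb x, wc x)\<close> is the cross product of
  \<open>x\<^sup>- = (x\<^sub>0, x\<^sub>1, x\<^sub>2)\<close> and \<open>x\<^sup>+ = (x\<^sub>1, x\<^sub>2, x\<^sub>3)\<close>, and the two entries of \<open>CC x y\<close> are
  \<open>det (x\<^sup>-, x\<^sup>+, y\<^sup>-)\<close> and \<open>det (x\<^sup>-, x\<^sup>+, y\<^sup>+)\<close>.\<close>

definition wa :: "pt \<Rightarrow> int" where "wa x = c1 x * c3 x - c2 x * c2 x"
definition wb :: "pt \<Rightarrow> int" where "wb x = c1 x * c2 x - c0 x * c3 x"
definition wc :: "pt \<Rightarrow> int" where "wc x = c0 x * c2 x - c1 x * c1 x"
lemmas w_defs = wa_def wb_def wc_def

definition Cm :: "pt \<Rightarrow> pt \<Rightarrow> int" where "Cm x y = wa x * c0 y + wb x * c1 y + wc x * c2 y"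
definition Cp :: "pt \<Rightarrow> pt \<Rightarrow> int" where "Cp x y = wa x * c1 y + wb x * c2 y + wc x * c3 y"

definition CC :: "pt \<Rightarrow> pt \<Rightarrow> int \<times> int" where "CC x y = (Cm x y, Cp x y)"

definition degen :: "pt \<Rightarrow> bool" where "degen x \<longleftrightarrow> wa x = 0 \<and> wb x = 0 \<and> wc x = 0"

definition crs :: "int \<times> int \<Rightarrow> int \<times> int \<Rightarrow> int" where
  "crs p q = fst p * snd q - snd p * fst q"

definition scl :: "int \<Rightarrow> int \<times> int \<Rightarrow> int \<times> int" where
  "scl m p = (m * fst p, m * snd p)"

lemma C_self [simp]: "Cm x x = 0" "Cp x x = 0" "CC x x = (0, 0)"
  by (simp_all add: Cm_def Cp_def CC_def w_defs algebra_simps)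

lemma Cm_cmb: "Cm x (cmb r y s z) = r * Cm x y + s * Cm x z"
  and Cp_cmb: "Cp x (cmb r y s z) = r * Cp x y + s * Cp x z"
  by (simp_all add: Cm_def Cp_def algebra_simps)

text \<open>Four vectors of three-space are linearly dependent: this is the relation among
  \<open>x\<^sup>-, x\<^sup>+, y\<^sup>-, y\<^sup>+\<close>.\<close>

lemma C_relation:
  "Cm x y * c1 y - Cp x y * c0 y + (Cm y x * c1 x - Cp y x * c0 x) = 0"
  "Cm x y * c2 y - Cp x y * c1 y + (Cm y x * c2 x - Cp y x * c1 x) = 0"
  "Cm x y * c3 y - Cp x y * c2 y + (Cm y x * c3 x - Cp y x * c2 x) = 0"
  by (simp_all add: Cm_def Cp_def w_defs algebra_simps)

definition wdet :: "pt \<Rightarrow> pt \<Rightarrow> pt \<Rightarrow> int" where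
  "wdet x y z = det3 (wa x) (wb x) (wc x) (wa y) (wb y) (wc y) (wa z) (wb z) (wc z)"

lemma wdet_swap: "wdet x z y = - wdet x y z" "wdet y x z = - wdet x y z"
  by (simp_all add: wdet_def det3_def algebra_simps)

text \<open>By Lagrange's identity a determinant of three vectors \<open>w\<close> can be computed by contracting
  with any one of the three points.\<close>

lemma crs_C: "crs (CC x s) (CC y s) = wdet x y s"
proof -
  have "crs (CC x s) (CC y s) =
    (wa x * c0 s + wb x * c1 s + wc x * c2 s) * (wa y * c1 s + wb y * c2 s + wc y * c3 s) -
    (wa x * c1 s + wb x * c2 s + wc x * c3 s) * (wa y * c0 s + wb y * c1 s + wc y * c2 s)"
    by (simp add: crs_def CC_def Cm_def Cp_def)
  also have "\<dots> = det3 (wa x) (wb x) (wc x) (wa y) (wb y) (wc y)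
      (c1 s * c3 s - c2 s * c2 s) (c1 s * c2 s - c0 s * c3 s) (c0 s * c2 s - c1 s * c1 s)"
    by (simp add: det3_def algebra_simps)
  finally show ?thesis by (simp add: wdet_def w_defs[of s])
qed

lemma crs_scl [simp]: "crs (scl m p) q = m * crs p q" "crs p (scl m q) = m * crs p q"
  by (simp_all add: crs_def scl_def algebra_simps)

lemma crs_self [simp]: "crs p p = 0" by (simp add: crs_def)

lemma crs_anti: "crs q p = - crs p q" by (simp add: crs_def algebra_simps)

lemma crs_zero_trans:
  assumes "crs p q = 0" "crs q r = 0" "q \<noteq> (0, 0)"
  shows "crs p r = 0"
proof -
  have "fst q * crs p r = fst r * crs p q + fst p * crs q r"
    "snd q * crs p r = snd r * crs p q + snd p * crs q r"
    by (simp_all add: crs_def algebra_simps)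
  then show ?thesis using assms by (cases q) auto
qed

text \<open>Proportionality is expressed by minors, so that no division occurs. The zero vector is
  proportional to everything, which is why \<open>par_trans\<close> and \<open>par_dot\<close> ask
  for a nonzero vector.\<close>

definition par :: "pt \<Rightarrow> pt \<Rightarrow> bool" where
  "par f g \<longleftrightarrow> c0 f * c1 g = c1 f * c0 g \<and> c0 f * c2 g = c2 f * c0 g \<and> c0 f * c3 g = c3 f * c0 g \<and>
         c1 f * c2 g = c2 f * c1 g \<and> c1 f * c3 g = c3 f * c1 g \<and> c2 f * c3 g = c3 f * c2 g"

lemma par_sym: "par f g \<Longrightarrow> par g f"
  by (auto simp: par_def algebra_simps)

text \<open>If \<open>x, y, z\<close> are independent, their annihilator is a line containing
  \<open>nrm x y z\<close>; otherwise \<open>nrm x y z\<close> is zero. Cramer's rule covers both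
  cases by polynomial identities.\<close>

lemma par_nrm:
  assumes "dot f x = 0" "dot f y = 0" "dot f z = 0"
  shows "par f (nrm x y z)"
  using assms unfolding par_def nrm_def dot_def det3_def pt.sel
  by (intro conjI; algebra)

lemma par_trans:
  assumes "par f n" "par n g" "n \<noteq> nul"
  shows "par f g"
proof -
  have "\<exists>t. t \<noteq> 0 \<and> (\<exists>r s. t * c0 f = r * c0 n \<and> t * c1 f = r * c1 n \<and> t * c2 f = r * c2 n \<and> t * c3 f = r * c3 n
     \<and> t * c0 g = s * c0 n \<and> t * c1 g = s * c1 n \<and> t * c2 g = s * c2 n \<and> t * c3 g = s * c3 n)"
  proof -
    consider "c0 n \<noteq> 0" | "c1 n \<noteq> 0" | "c2 n \<noteq> 0" | "c3 n \<noteq> 0" using assms(3) by (auto simp: pt_eq_iff)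
    then show ?thesis
    proof cases
      case 1 then show ?thesis using assms(1,2) unfolding par_def
        by (intro exI[of _ "c0 n"] conjI exI[of _ "c0 f"] exI[of _ "c0 g"]) (auto simp: algebra_simps)
    next
      case 2 then show ?thesis using assms(1,2) unfolding par_def
        by (intro exI[of _ "c1 n"] conjI exI[of _ "c1 f"] exI[of _ "c1 g"]) (auto simp: algebra_simps)
    next
      case 3 then show ?thesis using assms(1,2) unfolding par_def
        by (intro exI[of _ "c2 n"] conjI exI[of _ "c2 f"] exI[of _ "c2 g"]) (auto simp: algebra_simps)
    next
      case 4 then show ?thesis using assms(1,2) unfolding par_def
        by (intro exI[of _ "c3 n"] conjI exI[of _ "c3 f"] exI[of _ "c3 g"]) (auto simp: algebra_simps)
    qed
  qed
  then obtain t r s where t: "t \<noteq> 0" and f: "t * c0 f = r * c0 n" "t * c1 f = r * c1 n" "t * c2 f = r * c2 n" "t * c3 f = r * c3 n"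
     and g: "t * c0 g = s * c0 n" "t * c1 g = s * c1 n" "t * c2 g = s * c2 n" "t * c3 g = s * c3 n" by blast
  have *: "a * d = b * c" if "t * a = r * x" "t * b = r * y" "t * c = s * x" "t * d = s * y" for a b c d x y :: int
  proof -
    have "(t * a) * (t * d) = (t * b) * (t * c)" unfolding that by (simp add: algebra_simps)
    then have "(t * t) * (a * d) = (t * t) * (b * c)" by (simp add: algebra_simps)
    then show ?thesis using t by simp
  qed
  show ?thesis unfolding par_def using f g by (blast intro: *)
qed

lemma par_dot:
  assumes "par f g" "g \<noteq> nul" "dot g p = 0"
  shows "dot f p = 0"
proof -
  have "c0 g * dot f p = c0 f * dot g p" "c1 g * dot f p = c1 f * dot g p"
    "c2 g * dot f p = c2 f * dot g p" "c3 g * dot f p = c3 f * dot g p"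
    using assms(1) unfolding par_def dot_def by algebra+
  then show ?thesis using assms(2,3) by (auto simp: pt_eq_iff)
qed

text \<open>Up to sign these are the entries of adj(M) M = det(M) I for the matrix M with rows
  \<open>x, y, z, t\<close>. The point is that the coefficients of the relation are coordinates of
  normal vectors, whose sizes are known.\<close>

lemma cofactor_relation:
  assumes "dot (nrm x y z) t = 0"
  shows "c0 (nrm y z t) * c0 x - c0 (nrm x z t) * c0 y + c0 (nrm x y t) * c0 z - c0 (nrm x y z) * c0 t = 0"
    "c0 (nrm y z t) * c1 x - c0 (nrm x z t) * c1 y + c0 (nrm x y t) * c1 z - c0 (nrm x y z) * c1 t = 0"
    "c0 (nrm y z t) * c2 x - c0 (nrm x z t) * c2 y + c0 (nrm x y t) * c2 z - c0 (nrm x y z) * c2 t = 0"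
    "c0 (nrm y z t) * c3 x - c0 (nrm x z t) * c3 y + c0 (nrm x y t) * c3 z - c0 (nrm x y z) * c3 t = 0"
    "c1 (nrm y z t) * c0 x - c1 (nrm x z t) * c0 y + c1 (nrm x y t) * c0 z - c1 (nrm x y z) * c0 t = 0"
    "c1 (nrm y z t) * c1 x - c1 (nrm x z t) * c1 y + c1 (nrm x y t) * c1 z - c1 (nrm x y z) * c1 t = 0"
    "c1 (nrm y z t) * c2 x - c1 (nrm x z t) * c2 y + c1 (nrm x y t) * c2 z - c1 (nrm x y z) * c2 t = 0"
    "c1 (nrm y z t) * c3 x - c1 (nrm x z t) * c3 y + c1 (nrm x y t) * c3 z - c1 (nrm x y z) * c3 t = 0"
    "c2 (nrm y z t) * c0 x - c2 (nrm x z t) * c0 y + c2 (nrm x y t) * c0 z - c2 (nrm x y z) * c0 t = 0"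
    "c2 (nrm y z t) * c1 x - c2 (nrm x z t) * c1 y + c2 (nrm x y t) * c1 z - c2 (nrm x y z) * c1 t = 0"
    "c2 (nrm y z t) * c2 x - c2 (nrm x z t) * c2 y + c2 (nrm x y t) * c2 z - c2 (nrm x y z) * c2 t = 0"
    "c2 (nrm y z t) * c3 x - c2 (nrm x z t) * c3 y + c2 (nrm x y t) * c3 z - c2 (nrm x y z) * c3 t = 0"
    "c3 (nrm y z t) * c0 x - c3 (nrm x z t) * c0 y + c3 (nrm x y t) * c0 z - c3 (nrm x y z) * c0 t = 0"
    "c3 (nrm y z t) * c1 x - c3 (nrm x z t) * c1 y + c3 (nrm x y t) * c1 z - c3 (nrm x y z) * c1 t = 0"
    "c3 (nrm y z t) * c2 x - c3 (nrm x z t) * c2 y + c3 (nrm x y t) * c2 z - c3 (nrm x y z) * c2 t = 0"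
    "c3 (nrm y z t) * c3 x - c3 (nrm x z t) * c3 y + c3 (nrm x y t) * c3 z - c3 (nrm x y z) * c3 t = 0"
  using assms unfolding nrm_def dot_def det3_def pt.sel by algebra+

section \<open>Estimates\<close>

definition sz :: "int \<times> int \<Rightarrow> real" where
  "sz p = max \<bar>real_of_int (fst p)\<bar> \<bar>real_of_int (snd p)\<bar>"

definition mx :: "pt \<Rightarrow> real" where
  "mx n = max (max \<bar>real_of_int (c0 n)\<bar> \<bar>real_of_int (c1 n)\<bar>) (max \<bar>real_of_int (c2 n)\<bar> \<bar>real_of_int (c3 n)\<bar>)"

text \<open>The leading coordinate replaces the maximum norm: as soon as
  \<open>Lt x \<le> Nm x\<close>, the other coordinates are bounded by a constant times it.\<close>

definition Nm :: "pt \<Rightarrow> real" where "Nm x = \<bar>real_of_int (c0 x)\<bar>"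

lemma sz_ge: "\<bar>real_of_int (fst p)\<bar> \<le> sz p" "\<bar>real_of_int (snd p)\<bar> \<le> sz p"
  by (simp_all add: sz_def)

lemma sz_ge1: "p \<noteq> (0, 0) \<Longrightarrow> 1 \<le> sz p"
proof -
  assume "p \<noteq> (0, 0)"
  then have "1 \<le> \<bar>fst p\<bar> \<or> 1 \<le> \<bar>snd p\<bar>" by (cases p) auto
  then show ?thesis unfolding sz_def by linarith
qed

lemma sz_scl: "sz (scl m p) = \<bar>real_of_int m\<bar> * sz p"
  by (simp add: sz_def scl_def abs_mult max_mult_distrib_left)

lemma mx_ge: "\<bar>real_of_int (c0 n)\<bar> \<le> mx n" "\<bar>real_of_int (c1 n)\<bar> \<le> mx n"
  "\<bar>real_of_int (c2 n)\<bar> \<le> mx n" "\<bar>real_of_int (c3 n)\<bar> \<le> mx n"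
  by (simp_all add: mx_def le_max_iff_disj)

lemma mx_nonneg: "0 \<le> mx n" by (simp add: mx_def le_max_iff_disj)

lemma mx_ge1: "n \<noteq> nul \<Longrightarrow> 1 \<le> mx n"
proof -
  assume "n \<noteq> nul"
  then have "1 \<le> \<bar>c0 n\<bar> \<or> 1 \<le> \<bar>c1 n\<bar> \<or> 1 \<le> \<bar>c2 n\<bar> \<or> 1 \<le> \<bar>c3 n\<bar>" by (auto simp: pt_eq_iff)
  then show ?thesis unfolding mx_def by linarith
qed

lemma abs_mult3_le:
  fixes a b c :: real
  assumes "\<bar>a\<bar> \<le> A" "\<bar>b\<bar> \<le> B" "\<bar>c\<bar> \<le> C"
  shows "\<bar>a * b * c\<bar> \<le> A * B * C"
  using assms by (simp add: abs_mult mult_mono)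

lemma abs_sum4_le:
  fixes a b c d :: real
  assumes "\<bar>a\<bar> \<le> A" "\<bar>b\<bar> \<le> B" "\<bar>c\<bar> \<le> C" "\<bar>d\<bar> \<le> D"
  shows "\<bar>a + b + c + d\<bar> \<le> A + B + C + D"
proof -
  have "\<bar>a + b + c + d\<bar> \<le> \<bar>a\<bar> + \<bar>b\<bar> + \<bar>c\<bar> + \<bar>d\<bar>"
    by (meson abs_triangle_ineq add_right_mono order_trans)
  also have "\<dots> \<le> A + B + C + D" using assms by (intro add_mono)
  finally show ?thesis .
qed

lemma abs_sum6_le:
  fixes a b c d e f :: real
  assumes "\<bar>a\<bar> \<le> A" "\<bar>b\<bar> \<le> B" "\<bar>c\<bar> \<le> C" "\<bar>d\<bar> \<le> D" "\<bar>e\<bar> \<le> E" "\<bar>f\<bar> \<le> F"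
  shows "\<bar>a - b - c + d + e - f\<bar> \<le> A + B + C + D + E + F"
proof -
  have "\<bar>(a + - b + - c + d) + e + - f + 0\<bar> \<le> (A + B + C + D) + E + F + 0"
    using assms by (intro abs_sum4_le) auto
  then show ?thesis by simp
qed

lemma det3_bound:
  fixes a1 a2 a3 b1 b2 b3 d1 d2 d3 :: real
  assumes a: "\<bar>a1\<bar> \<le> A" "\<bar>a2\<bar> \<le> A" "\<bar>a3\<bar> \<le> A"
    and b: "\<bar>b1\<bar> \<le> B" "\<bar>b2\<bar> \<le> B" "\<bar>b3\<bar> \<le> B"
    and d: "\<bar>d1\<bar> \<le> D" "\<bar>d2\<bar> \<le> D" "\<bar>d3\<bar> \<le> D"
  shows "\<bar>det3 a1 a2 a3 b1 b2 b3 d1 d2 d3\<bar> \<le> 6 * (A * B * D)"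
proof -
  have "\<bar>det3 a1 a2 a3 b1 b2 b3 d1 d2 d3\<bar> = \<bar>a1 * b2 * d3 - a1 * b3 * d2 - a2 * b1 * d3 + a2 * b3 * d1
      + a3 * b1 * d2 - a3 * b2 * d1\<bar>"
    by (simp add: det3_def algebra_simps)
  also have "\<dots> \<le> A * B * D + A * B * D + A * B * D + A * B * D + A * B * D + A * B * D"
    by (intro abs_sum6_le abs_mult3_le a b d)
  finally show ?thesis by simp
qed

text \<open>Each row is a multiple of the common vector \<open>(k1, k2, k3)\<close> plus a small
  remainder. In the multilinear expansion all terms containing this vector twice vanish, and four
  determinants are left.\<close>

lemma det3_near_bound:
  fixes a1 a2 a3 b1 b2 b3 d1 d2 d3 x y z :: real
  assumes k: "\<bar>k1\<bar> \<le> P" "\<bar>k2\<bar> \<le> P" "\<bar>k3\<bar> \<le> P"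
    and a: "\<bar>a1 - k1 * x\<bar> \<le> A" "\<bar>a2 - k2 * x\<bar> \<le> A" "\<bar>a3 - k3 * x\<bar> \<le> A"
    and b: "\<bar>b1 - k1 * y\<bar> \<le> B" "\<bar>b2 - k2 * y\<bar> \<le> B" "\<bar>b3 - k3 * y\<bar> \<le> B"
    and d: "\<bar>d1 - k1 * z\<bar> \<le> D" "\<bar>d2 - k2 * z\<bar> \<le> D" "\<bar>d3 - k3 * z\<bar> \<le> D"
  shows "\<bar>det3 a1 a2 a3 b1 b2 b3 d1 d2 d3\<bar> \<le>
     6 * (A * B * D) + 6 * (P * \<bar>x\<bar> * B * D) + 6 * (A * (P * \<bar>y\<bar>) * D) + 6 * (A * B * (P * \<bar>z\<bar>))"
proof -
  define a1' a2' a3' b1' b2' b3' d1' d2' d3' where defs: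
    "a1' = a1 - k1 * x" "a2' = a2 - k2 * x" "a3' = a3 - k3 * x"
    "b1' = b1 - k1 * y" "b2' = b2 - k2 * y" "b3' = b3 - k3 * y"
    "d1' = d1 - k1 * z" "d2' = d2 - k2 * z" "d3' = d3 - k3 * z"
  have inv: "a1 = a1' + k1 * x" "a2 = a2' + k2 * x" "a3 = a3' + k3 * x"
    "b1 = b1' + k1 * y" "b2 = b2' + k2 * y" "b3 = b3' + k3 * y"
    "d1 = d1' + k1 * z" "d2 = d2' + k2 * z" "d3 = d3' + k3 * z"
    by (simp_all add: defs)
  have eq: "det3 a1 a2 a3 b1 b2 b3 d1 d2 d3 =
      det3 a1' a2' a3' b1' b2' b3' d1' d2' d3' + det3 (k1 * x) (k2 * x) (k3 * x) b1' b2' b3' d1' d2' d3'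
    + det3 a1' a2' a3' (k1 * y) (k2 * y) (k3 * y) d1' d2' d3' + det3 a1' a2' a3' b1' b2' b3' (k1 * z) (k2 * z) (k3 * z)"
    unfolding inv by (simp add: det3_def algebra_simps)
  have kx: "\<bar>k * t\<bar> \<le> P * \<bar>t\<bar>" if "\<bar>k\<bar> \<le> P" for k t using that by (simp add: abs_mult mult_right_mono)
  note A = a[folded defs] and B = b[folded defs] and D = d[folded defs]
  have "\<bar>det3 a1' a2' a3' b1' b2' b3' d1' d2' d3'\<bar> \<le> 6 * (A * B * D)"
    by (rule det3_bound[OF A B D])
  moreover have "\<bar>det3 (k1 * x) (k2 * x) (k3 * x) b1' b2' b3' d1' d2' d3'\<bar> \<le> 6 * (P * \<bar>x\<bar> * B * D)"
    by (rule det3_bound[OF kx[OF k(1)] kx[OF k(2)] kx[OF k(3)] B D])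
  moreover have "\<bar>det3 a1' a2' a3' (k1 * y) (k2 * y) (k3 * y) d1' d2' d3'\<bar> \<le> 6 * (A * (P * \<bar>y\<bar>) * D)"
    by (rule det3_bound[OF A kx[OF k(1)] kx[OF k(2)] kx[OF k(3)] D])
  moreover have "\<bar>det3 a1' a2' a3' b1' b2' b3' (k1 * z) (k2 * z) (k3 * z)\<bar> \<le> 6 * (A * B * (P * \<bar>z\<bar>))"
    by (rule det3_bound[OF A B kx[OF k(1)] kx[OF k(2)] kx[OF k(3)]])
  ultimately show ?thesis unfolding eq by (rule abs_sum4_le)
qed

section \<open>Approximation to the powers of \<xi>\<close>

locale cubic_independent =
  fixes \<xi> :: real
  assumes independent:
    "real_of_int (c0 f) + real_of_int (c1 f) * \<xi> + real_of_int (c2 f) * \<xi>^2 + real_of_int (c3 f) * \<xi>^3 = 0 \<Longrightarrow> f = nul"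
begin

definition M :: real where "M = 1 + \<bar>\<xi>\<bar>"

text \<open>These are the entries of \<open>x\<^sup>+ - \<xi> x\<^sup>-\<close>, which is the vector
  that enters the determinants \<open>Cm\<close> and \<open>Cp\<close>. By
  \<open>coords_near\<close> they control the differences between the coordinates and \<xi>^i times
  the leading one.\<close>

definition e0 :: "pt \<Rightarrow> real" where "e0 x = real_of_int (c1 x) - \<xi> * real_of_int (c0 x)"
definition e1 :: "pt \<Rightarrow> real" where "e1 x = real_of_int (c2 x) - \<xi> * real_of_int (c1 x)"
definition e2 :: "pt \<Rightarrow> real" where "e2 x = real_of_int (c3 x) - \<xi> * real_of_int (c2 x)"

definition Lt :: "pt \<Rightarrow> real" where "Lt x = max \<bar>e0 x\<bar> (max \<bar>e1 x\<bar> \<bar>e2 x\<bar>)"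

definition er :: "int \<times> int \<Rightarrow> real" where
  "er p = \<bar>\<xi> * real_of_int (fst p) - real_of_int (snd p)\<bar>"

lemma M_ge: "1 \<le> M" "\<bar>\<xi>\<bar> \<le> M" by (simp_all add: M_def)

lemma e_le: "\<bar>e0 x\<bar> \<le> Lt x" "\<bar>e1 x\<bar> \<le> Lt x" "\<bar>e2 x\<bar> \<le> Lt x"
  by (simp_all add: Lt_def)

lemma Lt_nonneg: "0 \<le> Lt x" using e_le(1)[of x] by linarith

lemma irrational: "\<xi> * real_of_int a = real_of_int b \<Longrightarrow> a = 0 \<and> b = 0"
  using independent[of "Pt (- b) a 0 0"] by (simp add: pt_eq_iff algebra_simps)

lemma Lt_pos: assumes "x \<noteq> nul" shows "0 < Lt x"
proof (rule ccontr)
  assume "\<not> 0 < Lt x"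
  then have "e0 x = 0" "e1 x = 0" "e2 x = 0" using e_le[of x] by linarith+
  then have "\<xi> * real_of_int (c0 x) = real_of_int (c1 x)" "\<xi> * real_of_int (c1 x) = real_of_int (c2 x)"
    "\<xi> * real_of_int (c2 x) = real_of_int (c3 x)" by (simp_all add: e0_def e1_def e2_def)
  then have "x = nul" using irrational by (metis nul_sel pt_eq_iff)
  then show False using assms by simp
qed

lemma er_pos: "p \<noteq> (0, 0) \<Longrightarrow> 0 < er p"
  using irrational[of "fst p" "snd p"] by (cases p) (auto simp: er_def)

lemma er_scl: "er (scl m p) = \<bar>real_of_int m\<bar> * er p"
  by (simp add: er_def scl_def abs_mult[symmetric] algebra_simps)

lemma sz_le: "sz p \<le> M * \<bar>real_of_int (fst p)\<bar> + er p"
proof -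
  have "\<bar>real_of_int (snd p)\<bar> \<le> \<bar>\<xi>\<bar> * \<bar>real_of_int (fst p)\<bar> + er p"
    unfolding er_def abs_mult[symmetric] by linarith
  moreover have "0 \<le> er p" "0 \<le> \<bar>\<xi>\<bar> * \<bar>real_of_int (fst p)\<bar>" by (simp_all add: er_def)
  ultimately show ?thesis unfolding sz_def M_def by (simp add: algebra_simps)
qed

lemma crs_eq: "real_of_int (crs p q) =
   real_of_int (snd p) * 0 + (\<xi> * real_of_int (fst p) - real_of_int (snd p)) * real_of_int (fst q)
   - real_of_int (fst p) * (\<xi> * real_of_int (fst q) - real_of_int (snd q))"
  by (simp add: crs_def algebra_simps)

lemma crs_le: "\<bar>real_of_int (crs p q)\<bar> \<le> sz q * er p + sz p * er q"
proof -
  have "\<bar>real_of_int (crs p q)\<bar> \<le> er p * \<bar>real_of_int (fst q)\<bar> + \<bar>real_of_int (fst p)\<bar> * er q"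
    unfolding crs_eq er_def abs_mult[symmetric] by linarith
  also have "\<dots> \<le> er p * sz q + sz p * er q"
    by (intro add_mono mult_mono sz_ge) (simp_all add: er_def sz_def)
  finally show ?thesis by (simp add: mult.commute)
qed

lemma fst_er_le: "\<bar>real_of_int (fst p)\<bar> * er q \<le> \<bar>real_of_int (crs p q)\<bar> + sz q * er p"
proof -
  have "\<bar>real_of_int (fst p)\<bar> * er q \<le> \<bar>real_of_int (crs p q)\<bar> + er p * \<bar>real_of_int (fst q)\<bar>"
    unfolding crs_eq er_def abs_mult[symmetric] by linarith
  also have "\<dots> \<le> \<bar>real_of_int (crs p q)\<bar> + er p * sz q"
    by (intro add_mono mult_mono sz_ge) (simp_all add: er_def)
  finally show ?thesis by (simp add: mult.commute)
qed

lemma coords_near: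
  "\<bar>real_of_int (c0 x) - 1 * real_of_int (c0 x)\<bar> \<le> 3 * M^2 * Lt x"
  "\<bar>real_of_int (c1 x) - \<xi> * real_of_int (c0 x)\<bar> \<le> 3 * M^2 * Lt x"
  "\<bar>real_of_int (c2 x) - \<xi>^2 * real_of_int (c0 x)\<bar> \<le> 3 * M^2 * Lt x"
  "\<bar>real_of_int (c3 x) - \<xi>^3 * real_of_int (c0 x)\<bar> \<le> 3 * M^2 * Lt x"
proof -
  have M2: "1 \<le> M^2" "M \<le> M^2" using M_ge(1) by (auto intro: one_le_power self_le_power)
  have xi: "\<bar>\<xi> * t\<bar> \<le> M^2 * Lt x" "\<bar>\<xi>^2 * t\<bar> \<le> M^2 * Lt x" "\<bar>t\<bar> \<le> M^2 * Lt x" if "\<bar>t\<bar> \<le> Lt x" for t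
  proof -
    have "\<bar>\<xi>\<bar>^2 \<le> M^2" using M_ge by (intro power_mono) auto
    then show "\<bar>\<xi>^2 * t\<bar> \<le> M^2 * Lt x" unfolding abs_mult using that by (intro mult_mono) auto
    have "\<bar>\<xi>\<bar> \<le> M^2" using M_ge M2 by linarith
    then show "\<bar>\<xi> * t\<bar> \<le> M^2 * Lt x" unfolding abs_mult using that by (intro mult_mono) auto
    have "1 * \<bar>t\<bar> \<le> M^2 * Lt x" using M2 that by (intro mult_mono) auto
    then show "\<bar>t\<bar> \<le> M^2 * Lt x" by simp
  qed
  note X0 = xi[OF e_le(1)[of x]] and X1 = xi[OF e_le(2)[of x]] and X2 = xi[OF e_le(3)[of x]]
  have nn: "0 \<le> M^2 * Lt x" using Lt_nonneg by simp
  show "\<bar>real_of_int (c0 x) - 1 * real_of_int (c0 x)\<bar> \<le> 3 * M^2 * Lt x" using nn by (simp add: mult.commute)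
  show "\<bar>real_of_int (c1 x) - \<xi> * real_of_int (c0 x)\<bar> \<le> 3 * M^2 * Lt x"
    using X0(3) nn unfolding e0_def by linarith
  have "real_of_int (c2 x) - \<xi>^2 * real_of_int (c0 x) = e1 x + \<xi> * e0 x"
    by (simp add: e0_def e1_def algebra_simps power2_eq_square)
  then show "\<bar>real_of_int (c2 x) - \<xi>^2 * real_of_int (c0 x)\<bar> \<le> 3 * M^2 * Lt x"
    using X0 X1 nn by linarith
  have "real_of_int (c3 x) - \<xi>^3 * real_of_int (c0 x) = e2 x + \<xi> * e1 x + \<xi>^2 * e0 x"
    by (simp add: e0_def e1_def e2_def algebra_simps power2_eq_square power3_eq_cube)
  then show "\<bar>real_of_int (c3 x) - \<xi>^3 * real_of_int (c0 x)\<bar> \<le> 3 * M^2 * Lt x"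
    using X0 X1 X2 nn by linarith
qed

lemma powers_le: "\<bar>1\<bar> \<le> M^3" "\<bar>\<xi>\<bar> \<le> M^3" "\<bar>\<xi>^2\<bar> \<le> M^3" "\<bar>\<xi>^3\<bar> \<le> M^3"
proof -
  have p: "M^i \<le> M^3" if "i \<le> 3" for i using M_ge(1) that by (intro power_increasing) auto
  show "\<bar>1\<bar> \<le> M^3" using p[of 0] by simp
  show "\<bar>\<xi>\<bar> \<le> M^3" using p[of 1] M_ge by simp
  have "\<bar>\<xi>\<bar>^2 \<le> M^2" using M_ge by (intro power_mono) auto
  then show "\<bar>\<xi>^2\<bar> \<le> M^3" using p[of 2] by simp
  have "\<bar>\<xi>\<bar>^3 \<le> M^3" using M_ge by (intro power_mono) auto
  then show "\<bar>\<xi>^3\<bar> \<le> M^3" by (simp add: power_abs)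
qed

text \<open>One generous constant for all estimates; only its logarithm matters later.\<close>

definition G :: real where "G = 1000 * M^10"

lemma G_ge: "1000 \<le> G" "1000 * M^i \<le> G" if "i \<le> 10" for i
proof -
  have "M^i \<le> M^10" using M_ge(1) that by (intro power_increasing) auto
  then show "1000 * M^i \<le> G" by (simp add: G_def)
  have "1 \<le> M^10" using M_ge(1) by simp
  then show "1000 \<le> G" by (simp add: G_def)
qed

text \<open>This bounds the height of the span of three points, \<open>z\<close> being the largest
  and most accurate one. The order hypotheses make \<open>Nm z * Lt x * Lt y\<close> dominate all
  four terms of \<open>det3_near_bound\<close>.\<close>

lemma nrm_le:
  assumes "Lt x \<le> Nm x" "Lt y \<le> Nm y" "Lt z \<le> Nm z"
    and "Nm x \<le> Nm z" "Nm y \<le> Nm z" "Lt z \<le> Lt x" "Lt z \<le> Lt y"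
  shows "mx (nrm x y z) \<le> G * (Nm z * Lt x * Lt y)"
proof -
  let ?B = "6 * ((3 * M^2 * Lt x) * (3 * M^2 * Lt y) * (3 * M^2 * Lt z))
     + 6 * (M^3 * Nm x * (3 * M^2 * Lt y) * (3 * M^2 * Lt z))
     + 6 * ((3 * M^2 * Lt x) * (M^3 * Nm y) * (3 * M^2 * Lt z))
     + 6 * ((3 * M^2 * Lt x) * (3 * M^2 * Lt y) * (M^3 * Nm z))"
  let ?T = "Nm z * Lt x * Lt y"
  note L0 = Lt_nonneg[of x] Lt_nonneg[of y] Lt_nonneg[of z]
  have N0: "0 \<le> Nm x" "0 \<le> Nm y" "0 \<le> Nm z" by (simp_all add: Nm_def)
  have dle: "\<bar>det3 (i x) (j x) (k x) (i y) (j y) (k y) (i z) (j z) (k z)\<bar> \<le> ?B"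
    if "\<And>p. \<bar>i p - ki * real_of_int (c0 p)\<bar> \<le> 3 * M^2 * Lt p"
      "\<And>p. \<bar>j p - kj * real_of_int (c0 p)\<bar> \<le> 3 * M^2 * Lt p"
      "\<And>p. \<bar>k p - kk * real_of_int (c0 p)\<bar> \<le> 3 * M^2 * Lt p"
      "\<bar>ki\<bar> \<le> M^3" "\<bar>kj\<bar> \<le> M^3" "\<bar>kk\<bar> \<le> M^3"
    for i j k :: "pt \<Rightarrow> real" and ki kj kk
    using det3_near_bound[OF that(4-6) that(1-3)[of x] that(1-3)[of y] that(1-3)[of z]]
    unfolding Nm_def by linarith
  have ri: "real_of_int (det3 a b c d e f g h i) = det3 (real_of_int a) (real_of_int b) (real_of_int c)
     (real_of_int d) (real_of_int e) (real_of_int f) (real_of_int g) (real_of_int h) (real_of_int i)"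
    for a b c d e f g h i by (simp add: det3_def)
  have "mx (nrm x y z) \<le> ?B"
    unfolding mx_def nrm_def pt.sel of_int_minus abs_minus_cancel ri
    using dle[OF coords_near(2,3,4) powers_le(2,3,4)] dle[OF coords_near(1,3,4) powers_le(1,3,4)]
        dle[OF coords_near(1,2,4) powers_le(1,2,4)] dle[OF coords_near(1,2,3) powers_le(1,2,3)]
    by (intro max.boundedI) assumption+
  also have "?B = 162 * M^6 * (Lt x * Lt y * Lt z) + 54 * M^7 * (Nm x * Lt y * Lt z)
     + 54 * M^7 * (Lt x * Nm y * Lt z) + 54 * M^7 * (Lt x * Lt y * Nm z)"
    by algebra
  also have "\<dots> \<le> 162 * M^7 * ?T + 54 * M^7 * ?T + 54 * M^7 * ?T + 54 * M^7 * ?T"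
  proof (rule add_mono[OF add_mono[OF add_mono]])
    have M67: "162 * M^6 \<le> 162 * M^7" using M_ge(1) by (intro mult_left_mono power_increasing) auto
    have 1: "Lt x * Lt y * Lt z \<le> Lt x * Lt y * Nm z" using L0 assms by (intro mult_left_mono) auto
    show "162 * M^6 * (Lt x * Lt y * Lt z) \<le> 162 * M^7 * ?T"
      by (rule mult_mono[OF M67]) (use 1 L0 M_ge in \<open>auto simp: mult_ac\<close>)
    have 2: "Nm x * Lt y * Lt z \<le> Nm z * Lt y * Lt x" using L0 N0 assms by (intro mult_mono) auto
    show "54 * M^7 * (Nm x * Lt y * Lt z) \<le> 54 * M^7 * ?T"
      by (rule mult_left_mono) (use 2 M_ge in \<open>auto simp: mult_ac\<close>)
    have 3: "Lt x * Nm y * Lt z \<le> Lt x * Nm z * Lt y" using L0 N0 assms by (intro mult_mono) auto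
    show "54 * M^7 * (Lt x * Nm y * Lt z) \<le> 54 * M^7 * ?T"
      by (rule mult_left_mono) (use 3 M_ge in \<open>auto simp: mult_ac\<close>)
    show "54 * M^7 * (Lt x * Lt y * Nm z) \<le> 54 * M^7 * ?T" by (simp add: mult_ac)
  qed
  also have "\<dots> = 324 * M^7 * ?T" by simp
  also have "\<dots> \<le> G * ?T"
  proof (rule mult_right_mono)
    have "1000 * M^7 \<le> G" by (rule G_ge) simp
    moreover have "0 \<le> M^7" using M_ge by simp
    ultimately show "324 * M^7 \<le> G" by linarith
  qed (use L0 N0 in auto)
  finally show ?thesis .
qed

definition form :: "pt \<Rightarrow> real" where
  "form f = real_of_int (c0 f) + real_of_int (c1 f) * \<xi> + real_of_int (c2 f) * \<xi>^2 + real_of_int (c3 f) * \<xi>^3"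

lemma dot_near: "\<bar>real_of_int (dot n p) - form n * real_of_int (c0 p)\<bar> \<le> 9 * M^2 * (mx n * Lt p)"
proof -
  define R where "R = real_of_int (c1 n) * (real_of_int (c1 p) - \<xi> * real_of_int (c0 p))
     + real_of_int (c2 n) * (real_of_int (c2 p) - \<xi>^2 * real_of_int (c0 p))
     + real_of_int (c3 n) * (real_of_int (c3 p) - \<xi>^3 * real_of_int (c0 p))"
  have *: "\<bar>u * v\<bar> \<le> 3 * M^2 * (mx n * Lt p)" if "\<bar>u\<bar> \<le> mx n" "\<bar>v\<bar> \<le> 3 * M^2 * Lt p" for u v
  proof -
    have "\<bar>u\<bar> * \<bar>v\<bar> \<le> mx n * (3 * M^2 * Lt p)" using that mx_nonneg by (intro mult_mono) auto
    then show ?thesis by (simp add: abs_mult mult_ac)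
  qed
  have "\<bar>R\<bar> \<le> 9 * M^2 * (mx n * Lt p)" unfolding R_def
    using *[OF mx_ge(2) coords_near(2)] *[OF mx_ge(3) coords_near(3)] *[OF mx_ge(4) coords_near(4)]
    by linarith
  moreover have "real_of_int (dot n p) - form n * real_of_int (c0 p) = R"
    by (simp add: form_def R_def dot_def algebra_simps)
  ultimately show ?thesis by simp
qed

lemma form_le:
  assumes "dot n y = 0"
  shows "\<bar>form n\<bar> * Nm y \<le> 9 * M^2 * (mx n * Lt y)"
  using dot_near[of n y] assms by (simp add: Nm_def abs_mult)

text \<open>If \<open>n\<close> annihilates the good approximation \<open>y\<close>, its value
  \<open>form n\<close> at (1, \<xi>, \<xi>^2, \<xi>^3) is tiny, so \<open>n\<close> is small on
  other approximations too. Combined with integrality this yields lower bounds for heights.\<close>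

lemma dot_le:
  assumes "dot n y = 0" "0 < Nm y" "Lt y / Nm y * Nm t \<le> T" "Lt t \<le> T"
  shows "\<bar>real_of_int (dot n t)\<bar> \<le> G * (mx n * T)"
proof -
  have Sle: "\<bar>form n\<bar> \<le> 9 * M^2 * mx n * (Lt y / Nm y)"
    using form_le[OF assms(1)] assms(2) by (simp add: field_simps)
  have "\<bar>real_of_int (dot n t)\<bar> \<le> \<bar>form n\<bar> * Nm t + 9 * M^2 * (mx n * Lt t)"
    using dot_near[of n t] unfolding Nm_def abs_mult[symmetric] by linarith
  also have "\<dots> \<le> 9 * M^2 * mx n * (Lt y / Nm y) * Nm t + 9 * M^2 * (mx n * Lt t)"
    by (intro add_mono mult_right_mono Sle order_refl) (simp add: Nm_def)
  also have "\<dots> = 9 * M^2 * mx n * (Lt y / Nm y * Nm t) + 9 * M^2 * mx n * Lt t" by (simp only: mult_ac)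
  also have "\<dots> \<le> 9 * M^2 * mx n * T + 9 * M^2 * mx n * T"
    using assms(3,4) mx_nonneg[of n] by (intro add_mono mult_left_mono) auto
  also have "\<dots> = 18 * M^2 * (mx n * T)" by simp
  also have "\<dots> \<le> G * (mx n * T)"
  proof (rule mult_right_mono)
    have "1000 * M^2 \<le> G" by (rule G_ge) simp
    moreover have "0 \<le> M^2" by simp
    ultimately show "18 * M^2 \<le> G" by linarith
    have "0 \<le> T" using assms(4) Lt_nonneg[of t] by linarith
    then show "0 \<le> mx n * T" using mx_nonneg by simp
  qed
  finally show ?thesis .
qed

text \<open>Subtract \<xi> times each column from the next one, and \<xi> times
  \<open>x\<^sup>-\<close> from \<open>x\<^sup>+\<close>. Afterwards only leading entries are large.
  For the error the last row becomes \<open>y\<^sup>+ - \<xi> y\<^sup>-\<close>, which has no large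
  entry at all.\<close>

lemma Cm_det: "real_of_int (Cm x y) = det3 (real_of_int (c0 x)) (e0 x) (e1 x)
    (e0 x) (e1 x - \<xi> * e0 x) (e2 x - \<xi> * e1 x) (real_of_int (c0 y)) (e0 y) (e1 y)"
  by (simp add: det3_def Cm_def w_defs e0_def e1_def e2_def algebra_simps)

lemma er_det: "\<xi> * real_of_int (Cm x y) - real_of_int (Cp x y) = - det3 (real_of_int (c0 x)) (e0 x) (e1 x)
    (e0 x) (e1 x - \<xi> * e0 x) (e2 x - \<xi> * e1 x) (e0 y) (e1 y - \<xi> * e0 y) (e2 y - \<xi> * e1 y)"
  by (simp add: det3_def Cm_def Cp_def w_defs e0_def e1_def e2_def algebra_simps)

lemma CC_le:
  assumes "Lt x \<le> Nm x"
  shows "er (CC x y) \<le> G * (Nm x * Lt x * Lt y)"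
    and "sz (CC x y) \<le> G * (Nm x * Lt x * Lt y + Lt x * Lt x * Nm y)"
proof -
  let ?h0 = "e1 x - \<xi> * e0 x" and ?h1 = "e2 x - \<xi> * e1 x" and ?k0 = "e1 y - \<xi> * e0 y" and ?k1 = "e2 y - \<xi> * e1 y"
  note L0 = Lt_nonneg[of x] Lt_nonneg[of y]
  have N0: "0 \<le> Nm x" "0 \<le> Nm y" by (simp_all add: Nm_def)
  have h: "\<bar>e1 p - \<xi> * e0 p\<bar> \<le> M * Lt p" "\<bar>e2 p - \<xi> * e1 p\<bar> \<le> M * Lt p" for p
  proof -
    have "\<bar>\<xi> * t\<bar> \<le> \<bar>\<xi>\<bar> * Lt p" if "\<bar>t\<bar> \<le> Lt p" for t using that by (simp add: abs_mult mult_left_mono)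
    from this[OF e_le(1)] this[OF e_le(2)] e_le[of p] show
      "\<bar>e1 p - \<xi> * e0 p\<bar> \<le> M * Lt p" "\<bar>e2 p - \<xi> * e1 p\<bar> \<le> M * Lt p"
      unfolding M_def by (simp_all add: algebra_simps)
  qed
  have expand: "det3 a b c d e f g h i = a * e * i - a * f * h - b * d * i + b * f * g + c * d * h - c * e * g"
    for a b c d e f g h i :: real by (simp add: det3_def algebra_simps)
  have cx: "\<bar>real_of_int (c0 x)\<bar> \<le> Nm x" "\<bar>real_of_int (c0 y)\<bar> \<le> Nm y" by (simp_all add: Nm_def)
  let ?T = "Nm x * Lt x * Lt y"
  have T: "Lt x * Lt x * Lt y \<le> ?T" using assms L0 by (intro mult_right_mono) auto
  have T0: "0 \<le> ?T" "0 \<le> Lt x * Lt x * Nm y" using L0 N0 by auto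
  note b = abs_mult3_le
  have M12: "1 \<le> M" "M \<le> M^2" "0 \<le> M" "1 \<le> M^2" using M_ge(1) by (auto intro: one_le_power self_le_power)
  have MT: "M * ?T \<le> M^2 * ?T" using M12 T0 by (intro mult_right_mono) auto
  have MT': "1 * ?T \<le> M^2 * ?T" using M12 T0 by (intro mult_right_mono) auto
  have MT'': "M * (Lt x * Lt x * Lt y) \<le> M^2 * ?T" by (rule mult_mono[OF M12(2) T]) (use L0 in auto)
  have ER: "er (CC x y) \<le> 6 * (M^2 * ?T)"
  proof -
    have "\<bar>det3 (real_of_int (c0 x)) (e0 x) (e1 x) (e0 x) ?h0 ?h1 (e0 y) ?k0 ?k1\<bar>
      \<le> Nm x * (M * Lt x) * (M * Lt y) + Nm x * (M * Lt x) * (M * Lt y) + Lt x * Lt x * (M * Lt y)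
       + Lt x * (M * Lt x) * Lt y + Lt x * Lt x * (M * Lt y) + Lt x * (M * Lt x) * Lt y"
      unfolding expand
      by (intro abs_sum6_le b cx h e_le)
    also have "\<dots> = 2 * (M^2 * ?T) + 4 * (M * (Lt x * Lt x * Lt y))" by (simp add: algebra_simps power2_eq_square)
    finally show ?thesis using MT'' unfolding er_def CC_def fst_conv snd_conv er_det by simp
  qed
  have CM: "\<bar>real_of_int (Cm x y)\<bar> \<le> 4 * (M^2 * ?T) + 2 * (M * (Lt x * Lt x * Nm y))"
  proof -
    have "\<bar>det3 (real_of_int (c0 x)) (e0 x) (e1 x) (e0 x) ?h0 ?h1 (real_of_int (c0 y)) (e0 y) (e1 y)\<bar>
      \<le> Nm x * (M * Lt x) * Lt y + Nm x * (M * Lt x) * Lt y + Lt x * Lt x * Lt y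
       + Lt x * (M * Lt x) * Nm y + Lt x * Lt x * Lt y + Lt x * (M * Lt x) * Nm y"
      unfolding expand
      by (intro abs_sum6_le b cx h e_le)
    also have "\<dots> = 2 * (M * ?T) + 2 * (Lt x * Lt x * Lt y) + 2 * (M * (Lt x * Lt x * Nm y))" by (simp add: algebra_simps)
    finally show ?thesis using MT MT' T unfolding Cm_det by linarith
  qed
  have G6: "6 * M^2 \<le> G" "10 * M^3 \<le> G"
    using G_ge(2)[of 2] G_ge(2)[of 3] M12 zero_le_power[of M 3] by linarith+
  show "er (CC x y) \<le> G * ?T"
    using ER mult_right_mono[OF G6(1) T0(1)] by simp
  let ?V = "Lt x * Lt x * Nm y"
  have "sz (CC x y) \<le> M * \<bar>real_of_int (Cm x y)\<bar> + er (CC x y)"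
    using sz_le[of "CC x y"] by (simp add: CC_def)
  also have "\<dots> \<le> M * (4 * (M^2 * ?T) + 2 * (M * ?V)) + 6 * (M^2 * ?T)"
    using CM ER M12 by (intro add_mono mult_left_mono) auto
  also have "\<dots> = 4 * M^3 * ?T + 2 * M^2 * ?V + 6 * M^2 * ?T" by algebra
  also have "\<dots> \<le> 4 * M^3 * ?T + 2 * M^3 * ?V + 6 * M^3 * ?T"
    using T0 M_ge(1) by (intro add_mono mult_right_mono mult_left_mono power_increasing) auto
  also have "\<dots> = 10 * M^3 * (?T + ?V) - 8 * (M^3 * ?V)" by algebra
  also have "\<dots> \<le> 10 * M^3 * (?T + ?V)" using T0 M12 by simp
  also have "\<dots> \<le> G * (?T + ?V)" using G6(2) T0 by (intro mult_right_mono) auto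
  finally show "sz (CC x y) \<le> G * (?T + ?V)" .
qed

end

section \<open>Minimal points\<close>

lemma finite_pt_box: "finite {x. \<bar>c0 x\<bar> \<le> B \<and> \<bar>c1 x\<bar> \<le> B \<and> \<bar>c2 x\<bar> \<le> B \<and> \<bar>c3 x\<bar> \<le> B}"
proof (rule finite_subset)
  show "{x. \<bar>c0 x\<bar> \<le> B \<and> \<bar>c1 x\<bar> \<le> B \<and> \<bar>c2 x\<bar> \<le> B \<and> \<bar>c3 x\<bar> \<le> B} \<subseteq>
    (\<lambda>(a, b, c, d). Pt a b c d) ` ({- B..B} \<times> {- B..B} \<times> {- B..B} \<times> {- B..B})"
  proof
    fix x assume "x \<in> {x. \<bar>c0 x\<bar> \<le> B \<and> \<bar>c1 x\<bar> \<le> B \<and> \<bar>c2 x\<bar> \<le> B \<and> \<bar>c3 x\<bar> \<le> B}"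
    then show "x \<in> (\<lambda>(a, b, c, d). Pt a b c d) ` ({- B..B} \<times> {- B..B} \<times> {- B..B} \<times> {- B..B})"
      by (intro image_eqI[of _ _ "(c0 x, c1 x, c2 x, c3 x)"]) auto
  qed
qed simp

context cubic_independent
begin

lemma exists_minimum:
  "\<exists>x. x \<noteq> nul \<and> Nm x \<le> real n \<and> (\<forall>y. y \<noteq> nul \<longrightarrow> Nm y \<le> real n \<longrightarrow> Lt x \<le> Lt y)"
proof -
  define S where "S = {x. x \<noteq> nul \<and> Nm x \<le> real n \<and> Lt x \<le> 1}"
  define R where "R = 3 * M^2 + M^3 * real n"
  have bound: "\<bar>i\<bar> \<le> \<lceil>R\<rceil>"
    if "\<bar>real_of_int i - k * real_of_int (c0 x)\<bar> \<le> 3 * M^2 * Lt x" "\<bar>k\<bar> \<le> M^3" "x \<in> S" for i k x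
  proof -
    have "3 * M^2 * Lt x \<le> 3 * M^2 * 1" using that(3) by (intro mult_left_mono) (auto simp: S_def)
    moreover have "\<bar>k * real_of_int (c0 x)\<bar> \<le> M^3 * real n"
      using that(2,3) M_ge unfolding abs_mult by (intro mult_mono) (auto simp: S_def Nm_def)
    ultimately have "\<bar>real_of_int i\<bar> \<le> R" using that(1) unfolding R_def by linarith
    then have "real_of_int \<bar>i\<bar> \<le> real_of_int \<lceil>R\<rceil>" using le_of_int_ceiling[of R] by linarith
    then show ?thesis by linarith
  qed
  have "S \<subseteq> {x. \<bar>c0 x\<bar> \<le> \<lceil>R\<rceil> \<and> \<bar>c1 x\<bar> \<le> \<lceil>R\<rceil> \<and> \<bar>c2 x\<bar> \<le> \<lceil>R\<rceil> \<and> \<bar>c3 x\<bar> \<le> \<lceil>R\<rceil>}"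
    using bound[OF coords_near(1) powers_le(1)] bound[OF coords_near(2) powers_le(2)]
      bound[OF coords_near(3) powers_le(3)] bound[OF coords_near(4) powers_le(4)] by blast
  then have "finite S" using finite_pt_box finite_subset by blast
  \<comment> \<open>This point has norm 0 and error 1, so it is admissible for every
    \<open>n\<close>, and the search may be confined to the finite set of points with error at most
    1.\<close>
  moreover have "Pt 0 0 0 1 \<in> S"
    by (simp add: S_def nul_def Nm_def Lt_def e0_def e1_def e2_def)
  ultimately obtain x where "is_arg_min Lt (\<lambda>x. x \<in> S) x"
    using ex_is_arg_min_if_finite by blast
  then have x: "x \<in> S" "\<And>y. y \<in> S \<Longrightarrow> Lt x \<le> Lt y" by (auto simp: is_arg_min_linorder)
  show ?thesis
  proof (intro exI[of _ x] conjI allI impI)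
    show "x \<noteq> nul" "Nm x \<le> real n" using x(1) by (simp_all add: S_def)
    fix y assume y: "y \<noteq> nul" "Nm y \<le> real n"
    show "Lt x \<le> Lt y"
    proof (cases "Lt y \<le> 1")
      case True then show ?thesis using y x(2) by (simp add: S_def)
    next
      case False then show ?thesis using x(1) by (simp add: S_def)
    qed
  qed
qed

lemma constant_between:
  fixes f :: "nat \<Rightarrow> real"
  assumes "m \<le> n" "\<And>k. m \<le> k \<Longrightarrow> k < n \<Longrightarrow> f (Suc k) = f k"
  shows "f n = f m"
  using assms(1)
proof (induction rule: dec_induct)
  case (step k)
  show ?case by (rule trans[OF assms(2)[OF step.hyps] step.IH])
qed (rule refl)

text \<open>The least error \<open>f n\<close> among points of norm at most \<open>n\<close> is a
  step function tending to 0. Minimal points are the minimizers at its jumps; since norms are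
  integers, the norm of such a minimizer equals the position of the jump.\<close>

lemma minimal_sequence:
  assumes hyp: "\<forall>\<^sub>F X in at_top. \<exists>x. x \<noteq> nul \<and> Nm x \<le> X \<and> Lt x \<le> c * X powr - lam"
    and c: "c > 0" and lam: "lam > 0"
  obtains x c' where "c' > 0" "\<And>i. 1 \<le> Nm (x i)" "\<And>i. Nm (x i) < Nm (x (Suc i))"
    "\<And>i. Lt (x (Suc i)) < Lt (x i)" "\<And>i. Lt (x i) \<le> 1"
    "\<And>i y. y \<noteq> nul \<Longrightarrow> Nm y < Nm (x (Suc i)) \<Longrightarrow> Lt (x i) \<le> Lt y"
    "\<And>i. Lt (x i) \<le> c' * Nm (x (Suc i)) powr - lam"
proof -
  obtain g where g: "g n \<noteq> nul" "Nm (g n) \<le> real n" "\<And>y. y \<noteq> nul \<Longrightarrow> Nm y \<le> real n \<Longrightarrow> Lt (g n) \<le> Lt y" for n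
    using exists_minimum by metis
  define f where "f n = Lt (g n)" for n
  have fpos: "0 < f n" for n using Lt_pos g(1) by (simp add: f_def)
  have mono: "f n \<le> f m" if "m \<le> n" for m n
    unfolding f_def using g(3)[of "g m" n] g(1,2)[of m] that by force
  have "\<forall>\<^sub>F n in sequentially. \<exists>x. x \<noteq> nul \<and> Nm x \<le> real n \<and> Lt x \<le> c * real n powr - lam"
    using eventually_compose_filterlim[OF hyp filterlim_real_sequentially] .
  then have ev: "\<forall>\<^sub>F n in sequentially. f n \<le> c * real n powr - lam"
    by eventually_elim (metis f_def g(3) order_trans)
  have lim0: "(\<lambda>n. c * real n powr - lam) \<longlonglongrightarrow> 0"
    using lam by (intro tendsto_mult_right_zero tendsto_neg_powr filterlim_real_sequentially) auto
  have lim: "f \<longlonglongrightarrow> 0"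
  proof (rule tendsto_sandwich[OF _ ev tendsto_const lim0])
    show "\<forall>\<^sub>F n in sequentially. 0 \<le> f n" using fpos less_imp_le by (intro always_eventually) blast
  qed
  have "\<forall>\<^sub>F n in sequentially. f n < 1" using order_tendstoD(2)[OF lim, of 1] by simp
  with ev have "\<forall>\<^sub>F n in sequentially. f n \<le> c * real n powr - lam \<and> f n < 1" by eventually_elim simp
  then obtain N0 where N0: "\<And>n. n \<ge> N0 \<Longrightarrow> f n \<le> c * real n powr - lam" "\<And>n. n \<ge> N0 \<Longrightarrow> f n < 1"
    unfolding eventually_sequentially by blast
  \<comment> \<open>Jumps start beyond \<open>Suc N0\<close> so that the decay estimate is available
    also at \<open>n - 1\<close>.\<close>
  define J where "J = {n. n > Suc N0 \<and> f n < f (n - 1)}"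
  have nojump: "f n = f m" if "m \<le> n" "Suc N0 \<le> m" "\<And>k. m < k \<Longrightarrow> k \<le> n \<Longrightarrow> k \<notin> J" for m n
  proof (rule constant_between[OF that(1)])
    fix k assume k: "m \<le> k" "k < n"
    have "Suc k \<notin> J" by (rule that(3)) (use k in linarith)+
    moreover have "Suc k > Suc N0" using k(1) that(2) by linarith
    ultimately have "\<not> f (Suc k) < f (Suc k - 1)" unfolding J_def mem_Collect_eq by blast
    then show "f (Suc k) = f k" using mono[of k "Suc k"] by (simp only: diff_Suc_1) linarith
  qed
  have inf: "infinite J"
  proof
    assume "finite J"
    then obtain B where B: "\<And>k. k \<in> J \<Longrightarrow> k \<le> B" 
      unfolding finite_nat_set_iff_bounded_le by blast
    define m where "m = max B (Suc N0)"
    have "f n = f m" if "n \<ge> m" for n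
    proof (rule nojump[OF that])
      show "Suc N0 \<le> m" by (simp add: m_def)
      show "k \<notin> J" if "m < k" for k using B[of k] that by (auto simp: m_def)
    qed
    then have "\<forall>\<^sub>F n in sequentially. f n = f m" unfolding eventually_sequentially by blast
    then have "f \<longlonglongrightarrow> f m" by (rule tendsto_eventually)
    then have "0 = f m" by (rule LIMSEQ_unique[OF lim])
    then show False using fpos[of m] by simp
  qed
  define X where "X = enumerate J"
  have XJ: "X i \<in> J" for i unfolding X_def by (rule enumerate_in_set[OF inf])
  have Xmono: "X i < X (Suc i)" for i unfolding X_def using enumerate_step[OF inf] .
  have Xnot: "k \<notin> J" if "X i < k" "k < X (Suc i)" for i k
    using that not_less_Least[of k "\<lambda>s. s \<in> J \<and> enumerate J i < s"] enumerate_Suc''[OF inf, of i]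
    unfolding X_def by auto
  have Xge: "X i > Suc N0" for i using XJ[of i] by (simp add: J_def)
  have fX: "f (X (Suc i) - 1) = f (X i)" for i
    using Xmono[of i] Xge[of i] Xnot[of i] by (intro nojump) auto
  have norm: "Nm (g (X i)) = real (X i)" for i
  proof (rule ccontr)
    assume "Nm (g (X i)) \<noteq> real (X i)"
    then have "Nm (g (X i)) < real (X i)" using g(2)[of "X i"] by simp
    then have "\<bar>c0 (g (X i))\<bar> \<le> int (X i - 1)" using Xge[of i] unfolding Nm_def by linarith
    then have "Nm (g (X i)) \<le> real (X i - 1)" unfolding Nm_def by linarith
    then have "f (X i - 1) \<le> f (X i)" unfolding f_def using g(1,3) by blast
    then show False using XJ[of i] by (simp add: J_def)
  qed
  \<comment> \<open>The error of one minimal point persists up to one below the norm X of the next.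
    As X - 1 is at least X/2, this costs the factor \<open>2 powr lam\<close>.\<close>
  show thesis
  proof (rule that[of "c * 2 powr lam" "\<lambda>i. g (X i)"])
    show "0 < c * 2 powr lam" using c by simp
    fix i
    show "1 \<le> Nm (g (X i))" using norm Xge[of i] by simp
    show "Nm (g (X i)) < Nm (g (X (Suc i)))" using norm Xmono[of i] by simp
    show "Lt (g (X (Suc i))) < Lt (g (X i))" using XJ[of "Suc i"] fX[of i] by (simp add: J_def f_def)
    show "Lt (g (X i)) \<le> 1" using N0(2)[of "X i"] Xge[of i] by (simp add: f_def)
    show "Lt (g (X i)) \<le> Lt y" if "y \<noteq> nul" "Nm y < Nm (g (X (Suc i)))" for y
    proof -
      have "\<bar>c0 y\<bar> \<le> int (X (Suc i) - 1)" using that(2) Xge[of "Suc i"] unfolding norm unfolding Nm_def by linarith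
      then have "Nm y \<le> real (X (Suc i) - 1)" unfolding Nm_def by linarith
      from g(3)[OF that(1) this] show ?thesis using fX[of i] by (simp add: f_def)
    qed
    have "Lt (g (X i)) = f (X (Suc i) - 1)" using fX[of i] by (simp add: f_def)
    also have "\<dots> \<le> c * real (X (Suc i) - 1) powr - lam" using Xge[of "Suc i"] by (intro N0) auto
    also have "\<dots> \<le> c * (real (X (Suc i)) / 2) powr - lam"
      using c lam Xge[of "Suc i"] by (intro mult_left_mono powr_mono2') auto
    also have "\<dots> = c * 2 powr lam * real (X (Suc i)) powr - lam"
      by (simp add: powr_divide powr_minus field_simps)
    finally show "Lt (g (X i)) \<le> c * 2 powr lam * Nm (g (X (Suc i))) powr - lam" by (simp add: norm)
  qed
qed

end

section \<open>Bases of planes formed by consecutive minimal points\<close>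

definition lat :: "pt \<Rightarrow> pt \<Rightarrow> pt \<Rightarrow> bool" where "lat a b p \<longleftrightarrow> (\<exists>r s. p = cmb r a s b)"

lemma lat_refl: "lat a b a" "lat a b b"
proof -
  have "a = cmb 1 a 0 b" "b = cmb 0 a 1 b" by (simp_all add: pt_eq_iff)
  then show "lat a b a" "lat a b b" unfolding lat_def by blast+
qed

lemma lat_trans: "lat a b c \<Longrightarrow> lat a b d \<Longrightarrow> lat c d p \<Longrightarrow> lat a b p"
proof -
  assume "lat a b c" "lat a b d" "lat c d p"
  then obtain r s r' s' m n where "c = cmb r a s b" "d = cmb r' a s' b" "p = cmb m c n d"
    unfolding lat_def by blast
  then have "p = cmb (m * r + n * r') a (m * s + n * s') b" by (simp add: pt_eq_iff algebra_simps)
  then show ?thesis unfolding lat_def by blast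
qed

lemma real_combination:
  assumes "c0 a \<noteq> 0" "nrm a b p = nul"
    and "\<not> (c0 a * c1 b = c1 a * c0 b \<and> c0 a * c2 b = c2 a * c0 b \<and> c0 a * c3 b = c3 a * c0 b)"
  obtains r s :: real where
    "real_of_int (c0 p) = r * c0 a + s * c0 b" "real_of_int (c1 p) = r * c1 a + s * c1 b"
    "real_of_int (c2 p) = r * c2 a + s * c2 b" "real_of_int (c3 p) = r * c3 a + s * c3 b"
proof -
  have Z: "c1 a * (c2 b * c3 p - c3 b * c2 p) - c2 a * (c1 b * c3 p - c3 b * c1 p) + c3 a * (c1 b * c2 p - c2 b * c1 p) = 0"
    "c0 a * (c2 b * c3 p - c3 b * c2 p) - c2 a * (c0 b * c3 p - c3 b * c0 p) + c3 a * (c0 b * c2 p - c2 b * c0 p) = 0"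
    "c0 a * (c1 b * c3 p - c3 b * c1 p) - c1 a * (c0 b * c3 p - c3 b * c0 p) + c3 a * (c0 b * c1 p - c1 b * c0 p) = 0"
    "c0 a * (c1 b * c2 p - c2 b * c1 p) - c1 a * (c0 b * c2 p - c2 b * c0 p) + c2 a * (c0 b * c1 p - c1 b * c0 p) = 0"
    using assms(2) by (simp_all add: nrm_def nul_def det3_def)
  have sol: "real_of_int k = real_of_int (p0 * bq - pq * b0) / real_of_int D * real_of_int ka
      + real_of_int (a0 * pq - aq * p0) / real_of_int D * real_of_int kb"
    if "D \<noteq> 0" "D * k = (p0 * bq - pq * b0) * ka + (a0 * pq - aq * p0) * kb" for D k ka kb p0 bq pq b0 a0 aq
  proof -
    have "real_of_int D * real_of_int k = real_of_int (p0 * bq - pq * b0) * real_of_int ka + real_of_int (a0 * pq - aq * p0) * real_of_int kb"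
      using arg_cong[OF that(2), of real_of_int] by simp
    then show ?thesis using that(1) by (simp add: field_simps del: of_int_diff of_int_mult)
  qed
  consider "c0 a * c1 b - c1 a * c0 b \<noteq> 0" | "c0 a * c2 b - c2 a * c0 b \<noteq> 0" | "c0 a * c3 b - c3 a * c0 b \<noteq> 0"
    using assms(3) by auto
  then show thesis
  proof cases
    case 1
    have k0: "(c0 a * c1 b - c1 a * c0 b) * c0 p = (c0 p * c1 b - c1 p * c0 b) * c0 a + (c0 a * c1 p - c1 a * c0 p) * c0 b"
      by (simp add: algebra_simps)
    have k1: "(c0 a * c1 b - c1 a * c0 b) * c1 p = (c0 p * c1 b - c1 p * c0 b) * c1 a + (c0 a * c1 p - c1 a * c0 p) * c1 b"
      by (simp add: algebra_simps)
    have k2: "(c0 a * c1 b - c1 a * c0 b) * c2 p = (c0 p * c1 b - c1 p * c0 b) * c2 a + (c0 a * c1 p - c1 a * c0 p) * c2 b"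
      using Z(4) by (simp add: algebra_simps)
    have k3: "(c0 a * c1 b - c1 a * c0 b) * c3 p = (c0 p * c1 b - c1 p * c0 b) * c3 a + (c0 a * c1 p - c1 a * c0 p) * c3 b"
      using Z(3) by (simp add: algebra_simps)
    note sol[OF 1 k0] sol[OF 1 k1] sol[OF 1 k2] sol[OF 1 k3]
    then show thesis by (rule that)
  next
    case 2
    have k0: "(c0 a * c2 b - c2 a * c0 b) * c0 p = (c0 p * c2 b - c2 p * c0 b) * c0 a + (c0 a * c2 p - c2 a * c0 p) * c0 b"
      by (simp add: algebra_simps)
    have k1: "(c0 a * c2 b - c2 a * c0 b) * c1 p = (c0 p * c2 b - c2 p * c0 b) * c1 a + (c0 a * c2 p - c2 a * c0 p) * c1 b"
      using Z(4) by (simp add: algebra_simps)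
    have k2: "(c0 a * c2 b - c2 a * c0 b) * c2 p = (c0 p * c2 b - c2 p * c0 b) * c2 a + (c0 a * c2 p - c2 a * c0 p) * c2 b"
      by (simp add: algebra_simps)
    have k3: "(c0 a * c2 b - c2 a * c0 b) * c3 p = (c0 p * c2 b - c2 p * c0 b) * c3 a + (c0 a * c2 p - c2 a * c0 p) * c3 b"
      using Z(2) by (simp add: algebra_simps)
    note sol[OF 2 k0] sol[OF 2 k1] sol[OF 2 k2] sol[OF 2 k3]
    then show thesis by (rule that)
  next
    case 3
    have k0: "(c0 a * c3 b - c3 a * c0 b) * c0 p = (c0 p * c3 b - c3 p * c0 b) * c0 a + (c0 a * c3 p - c3 a * c0 p) * c0 b"
      by (simp add: algebra_simps)
    have k1: "(c0 a * c3 b - c3 a * c0 b) * c1 p = (c0 p * c3 b - c3 p * c0 b) * c1 a + (c0 a * c3 p - c3 a * c0 p) * c1 b"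
      using Z(3) by (simp add: algebra_simps)
    have k2: "(c0 a * c3 b - c3 a * c0 b) * c2 p = (c0 p * c3 b - c3 p * c0 b) * c2 a + (c0 a * c3 p - c3 a * c0 p) * c2 b"
      using Z(2) by (simp add: algebra_simps)
    have k3: "(c0 a * c3 b - c3 a * c0 b) * c3 p = (c0 p * c3 b - c3 p * c0 b) * c3 a + (c0 a * c3 p - c3 a * c0 p) * c3 b"
      by (simp add: algebra_simps)
    note sol[OF 3 k0] sol[OF 3 k1] sol[OF 3 k2] sol[OF 3 k3]
    then show thesis by (rule that)
  qed
qed

lemma nrm_cyclic: "nrm y z x = nrm x y z"
  by (simp add: nrm_def det3_def algebra_simps)

locale minimal_points = cubic_independent +
  fixes x :: "nat \<Rightarrow> pt" and c :: real
  assumes c_pos: "c > 0"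
    and norm_ge1: "1 \<le> Nm (x i)"
    and norm_Suc: "Nm (x i) < Nm (x (Suc i))"
    and Lt_Suc: "Lt (x (Suc i)) < Lt (x i)"
    and Lt_le1: "Lt (x i) \<le> 1"
    and minimal: "y \<noteq> nul \<Longrightarrow> Nm y < Nm (x (Suc i)) \<Longrightarrow> Lt (x i) \<le> Lt y"
    and decay: "Lt (x i) \<le> c * Nm (x (Suc i)) powr - (849/2000)"
begin

lemma Lt_cases: "Lt y = \<bar>e0 y\<bar> \<or> Lt y = \<bar>e1 y\<bar> \<or> Lt y = \<bar>e2 y\<bar>"
  by (auto simp: Lt_def max_def)

lemma norm_mono: "i \<le> j \<Longrightarrow> Nm (x i) \<le> Nm (x j)"
  by (rule lift_Suc_mono_le[of "\<lambda>i. Nm (x i)"]) (use norm_Suc less_imp_le in auto)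

lemma Lt_antimono: "i \<le> j \<Longrightarrow> Lt (x j) \<le> Lt (x i)"
  by (rule lift_Suc_antimono_le[of "\<lambda>i. Lt (x i)"]) (use Lt_Suc less_imp_le in auto)

lemma x_nonzero: "c0 (x i) \<noteq> 0" "x i \<noteq> nul"
  using norm_ge1[of i] by (auto simp: Nm_def)

lemma Lt_x_pos: "0 < Lt (x i)" by (rule Lt_pos[OF x_nonzero(2)])

lemma norm_ge_index: "real i < Nm (x i)"
proof (induction i)
  case 0 then show ?case using norm_ge1[of 0] by simp
next
  case (Suc i)
  then have "int i < \<bar>c0 (x i)\<bar>" unfolding Nm_def by linarith
  moreover have "\<bar>c0 (x i)\<bar> < \<bar>c0 (x (Suc i))\<bar>" using norm_Suc[of i] unfolding Nm_def by linarith
  ultimately have "int (Suc i) < \<bar>c0 (x (Suc i))\<bar>" by linarith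
  then show ?case unfolding Nm_def by linarith
qed

lemma norm_at_top: "filterlim (\<lambda>i. Nm (x i)) at_top sequentially"
  by (rule filterlim_at_top_mono[OF filterlim_real_sequentially]) (simp add: norm_ge_index less_imp_le)

lemma Lt_tendsto_0: "(\<lambda>i. Lt (x i)) \<longlonglongrightarrow> 0"
proof (rule tendsto_sandwich[OF _ _ tendsto_const])
  show "\<forall>\<^sub>F i in sequentially. Lt (x i) \<le> c * Nm (x (Suc i)) powr - (849/2000)" using decay by simp
  show "(\<lambda>i. c * Nm (x (Suc i)) powr - (849/2000)) \<longlonglongrightarrow> 0"
    by (intro tendsto_mult_right_zero tendsto_neg_powr filterlim_compose[OF norm_at_top filterlim_Suc]) auto
qed (simp add: Lt_nonneg)

text \<open>Proportional points would have errors proportional to their norms, whereas here the norm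
  grows and the error drops.\<close>

lemma not_proportional:
  "\<not> (c0 (x i) * c1 (x (Suc i)) = c1 (x i) * c0 (x (Suc i)) \<and> c0 (x i) * c2 (x (Suc i)) = c2 (x i) * c0 (x (Suc i)) \<and>
      c0 (x i) * c3 (x (Suc i)) = c3 (x i) * c0 (x (Suc i)))"
proof
  let ?a = "x i" and ?b = "x (Suc i)"
  assume *: "c0 ?a * c1 ?b = c1 ?a * c0 ?b \<and> c0 ?a * c2 ?b = c2 ?a * c0 ?b \<and> c0 ?a * c3 ?b = c3 ?a * c0 ?b"
  then have "real_of_int (c0 ?a) * real_of_int (c1 ?b) = real_of_int (c1 ?a) * real_of_int (c0 ?b)"
    "real_of_int (c0 ?a) * real_of_int (c2 ?b) = real_of_int (c2 ?a) * real_of_int (c0 ?b)"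
    "real_of_int (c0 ?a) * real_of_int (c3 ?b) = real_of_int (c3 ?a) * real_of_int (c0 ?b)"
    by (simp_all flip: of_int_mult)
  then have "real_of_int (c0 ?a) * e0 ?b = e0 ?a * real_of_int (c0 ?b)"
    "real_of_int (c0 ?a) * e1 ?b = e1 ?a * real_of_int (c0 ?b)"
    "real_of_int (c0 ?a) * e2 ?b = e2 ?a * real_of_int (c0 ?b)"
    by (simp_all add: e0_def e1_def e2_def algebra_simps)
  then have "\<bar>e0 ?a\<bar> * Nm ?b = \<bar>e0 ?b\<bar> * Nm ?a" "\<bar>e1 ?a\<bar> * Nm ?b = \<bar>e1 ?b\<bar> * Nm ?a" "\<bar>e2 ?a\<bar> * Nm ?b = \<bar>e2 ?b\<bar> * Nm ?a"
    unfolding Nm_def abs_mult[symmetric] by (simp_all add: mult.commute)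
  moreover have "\<bar>e0 ?b\<bar> * Nm ?a \<le> Lt ?b * Nm ?a" "\<bar>e1 ?b\<bar> * Nm ?a \<le> Lt ?b * Nm ?a" "\<bar>e2 ?b\<bar> * Nm ?a \<le> Lt ?b * Nm ?a"
    using e_le[of ?b] by (simp_all add: Nm_def mult_right_mono)
  moreover note Lt_cases[of ?a]
  ultimately have "Lt ?a * Nm ?b \<le> Lt ?b * Nm ?a" by auto
  moreover have "Lt ?b * Nm ?a < Lt ?a * Nm ?b"
    using Lt_Suc[of i] norm_Suc[of i] Lt_x_pos norm_ge1[of i] by (intro mult_strict_mono) auto
  ultimately show False by simp
qed

text \<open>Subtracting the combination with rounded coefficients leaves coefficients of absolute
  value at most 1/2. The remainder has norm below that of \<open>x (Suc i)\<close> and error below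
  that of \<open>x i\<close>, so by minimality it is zero.\<close>

lemma lattice_basis:
  assumes "nrm (x i) (x (Suc i)) p = nul"
  shows "lat (x i) (x (Suc i)) p"
proof -
  let ?a = "x i" and ?b = "x (Suc i)"
  obtain r s :: real where rs: "real_of_int (c0 p) = r * c0 ?a + s * c0 ?b" "real_of_int (c1 p) = r * c1 ?a + s * c1 ?b"
    "real_of_int (c2 p) = r * c2 ?a + s * c2 ?b" "real_of_int (c3 p) = r * c3 ?a + s * c3 ?b"
    by (rule real_combination[OF x_nonzero(1) assms not_proportional])
  define r' s' where "r' = r - round r" "s' = s - round s"
  have h: "\<bar>r'\<bar> \<le> 1/2" "\<bar>s'\<bar> \<le> 1/2"
    using of_int_round_abs_le[of r] of_int_round_abs_le[of s] unfolding r'_s'_def by (simp_all add: abs_minus_commute)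
  define q where "q = cmb 1 p (-1) (cmb (round r) ?a (round s) ?b)"
  have q: "real_of_int (c0 q) = r' * c0 ?a + s' * c0 ?b" "real_of_int (c1 q) = r' * c1 ?a + s' * c1 ?b"
    "real_of_int (c2 q) = r' * c2 ?a + s' * c2 ?b" "real_of_int (c3 q) = r' * c3 ?a + s' * c3 ?b"
    unfolding q_def r'_s'_def by (simp_all add: rs algebra_simps)
  have half: "2 * \<bar>r' * u + s' * v\<bar> \<le> \<bar>u\<bar> + \<bar>v\<bar>" for u v
  proof -
    have "\<bar>r' * u\<bar> \<le> 1/2 * \<bar>u\<bar>" "\<bar>s' * v\<bar> \<le> 1/2 * \<bar>v\<bar>" using h by (simp_all only: abs_mult mult_right_mono abs_ge_zero)
    then show ?thesis using abs_triangle_ineq[of "r' * u" "s' * v"] by linarith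
  qed
  have "2 * Nm q \<le> Nm ?a + Nm ?b" unfolding Nm_def q by (rule half)
  then have "Nm q < Nm ?b" using norm_Suc[of i] by linarith
  moreover have "Lt q < Lt ?a"
  proof -
    have e: "e0 q = r' * e0 ?a + s' * e0 ?b" "e1 q = r' * e1 ?a + s' * e1 ?b" "e2 q = r' * e2 ?a + s' * e2 ?b"
      by (simp_all add: e0_def e1_def e2_def q algebra_simps)
    have *: "2 * \<bar>r' * u + s' * v\<bar> \<le> Lt ?a + Lt ?b" if "\<bar>u\<bar> \<le> Lt ?a" "\<bar>v\<bar> \<le> Lt ?b" for u v
      using half[of u v] that by linarith
    have "2 * \<bar>e0 q\<bar> \<le> Lt ?a + Lt ?b" "2 * \<bar>e1 q\<bar> \<le> Lt ?a + Lt ?b" "2 * \<bar>e2 q\<bar> \<le> Lt ?a + Lt ?b"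
      unfolding e by (rule *[OF e_le(1) e_le(1)] *[OF e_le(2) e_le(2)] *[OF e_le(3) e_le(3)])+
    then have "2 * Lt q \<le> Lt ?a + Lt ?b" using Lt_cases[of q] by metis
    then show ?thesis using Lt_Suc[of i] by linarith
  qed
  ultimately have "q = nul" using minimal[of q i] by fastforce
  then have "p = cmb (round r) ?a (round s) ?b" unfolding q_def by (simp add: pt_eq_iff)
  then show ?thesis unfolding lat_def by blast
qed

lemma form_vanishing:
  assumes "\<And>i. i \<ge> n \<Longrightarrow> dot f (x i) = 0"
  shows "f = nul"
proof (rule independent)
  have "\<bar>form f\<bar> \<le> 9 * M^2 * mx f * Lt (x i)" if "i \<ge> n" for i
  proof -
    have "\<bar>form f\<bar> * 1 \<le> \<bar>form f\<bar> * Nm (x i)" using norm_ge1 by (intro mult_left_mono) auto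
    then show ?thesis using form_le[OF assms[OF that]] by simp
  qed
  then have "\<forall>\<^sub>F i in sequentially. \<bar>form f\<bar> \<le> 9 * M^2 * mx f * Lt (x i)"
    unfolding eventually_sequentially by blast
  moreover have "(\<lambda>i. 9 * M^2 * mx f * Lt (x i)) \<longlonglongrightarrow> 0"
    using tendsto_mult_right_zero[OF Lt_tendsto_0] by simp
  ultimately have "\<bar>form f\<bar> \<le> 0"
    by (intro tendsto_le[OF _ _ tendsto_const]) auto
  then show "real_of_int (c0 f) + real_of_int (c1 f) * \<xi> + real_of_int (c2 f) * \<xi>\<^sup>2 + real_of_int (c3 f) * \<xi> ^ 3 = 0"
    by (simp add: form_def)
qed

text \<open>Otherwise all later points stay in the plane of two of them. A nonzero integral form
  vanishing on that plane would vanish at (1, \<xi>, \<xi>^2, \<xi>^3).\<close>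

lemma infinitely_many_independent: "\<exists>i\<ge>n. nrm (x i) (x (Suc i)) (x (Suc (Suc i))) \<noteq> nul"
proof (rule ccontr)
  assume "\<not> ?thesis"
  then have z: "nrm (x i) (x (Suc i)) (x (Suc (Suc i))) = nul" if "i \<ge> n" for i using that by blast
  let ?a = "x n" and ?b = "x (Suc n)"
  have "\<exists>e. nrm ?a ?b e \<noteq> nul"
  proof -
    consider "c0 ?a * c1 ?b \<noteq> c1 ?a * c0 ?b" | "c0 ?a * c2 ?b \<noteq> c2 ?a * c0 ?b" | "c0 ?a * c3 ?b \<noteq> c3 ?a * c0 ?b"
      using not_proportional[of n] by blast
    then show ?thesis
    proof cases
      case 1 then show ?thesis by (intro exI[of _ "Pt 0 0 1 0"]) (auto simp: pt_eq_iff nrm_def det3_def)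
    next
      case 2 then show ?thesis by (intro exI[of _ "Pt 0 1 0 0"]) (auto simp: pt_eq_iff nrm_def det3_def)
    next
      case 3 then show ?thesis by (intro exI[of _ "Pt 0 1 0 0"]) (auto simp: pt_eq_iff nrm_def det3_def)
    qed
  qed
  then obtain e where e: "nrm ?a ?b e \<noteq> nul" by blast
  define f where "f = nrm ?a ?b e"
  have "dot f (x i) = 0 \<and> dot f (x (Suc i)) = 0" if "i \<ge> n" for i
    using that
  proof (induction i rule: dec_induct)
    case base
    show ?case unfolding f_def by simp
  next
    case (step i)
    have "lat (x i) (x (Suc i)) (x (Suc (Suc i)))" by (rule lattice_basis[OF z[OF step.hyps(1)]])
    then obtain r s where "x (Suc (Suc i)) = cmb r (x i) s (x (Suc i))" unfolding lat_def by blast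
    then have "dot f (x (Suc (Suc i))) = r * dot f (x i) + s * dot f (x (Suc i))" by (simp only: dot_cmb)
    with step.IH show ?case by simp
  qed
  then have "f = nul" using form_vanishing[of n f] by simp
  then show False using e by (simp add: f_def)
qed

end

text \<open>The three entries \<open>fst p * x\<^sub>j\<^sub>+\<^sub>1 - snd p * x\<^sub>j\<close> measure how well the rational number \<open>snd p / fst p\<close>
  fits the point \<open>x\<close>.\<close>

definition con :: "int \<times> int \<Rightarrow> pt \<Rightarrow> int \<times> int \<times> int" where
  "con p x = (fst p * c1 x - snd p * c0 x, fst p * c2 x - snd p * c1 x, fst p * c3 x - snd p * c2 x)"

lemma con_zeroD:
  assumes "con p x = (0, 0, 0)"
  shows "fst p * c1 x = snd p * c0 x" "fst p * c2 x = snd p * c1 x" "fst p * c3 x = snd p * c2 x"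
  using assms by (simp_all add: con_def)

lemma con_zero_degen:
  assumes "con p x = (0, 0, 0)" "fst p \<noteq> 0"
  shows "degen x"
proof -
  note z = con_zeroD[OF assms(1)]
  have "fst p * wa x = 0" "fst p * wb x = 0" "fst p * wc x = 0"
    unfolding w_defs using z by algebra+
  then show ?thesis using assms(2) by (simp add: degen_def)
qed

lemma con_zero_proportional:
  assumes "con p x = (0, 0, 0)" "con p y = (0, 0, 0)" "fst p \<noteq> 0"
  shows "c0 x * c1 y = c1 x * c0 y \<and> c0 x * c2 y = c2 x * c0 y \<and> c0 x * c3 y = c3 x * c0 y"
proof -
  note x = con_zeroD[OF assms(1)] and y = con_zeroD[OF assms(2)]
  have "fst p * (c0 x * c1 y - c1 x * c0 y) = 0"
    using x(1) y(1) by algebra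
  moreover have "fst p * (fst p * (c0 x * c2 y - c2 x * c0 y)) = 0"
    using x(1,2) y(1,2) by algebra
  moreover have "fst p * (fst p * (fst p * (c0 x * c3 y - c3 x * c0 y))) = 0"
    using x y by algebra
  ultimately show ?thesis using assms(3) by simp
qed

context cubic_independent
begin

lemma coord_le:
  assumes "Lt x \<le> Nm x"
  shows "\<bar>real_of_int (c0 x)\<bar> \<le> 4 * M^3 * Nm x" "\<bar>real_of_int (c1 x)\<bar> \<le> 4 * M^3 * Nm x"
    "\<bar>real_of_int (c2 x)\<bar> \<le> 4 * M^3 * Nm x"
proof -
  have *: "\<bar>real_of_int j\<bar> \<le> 4 * M^3 * Nm x"
    if "\<bar>real_of_int j - k * real_of_int (c0 x)\<bar> \<le> 3 * M^2 * Lt x" "\<bar>k\<bar> \<le> M^3" for j k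
  proof -
    have "3 * M^2 * Lt x \<le> 3 * M^3 * Nm x"
      using assms M_ge(1) Lt_nonneg[of x] by (intro mult_mono power_increasing) auto
    moreover have "\<bar>k * real_of_int (c0 x)\<bar> \<le> M^3 * Nm x"
      unfolding abs_mult Nm_def using that(2) by (intro mult_right_mono) auto
    ultimately show ?thesis using that(1) by linarith
  qed
  show "\<bar>real_of_int (c0 x)\<bar> \<le> 4 * M^3 * Nm x" "\<bar>real_of_int (c1 x)\<bar> \<le> 4 * M^3 * Nm x"
    "\<bar>real_of_int (c2 x)\<bar> \<le> 4 * M^3 * Nm x"
    by (rule *[OF coords_near(1) powers_le(1)] *[OF coords_near(2) powers_le(2)] *[OF coords_near(3) powers_le(3)])+
qed

text \<open>The three entries are integers of absolute value less than 1.\<close>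

lemma con_le:
  assumes "Lt x \<le> Nm x"
    and small: "\<bar>real_of_int (fst p)\<bar> * Lt x + er p * (4 * M^3 * Nm x) < 1"
  shows "con p x = (0, 0, 0)"
proof -
  have *: "fst p * j' - snd p * j = 0"
    if "\<bar>real_of_int j' - \<xi> * real_of_int j\<bar> \<le> Lt x" "\<bar>real_of_int j\<bar> \<le> 4 * M^3 * Nm x" for j j'
  proof -
    have "real_of_int (fst p * j' - snd p * j) = real_of_int (fst p) * (real_of_int j' - \<xi> * real_of_int j)
        + (\<xi> * real_of_int (fst p) - real_of_int (snd p)) * real_of_int j"
      by (simp add: algebra_simps)
    also have "\<bar>\<dots>\<bar> \<le> \<bar>real_of_int (fst p)\<bar> * Lt x + er p * (4 * M^3 * Nm x)"
      unfolding er_def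
      by (rule order_trans[OF abs_triangle_ineq add_mono]; unfold abs_mult; rule mult_left_mono; use that in simp)
    also note small
    finally show ?thesis by linarith
  qed
  show ?thesis unfolding con_def
    using *[OF e_le(1)[of x, unfolded e0_def] coord_le(1)[OF assms(1)]]
      *[OF e_le(2)[of x, unfolded e1_def] coord_le(2)[OF assms(1)]]
      *[OF e_le(3)[of x, unfolded e2_def] coord_le(3)[OF assms(1)]] by simp
qed

end

section \<open>Rational approximations to \<xi>\<close>

context minimal_points
begin

lemma Lt_le_norm: "Lt (x i) \<le> Nm (x i)" using Lt_le1[of i] norm_ge1[of i] by linarith

text \<open>A point \<open>x\<close> with \<open>x\<^sup>-\<close> and \<open>x\<^sup>+\<close> proportional is a multiple of \<open>(a\<^sup>3, a\<^sup>2 b, a b\<^sup>2, b\<^sup>3)\<close>, so that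
  \<open>b / a\<close> is an approximation to \<open>\<xi>\<close> good enough to be fitted by the preceding minimal point too.\<close>

lemma eventually_not_degen: "\<exists>n. \<forall>i\<ge>n. \<not> degen (x i)"
proof -
  define K where "K = 5 * M^3 * c"
  \<comment> \<open>547/2000 = 3 * 849/2000 - 1. The quantity \<open>D\<close> below is bounded by
    \<open>K\<close> times a power of the norm with exponent 1/3 - 849/2000, and its cube is
    compared with 1.\<close>
  have "(\<lambda>i. K^3 * Nm (x (Suc i)) powr - (547/2000)) \<longlonglongrightarrow> 0"
    by (intro tendsto_mult_right_zero tendsto_neg_powr filterlim_compose[OF norm_at_top filterlim_Suc]) auto
  then have "\<forall>\<^sub>F i in sequentially. K^3 * Nm (x (Suc i)) powr - (547/2000) < 1"
    by (rule order_tendstoD(2)) simp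
  then obtain n where n: "\<And>i. i \<ge> n \<Longrightarrow> K^3 * Nm (x (Suc i)) powr - (547/2000) < 1"
    unfolding eventually_sequentially by blast
  have "\<not> degen (x (Suc i))" if "i \<ge> n" for i
  proof
    let ?X = "x (Suc i)" and ?Y = "x i"
    assume "degen ?X"
    then have w: "c1 ?X * c3 ?X = c2 ?X * c2 ?X" "c1 ?X * c2 ?X = c0 ?X * c3 ?X" "c0 ?X * c2 ?X = c1 ?X * c1 ?X"
      by (simp_all add: degen_def w_defs)
    define g where "g = gcd (c0 ?X) (c1 ?X)"
    define a b where "a = c0 ?X div g" and "b = c1 ?X div g"
    have g0: "g \<noteq> 0" using x_nonzero(1)[of "Suc i"] by (simp add: g_def)
    have ab: "c0 ?X = g * a" "c1 ?X = g * b" by (simp_all add: a_def b_def g_def)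
    have a0: "a \<noteq> 0" using x_nonzero(1)[of "Suc i"] ab by auto
    have cop: "coprime a b"
      unfolding a_def b_def g_def using x_nonzero(1)[of "Suc i"] by (intro div_gcd_coprime) simp
    have "g * (a * c2 ?X) = g * (b * c1 ?X)" "g * (a * c3 ?X) = g * (b * c2 ?X)"
      using w ab by algebra+
    then have r: "a * c1 ?X = b * c0 ?X" "a * c2 ?X = b * c1 ?X" "a * c3 ?X = b * c2 ?X"
      using g0 ab by simp_all
    have conX: "con (a, b) ?X = (0, 0, 0)" using r by (simp add: con_def)
    \<comment> \<open>The leading coordinate is divisible by the cube of \<open>a\<close>, so
      \<open>a\<close> is at most the cube root of the norm.\<close>
    have "a^3 * c3 ?X = b^3 * c0 ?X" using r by algebra
    then have "a^3 dvd b^3 * c0 ?X" by (metis dvd_triv_left)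
    moreover have "coprime (a^3) (b^3)" using cop by simp
    ultimately have "a^3 dvd c0 ?X" by (simp add: coprime_dvd_mult_right_iff)
    then have "\<bar>a^3\<bar> \<le> \<bar>c0 ?X\<bar>" using x_nonzero(1)[of "Suc i"] by (rule dvd_imp_le_int[rotated])
    then have a3: "\<bar>real_of_int a\<bar>^3 \<le> Nm ?X"
      unfolding Nm_def power_abs[symmetric] by (simp flip: of_int_power of_int_abs)
    have er: "er (a, b) * Nm ?X \<le> \<bar>real_of_int a\<bar> * Lt ?Y"
    proof -
      have "e0 ?X = - real_of_int g * (\<xi> * real_of_int a - real_of_int b)"
        by (simp add: e0_def ab algebra_simps)
      then have "\<bar>real_of_int g\<bar> * er (a, b) = \<bar>e0 ?X\<bar>" by (simp add: er_def abs_mult)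
      then have "er (a, b) * Nm ?X = \<bar>real_of_int a\<bar> * \<bar>e0 ?X\<bar>"
        by (simp add: Nm_def ab abs_mult mult_ac)
      also have "\<dots> \<le> \<bar>real_of_int a\<bar> * Lt ?Y"
        using e_le(1)[of ?X] Lt_Suc[of i] by (intro mult_left_mono) linarith+
      finally show ?thesis .
    qed
    define D where "D = \<bar>real_of_int a\<bar> * Lt ?Y + er (a, b) * (4 * M^3 * Nm ?Y)"
    have M3: "1 \<le> M^3" using M_ge(1) by simp
    have "D \<le> 5 * M^3 * (\<bar>real_of_int a\<bar> * Lt ?Y)"
    proof -
      have "er (a, b) * Nm ?Y \<le> er (a, b) * Nm ?X"
        using norm_Suc[of i] by (intro mult_left_mono) (auto simp: er_def)
      then have "4 * M^3 * (er (a, b) * Nm ?Y) \<le> 4 * M^3 * (\<bar>real_of_int a\<bar> * Lt ?Y)"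
        using er M_ge(1) by (intro mult_left_mono) auto
      moreover have "1 * (\<bar>real_of_int a\<bar> * Lt ?Y) \<le> M^3 * (\<bar>real_of_int a\<bar> * Lt ?Y)"
        using M3 Lt_nonneg by (intro mult_right_mono) auto
      ultimately show ?thesis unfolding D_def by (simp add: algebra_simps)
    qed
    also have "\<dots> \<le> 5 * M^3 * (\<bar>real_of_int a\<bar> * (c * Nm ?X powr - (849/2000)))"
      using decay[of i] M_ge(1) by (intro mult_left_mono) auto
    finally have D: "D \<le> K * \<bar>real_of_int a\<bar> * Nm ?X powr - (849/2000)" by (simp add: K_def mult_ac)
    have K0: "0 \<le> K" using c_pos M_ge(1) by (simp add: K_def)
    have "D^3 \<le> (K * \<bar>real_of_int a\<bar> * Nm ?X powr - (849/2000))^3"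
      using D Lt_nonneg[of ?Y] M_ge(1) by (intro power_mono) (auto simp: D_def er_def Nm_def)
    also have "\<dots> = K^3 * (\<bar>real_of_int a\<bar>^3 * (Nm ?X powr - (849/2000))^3)" by (simp add: power_mult_distrib)
    also have "(Nm ?X powr - (849/2000))^3 = Nm ?X powr - (2547/2000)"
      using norm_ge1[of "Suc i"] by (subst powr_realpow[symmetric]) (auto simp: powr_powr)
    also have "K^3 * (\<bar>real_of_int a\<bar>^3 * Nm ?X powr - (2547/2000)) \<le> K^3 * (Nm ?X * Nm ?X powr - (2547/2000))"
      using a3 K0 by (intro mult_left_mono mult_right_mono) auto
    also have "Nm ?X * Nm ?X powr - (2547/2000) = Nm ?X powr - (547/2000)"
      using norm_ge1[of "Suc i"] powr_add[of "Nm ?X" 1 "- (2547/2000)"] by simp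
    also note n[OF that]
    finally have "D^3 < 1" .
    then have "D < 1" by (metis not_less one_le_power)
    then have "con (a, b) ?Y = (0, 0, 0)" using Lt_le_norm by (intro con_le) (auto simp: D_def)
    from con_zero_proportional[OF this conX] a0 not_proportional[of i] show False by simp
  qed
  then show ?thesis by (intro exI[of _ "Suc n"]) (metis Suc_le_D Suc_le_mono)
qed

text \<open>Take the first minimal point with error below 1/(2a), where a is the absolute value of
  \<open>fst p\<close>. It is not degenerate, so \<open>p\<close> does not fit it exactly, and
  integrality bounds \<open>er p\<close> below by its inverse norm. The preceding point still has
  error at least 1/(2a), hence this norm is at most a constant times a^(2000/849); 236/100 rounds
  the exponent up.\<close>

lemma irrationality_measure:
  obtains K where "0 \<le> K" "\<And>p. p \<noteq> (0, 0) \<Longrightarrow> ln (er p) \<ge> - (236/100) * ln (sz p) - K"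
proof -
  obtain n where n: "\<And>i. i \<ge> n \<Longrightarrow> \<not> degen (x i)" using eventually_not_degen by blast
  define K where "K = ln (8 * M^3) + ln (Nm (x n)) + 2000/849 * \<bar>ln (2 * c)\<bar>"
  have M3: "1 \<le> M^3" using M_ge(1) by simp
  have Kparts: "0 \<le> ln (8 * M^3)" "0 \<le> ln (Nm (x n))" using M3 norm_ge1 by simp_all
  have K0: "0 \<le> K" using Kparts by (simp add: K_def)
  have "ln (er p) \<ge> - (236/100) * ln (sz p) - K" if p: "p \<noteq> (0, 0)" for p
  proof (cases "fst p = 0")
    case True
    then have "er p = sz p" by (simp add: er_def sz_def)
    moreover have "0 \<le> ln (sz p)" using sz_ge1[OF p] by simp
    ultimately show ?thesis using K0 by simp
  next
    case False
    define a where "a = \<bar>real_of_int (fst p)\<bar>"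
    have a1: "1 \<le> a" using False unfolding a_def by linarith
    have as: "ln a \<le> ln (sz p)" "0 \<le> ln (sz p)" using a1 sz_ge(1)[of p] sz_ge1[OF p] by (simp_all add: a_def)
    have "(\<lambda>i. 2 * a * Lt (x i)) \<longlonglongrightarrow> 0" by (intro tendsto_mult_right_zero Lt_tendsto_0)
    then have "\<forall>\<^sub>F i in sequentially. 2 * a * Lt (x i) < 1" by (rule order_tendstoD(2)) simp
    then obtain m where m: "\<And>i. i \<ge> m \<Longrightarrow> 2 * a * Lt (x i) < 1" unfolding eventually_sequentially by blast
    define P where "P i \<longleftrightarrow> n \<le> i \<and> 2 * a * Lt (x i) < 1" for i
    define i where "i = (LEAST i. P i)"
    have "P (max m n)" using m by (simp add: P_def)
    then have Pi: "P i" unfolding i_def by (rule LeastI)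
    have "con p (x i) \<noteq> (0, 0, 0)" using con_zero_degen[OF _ False] n Pi by (auto simp: P_def)
    then have "1 \<le> a * Lt (x i) + er p * (4 * M^3 * Nm (x i))"
      using con_le[OF Lt_le_norm, of p i] unfolding a_def by linarith
    then have "1 \<le> er p * (8 * M^3 * Nm (x i))" using Pi unfolding P_def by linarith
    then have "0 \<le> ln (er p * (8 * M^3 * Nm (x i)))" by simp
    also have "\<dots> = ln (er p) + ln (8 * M^3) + ln (Nm (x i))"
      using er_pos[OF p] M_ge(1) norm_ge1[of i] by (simp add: ln_mult)
    finally have er: "ln (er p) \<ge> - ln (8 * M^3) - ln (Nm (x i))" by linarith
    show ?thesis
    proof (cases "i = n")
      case True
      then show ?thesis using er as unfolding K_def by (simp add: algebra_simps)
    next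
      case False
      then obtain j where j: "i = Suc j" "n \<le> j" using Pi unfolding P_def by (cases i) auto
      have "\<not> P j" using not_less_Least[of j P] j(1) unfolding i_def by auto
      then have "1 \<le> 2 * a * Lt (x j)" using j(2) by (auto simp: P_def)
      also have "\<dots> \<le> 2 * a * (c * Nm (x i) powr - (849/2000))"
        using decay[of j] a1 j(1) by (intro mult_left_mono) auto
      finally have "0 \<le> ln (2 * a * (c * Nm (x i) powr - (849/2000)))" by simp
      also have "2 * a * (c * Nm (x i) powr - (849/2000)) = (2 * c) * (a * Nm (x i) powr - (849/2000))" by simp
      also have "ln \<dots> = ln (2 * c) + (ln a - 849/2000 * ln (Nm (x i)))"
        using a1 c_pos norm_ge1[of i] by (simp add: ln_mult ln_powr)
      finally have "ln (Nm (x i)) \<le> 2000/849 * (ln (2 * c) + ln a)" by simp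
      also have "\<dots> = 2000/849 * ln (2 * c) + 2000/849 * ln a" by (simp add: algebra_simps)
      also have "\<dots> \<le> 2000/849 * \<bar>ln (2 * c)\<bar> + 236/100 * ln (sz p)"
        using as abs_ge_self[of "ln (2 * c)"] by linarith
      finally show ?thesis using er Kparts unfolding K_def by (simp add: algebra_simps)
    qed
  qed
  with K0 show thesis by (rule that)
qed

text \<open>At the indices in \<open>Ix\<close> three consecutive minimal points \<open>v k, y k, u k\<close> are independent; all minimal points from \<open>y k\<close> to
  \<open>y (k + 1)\<close> lie in the plane of \<open>y k\<close> and \<open>u k\<close>.\<close>

definition Ix :: "nat set" where "Ix = {i. nrm (x i) (x (Suc i)) (x (Suc (Suc i))) \<noteq> nul}"
definition ix :: "nat \<Rightarrow> nat" where "ix = enumerate Ix"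
definition v :: "nat \<Rightarrow> pt" where "v k = x (ix k)"
definition y :: "nat \<Rightarrow> pt" where "y k = x (Suc (ix k))"
definition u :: "nat \<Rightarrow> pt" where "u k = x (Suc (Suc (ix k)))"

lemma infinite_Ix: "infinite Ix"
  unfolding infinite_nat_iff_unbounded_le using infinitely_many_independent by (auto simp: Ix_def)

lemma ix_Suc: "ix k < ix (Suc k)"
  unfolding ix_def using enumerate_step[OF infinite_Ix] .

lemma le_ix: "k \<le> ix k"
  unfolding ix_def using le_enumerate[OF infinite_Ix] .

lemma between_ix:
  assumes "ix k < i" "i < ix (Suc k)"
  shows "nrm (x i) (x (Suc i)) (x (Suc (Suc i))) = nul"
  using assms not_less_Least[of i "\<lambda>s. s \<in> Ix \<and> enumerate Ix k < s"] enumerate_Suc''[OF infinite_Ix, of k]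
  unfolding ix_def by (auto simp: Ix_def)

lemma nrm_vyu: "nrm (v k) (y k) (u k) \<noteq> nul"
  using enumerate_in_set[OF infinite_Ix, of k] unfolding v_def y_def u_def ix_def by (simp add: Ix_def)

text \<open>As long as no new independent point appears, each consecutive pair is a basis of the
  same lattice of rank two, so membership passes in both directions.\<close>

lemma lattice_chain:
  assumes "Suc (ix k) \<le> i" "i \<le> ix (Suc k)"
  shows "lat (x i) (x (Suc i)) (y k) \<and> lat (x i) (x (Suc i)) (u k) \<and> lat (y k) (u k) (x i) \<and> lat (y k) (u k) (x (Suc i))"
  using assms
proof (induction i rule: dec_induct)
  case base
  show ?case unfolding y_def u_def by (intro conjI lat_refl)
next
  case (step i)
  have z: "nrm (x i) (x (Suc i)) (x (Suc (Suc i))) = nul"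
    by (rule between_ix[of k]) (use step in auto)
  have f: "lat (x i) (x (Suc i)) (x (Suc (Suc i)))" by (rule lattice_basis[OF z])
  have b: "lat (x (Suc i)) (x (Suc (Suc i))) (x i)"
    by (rule lattice_basis) (simp add: nrm_cyclic z)
  have IH: "lat (x i) (x (Suc i)) (y k)" "lat (x i) (x (Suc i)) (u k)" "lat (y k) (u k) (x i)" "lat (y k) (u k) (x (Suc i))"
    using step by auto
  show ?case
    by (intro conjI lat_trans[OF b lat_refl(1) IH(1)] lat_trans[OF b lat_refl(1) IH(2)] IH(4) lat_trans[OF IH(3,4) f])
qed

lemma lattice_next:
  "lat (v (Suc k)) (y (Suc k)) (y k)" "lat (v (Suc k)) (y (Suc k)) (u k)"
  "lat (y k) (u k) (v (Suc k))" "lat (y k) (u k) (y (Suc k))"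
  using lattice_chain[of k "ix (Suc k)"] ix_Suc[of k] unfolding v_def y_def[of "Suc k"] by auto

lemma order_facts:
  "1 \<le> Nm (v k)" "Nm (v k) \<le> Nm (y k)" "Nm (y k) \<le> Nm (u k)" "Nm (u k) \<le> Nm (y (Suc k))" "Nm (y k) \<le> Nm (v (Suc k))"
  "Lt (y k) \<le> Lt (v k)" "Lt (u k) \<le> Lt (y k)" "Lt (y (Suc k)) \<le> Lt (u k)" "Lt (v (Suc k)) \<le> Lt (y k)" "Lt (v k) \<le> 1"
  unfolding v_def y_def u_def using ix_Suc[of k]
  by (auto intro: norm_mono Lt_antimono norm_ge1 Lt_le1)

lemma decay_facts:
  "Lt (y k) \<le> c * Nm (u k) powr - (849/2000)" "Lt (v k) \<le> c * Nm (y k) powr - (849/2000)"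
  unfolding v_def y_def u_def by (rule decay)+

end

section \<open>Nonvanishing of contractions\<close>

lemma primitive_multiple:
  fixes p q r x y z :: int
  assumes "gcd p (gcd q r) = 1" "x * q = y * p" "x * r = z * p" "y * r = z * q"
  obtains s where "x = s * p" "y = s * q" "z = s * r"
proof -
  obtain i j where ij: "i * q + j * r = gcd q r" using bezout_int[of q r] by blast
  obtain k l where "k * p + l * gcd q r = 1" using bezout_int[of p "gcd q r"] assms(1) by auto
  then have b: "k * p + l * i * q + l * j * r = 1" unfolding ij[symmetric] by (simp add: algebra_simps)
  show thesis
  proof (rule that[of "k * x + l * i * y + l * j * z"])
    have "x = x * (k * p + l * i * q + l * j * r)" "y = y * (k * p + l * i * q + l * j * r)"
      "z = z * (k * p + l * i * q + l * j * r)" using b by simp_all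
    moreover have "x * (k * p + l * i * q + l * j * r) = (k * x + l * i * y + l * j * z) * p"
      "y * (k * p + l * i * q + l * j * r) = (k * x + l * i * y + l * j * z) * q"
      "z * (k * p + l * i * q + l * j * r) = (k * x + l * i * y + l * j * z) * r"
      using assms(2-4) by algebra+
    ultimately show "x = (k * x + l * i * y + l * j * z) * p" "y = (k * x + l * i * y + l * j * z) * q"
      "z = (k * x + l * i * y + l * j * z) * r" by metis+
  qed
qed

text \<open>The Pluecker coordinates of the plane annihilated by \<open>(p, q, r, 0)\<close> and \<open>(0, p, q, r)\<close> are
  quadratic in \<open>(p, q, r)\<close>, and they are coprime if \<open>p, q, r\<close> are.\<close>

lemma quadratic_pluecker:
  fixes p q r :: int
  assumes prim: "gcd p (gcd q r) = 1"
    and a: "p * c0 a + q * c1 a + r * c2 a = 0" "p * c1 a + q * c2 a + r * c3 a = 0"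
    and b: "p * c0 b + q * c1 b + r * c2 b = 0" "p * c1 b + q * c2 b + r * c3 b = 0"
    and indep: "\<not> (c0 a * c1 b = c1 a * c0 b \<and> c0 a * c2 b = c2 a * c0 b \<and> c0 a * c3 b = c3 a * c0 b)"
    and bound: "\<bar>c0 a * c1 b - c1 a * c0 b\<bar> \<le> B" "\<bar>c0 a * c3 b - c3 a * c0 b\<bar> \<le> B"
      "\<bar>c2 a * c3 b - c3 a * c2 b\<bar> \<le> B"
  shows "p * p \<le> 2 * B \<and> q * q \<le> 2 * B \<and> r * r \<le> 2 * B"
proof -
  define M01 M02 M03 M12 M13 M23 where defs:
    "M01 = c0 a * c1 b - c1 a * c0 b" "M02 = c0 a * c2 b - c2 a * c0 b" "M03 = c0 a * c3 b - c3 a * c0 b"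
    "M12 = c1 a * c2 b - c2 a * c1 b" "M13 = c1 a * c3 b - c3 a * c1 b" "M23 = c2 a * c3 b - c3 a * c2 b"
  \<comment> \<open>\<open>(M12, - M02, M01)\<close> is the cross product of the first three
    coordinates of \<open>a\<close> and \<open>b\<close>, both orthogonal to
    \<open>(p, q, r)\<close>; hence it is a multiple of this primitive vector. The last three
    coordinates give \<open>t\<close> in the same way.\<close>
  have "M12 * q = (- M02) * p" "M12 * r = M01 * p" "(- M02) * r = M01 * q"
    unfolding defs using a b by algebra+
  then obtain s where s: "M12 = s * p" "- M02 = s * q" "M01 = s * r" by (rule primitive_multiple[OF prim])
  have "M23 * q = (- M13) * p" "M23 * r = M12 * p" "(- M13) * r = M12 * q"
    unfolding defs using a b by algebra+
  then obtain t where t: "M23 = t * p" "- M13 = t * q" "M12 = t * r" by (rule primitive_multiple[OF prim])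
  have e1: "M03 * p = t * (q * q - p * r)" "M03 * r = s * (q * q - p * r)"
  proof -
    have "M03 * p + r * M23 - q * (- M13) = 0" "M03 * r + p * M01 - q * (- M02) = 0"
      unfolding defs using a b by algebra+
    then show "M03 * p = t * (q * q - p * r)" "M03 * r = s * (q * q - p * r)"
      unfolding s t by algebra+
  qed
  have st: "s * p = t * r" using s t by simp
  have nz: "\<not> (M01 = 0 \<and> M02 = 0 \<and> M03 = 0)" using indep by (auto simp: defs)
  \<comment> \<open>The integers \<open>x\<close>, \<open>q * q\<close> and \<open>x'\<close> have
    no common factor, so 1 is a combination of them; multiply it by \<open>w\<close>.\<close>
  have key: "x dvd w" if "x dvd w * x'" "x dvd w * (q * q)" "gcd x (gcd q x') = 1" for x x' w :: int
  proof -
    have "coprime q (gcd x x')" using that(3) by (simp add: coprime_iff_gcd_eq_1 gcd.left_commute)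
    then have "coprime (q * q) (gcd x x')" by simp
    then have g: "gcd x (gcd (q * q) x') = 1" by (simp add: coprime_iff_gcd_eq_1 gcd.left_commute)
    obtain i j where ij: "i * (q * q) + j * x' = gcd (q * q) x'" using bezout_int[of "q * q" x'] by blast
    obtain k l where "k * x + l * gcd (q * q) x' = 1" using bezout_int[of x "gcd (q * q) x'"] g by auto
    then have "k * x + l * (i * (q * q) + j * x') = 1" unfolding ij .
    then have "w = w * (k * x + l * (i * (q * q) + j * x'))" by simp
    also have "\<dots> = x * (w * k) + (w * (q * q)) * (l * i) + (w * x') * (l * j)" by (simp add: algebra_simps)
    also have "x dvd \<dots>" by (rule dvd_add[OF dvd_add[OF dvd_triv_left dvd_mult2[OF that(2)]] dvd_mult2[OF that(1)]])
    finally show ?thesis .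
  qed
  have pr: "2 * \<bar>p * r\<bar> \<le> p * p + r * r"
    using sum_squares_ge_zero[of "p - r" 0] sum_squares_ge_zero[of "p + r" 0] by (simp add: algebra_simps abs_if)
  \<comment> \<open>With a nonzero integer factor \<open>k\<close>, two coordinates bound
    \<open>p * p\<close> and \<open>r * r\<close> by \<open>B\<close>. The third bounds q^2 - pr,
    and |pr| is at most (p^2 + r^2)/2, whence the factor 2.\<close>
  have finish: "p * p \<le> 2 * B \<and> q * q \<le> 2 * B \<and> r * r \<le> 2 * B"
    if k: "k \<noteq> 0" "M23 = k * (p * p)" "M01 = k * (r * r)" "M03 = k * (q * q - p * r)" for k
  proof -
    have "X \<le> \<bar>k * X\<bar> \<and> - X \<le> \<bar>k * X\<bar>" for X
    proof -
      have "1 * \<bar>X\<bar> \<le> \<bar>k\<bar> * \<bar>X\<bar>" using k(1) by (intro mult_right_mono) auto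
      then show ?thesis unfolding abs_mult by linarith
    qed
    then have "p * p \<le> \<bar>M23\<bar>" "r * r \<le> \<bar>M01\<bar>" "q * q - p * r \<le> \<bar>M03\<bar>" unfolding k(2-4) by blast+
    then show ?thesis using bound[folded defs] pr by linarith
  qed
  show ?thesis
  proof (cases "p = 0")
    case False
    have "p dvd t" 
    proof (rule key[OF _ _ prim])
      show "p dvd t * r" unfolding st[symmetric] by simp
      have "t * (q * q) = p * (M03 + t * r)" using e1(1) by (simp add: algebra_simps)
      then show "p dvd t * (q * q)" by simp
    qed
    then obtain k where k: "t = p * k" by blast
    have s': "s = k * r" using st k False by simp
    have "p * M03 = p * (k * (q * q - p * r))" using e1(1) k by algebra
    then have M: "M03 = k * (q * q - p * r)" using False by simp
    have "k \<noteq> 0"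
    proof
      assume "k = 0"
      then have "s = 0" "M03 = 0" using s' M by simp_all
      then show False using nz s by simp
    qed
    then show ?thesis by (rule finish) (use s t k s' M in \<open>simp_all add: algebra_simps\<close>)
  next
    case p0: True
    show ?thesis
    proof (cases "r = 0")
      case False
      have t0: "t = 0" using st p0 False by simp
      have "r dvd s"
      proof (rule key)
        show "r dvd s * p" by (simp add: p0)
        have "s * (q * q) = r * M03" using e1(2) p0 by (simp add: algebra_simps)
        then show "r dvd s * (q * q)" by simp
        show "gcd r (gcd q p) = 1" using prim by (simp add: ac_simps)
      qed
      then obtain k where k: "s = r * k" by blast
      have "r * M03 = r * (k * (q * q - p * r))" using e1(2) k by algebra
      then have M: "M03 = k * (q * q - p * r)" using False by simp
      have "k \<noteq> 0"
      proof
        assume "k = 0"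
        then have "s = 0" "M03 = 0" using k M by simp_all
        then show False using nz s by simp
      qed
      then show ?thesis by (rule finish) (use s t t0 k M p0 in \<open>simp_all add: algebra_simps\<close>)
    next
      case True
      then have "\<bar>q\<bar> = 1" using prim p0 by simp
      then have q: "q * q = 1" "q \<noteq> 0" by (auto simp: abs_if split: if_splits)
      then have "M01 = 0" "M02 = 0" unfolding defs using a b p0 True by simp_all
      then have "1 \<le> \<bar>M03\<bar>" using nz by simp
      then have "1 \<le> B" using bound(2) by (simp add: defs)
      then show ?thesis using p0 True q by simp
    qed
  qed
qed

section \<open>Logarithmic form of the estimates\<close>

context cubic_independent
begin

definition n :: "pt \<Rightarrow> real" where "n x = ln (Nm x)"
definition d :: "pt \<Rightarrow> real" where "d x = - ln (Lt x)"

lemma n_mono: "Nm p \<le> Nm q \<Longrightarrow> 1 \<le> Nm p \<Longrightarrow> n p \<le> n q"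
  unfolding n_def by (intro ln_mono) auto

lemma d_mono: "Lt q \<le> Lt p \<Longrightarrow> q \<noteq> nul \<Longrightarrow> d p \<le> d q"
  unfolding d_def using Lt_pos[of q] by (simp add: ln_mono)

lemma G_ge1000: "1000 \<le> G" by (rule G_ge(1)[of 0]) simp

lemma lnG: "ln 2 \<le> ln G" "0 \<le> ln G" "ln 3 \<le> ln G" "ln 6 \<le> ln G"
  using G_ge1000 by simp_all

lemma ln_CC:
  assumes ne: "CC x y \<noteq> (0, 0)" and x: "Lt x \<le> Nm x" "1 \<le> Nm x" "x \<noteq> nul" and y: "y \<noteq> nul" "1 \<le> Nm y"
  shows "ln (er (CC x y)) \<le> ln G + n x - d x - d y"
    and "Nm x \<le> Nm y \<Longrightarrow> Lt y \<le> Lt x \<Longrightarrow> ln (sz (CC x y)) \<le> 2 * ln G + n y - 2 * d x"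
    and "Nm y \<le> Nm x \<Longrightarrow> Lt x \<le> Lt y \<Longrightarrow> ln (sz (CC x y)) \<le> 2 * ln G + n x - d x - d y"
    and "0 \<le> ln (sz (CC x y))"
proof -
  note L = Lt_pos[OF x(3)] Lt_pos[OF y(1)]
  have G0: "0 < G" using G_ge1000 by simp
  have s1: "1 \<le> sz (CC x y)" by (rule sz_ge1[OF ne])
  show "0 \<le> ln (sz (CC x y))" using s1 by simp
  have "ln (er (CC x y)) \<le> ln (G * (Nm x * Lt x * Lt y))"
    using CC_le(1)[OF x(1), of y] er_pos[OF ne] by (intro ln_mono) auto
  also have "\<dots> = ln G + n x - d x - d y" using L x G0 by (simp add: ln_mult n_def d_def)
  finally show "ln (er (CC x y)) \<le> ln G + n x - d x - d y" .
  show "ln (sz (CC x y)) \<le> 2 * ln G + n y - 2 * d x" if "Nm x \<le> Nm y" "Lt y \<le> Lt x"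
  proof -
    have "Nm x * Lt x * Lt y \<le> Nm y * Lt x * Lt x" using that L x by (intro mult_mono) auto
    then have "Nm x * Lt x * Lt y + Lt x * Lt x * Nm y \<le> 2 * (Lt x * Lt x * Nm y)" by (simp add: mult_ac)
    then have "G * (Nm x * Lt x * Lt y + Lt x * Lt x * Nm y) \<le> G * (2 * (Lt x * Lt x * Nm y))"
      using G0 by (intro mult_left_mono) auto
    then have "ln (sz (CC x y)) \<le> ln (G * (2 * (Lt x * Lt x * Nm y)))"
      using CC_le(2)[OF x(1), of y] s1 by (intro ln_mono) auto
    also have "\<dots> = ln G + ln 2 + n y - 2 * d x" using L y G0 by (simp add: ln_mult n_def d_def)
    finally show ?thesis using lnG by simp
  qed
  show "ln (sz (CC x y)) \<le> 2 * ln G + n x - d x - d y" if "Nm y \<le> Nm x" "Lt x \<le> Lt y"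
  proof -
    have "Lt x * Lt x * Nm y \<le> Lt x * Lt y * Nm x" using that L x y by (intro mult_mono) auto
    then have "Nm x * Lt x * Lt y + Lt x * Lt x * Nm y \<le> 2 * (Nm x * Lt x * Lt y)" by (simp add: mult_ac)
    then have "G * (Nm x * Lt x * Lt y + Lt x * Lt x * Nm y) \<le> G * (2 * (Nm x * Lt x * Lt y))"
      using G0 by (intro mult_left_mono) auto
    then have "ln (sz (CC x y)) \<le> ln (G * (2 * (Nm x * Lt x * Lt y)))"
      using CC_le(2)[OF x(1), of y] s1 by (intro ln_mono) auto
    also have "\<dots> = ln G + ln 2 + n x - d x - d y" using L x G0 by (simp add: ln_mult n_def d_def)
    finally show ?thesis using lnG by simp
  qed
qed

lemma ln_nrm:
  assumes "nrm x y z \<noteq> nul" "Lt x \<le> Nm x" "Lt y \<le> Nm y" "Lt z \<le> Nm z"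
    and "Nm x \<le> Nm z" "Nm y \<le> Nm z" "Lt z \<le> Lt x" "Lt z \<le> Lt y" "1 \<le> Nm z" "x \<noteq> nul" "y \<noteq> nul"
  shows "ln (mx (nrm x y z)) \<le> ln G + n z - d x - d y"
proof -
  have "ln (mx (nrm x y z)) \<le> ln (G * (Nm z * Lt x * Lt y))"
    using nrm_le[of x y z] assms mx_ge1[OF assms(1)] by (intro ln_mono) auto
  also have "\<dots> = ln G + n z - d x - d y"
    using assms Lt_pos[of x] Lt_pos[of y] G_ge1000 by (simp add: ln_mult n_def d_def)
  finally show ?thesis .
qed

lemma ln_dot:
  assumes "dot f t \<noteq> 0" "dot f y = 0" "0 < Nm y" "Lt y / Nm y * Nm t \<le> T" "Lt t \<le> T" "0 < T" "f \<noteq> nul"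
  shows "0 \<le> ln G + ln (mx f) + ln T"
proof -
  have "1 \<le> \<bar>real_of_int (dot f t)\<bar>" using assms(1) by linarith
  also have "\<dots> \<le> G * (mx f * T)" by (rule dot_le) (use assms in auto)
  finally have "0 \<le> ln (G * (mx f * T))" by simp
  also have "\<dots> = ln G + ln (mx f) + ln T"
    using assms(6) mx_ge1[OF assms(7)] G_ge1000 by (simp add: ln_mult)
  finally show ?thesis .
qed

text \<open>A hyperplane that contains \<open>w\<close> but misses \<open>w'\<close> has a nonzero
  integer value at \<open>w'\<close>, so its height cannot be small.\<close>

lemma ln_far:
  assumes "f \<noteq> nul" "dot f w = 0" "dot f w' \<noteq> 0" "w \<noteq> nul" "1 \<le> Nm w" "Nm w \<le> Nm w'" "Lt w' \<le> Lt w"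
  shows "0 \<le> ln (mx f) + n w' - d w - n w + ln G"
proof -
  note L = Lt_pos[OF assms(4)]
  have "Lt w' \<le> Lt w * 1" using assms(7) by simp
  also have "\<dots> \<le> Lt w * (Nm w' / Nm w)" using assms(5,6) L by (intro mult_left_mono) auto
  finally have "Lt w' \<le> Lt w / Nm w * Nm w'" by simp
  then have "0 \<le> ln G + ln (mx f) + ln (Lt w / Nm w * Nm w')"
    using assms L by (intro ln_dot[of f w' w]) auto
  also have "ln (Lt w / Nm w * Nm w') = n w' - d w - n w"
    using assms(5,6) L by (simp add: ln_mult ln_div n_def d_def)
  finally show ?thesis by linarith
qed

lemma minor_le:
  assumes "Lt x \<le> Nm x" "Lt y \<le> Nm y" "Nm x \<le> Nm y" "Lt y \<le> Lt x"
  shows "\<bar>real_of_int (c0 x * c1 y - c1 x * c0 y)\<bar> \<le> G * (Nm y * Lt x)"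
    "\<bar>real_of_int (c0 x * c3 y - c3 x * c0 y)\<bar> \<le> G * (Nm y * Lt x)"
    "\<bar>real_of_int (c2 x * c3 y - c3 x * c2 y)\<bar> \<le> G * (Nm y * Lt x)"
proof -
  have *: "\<bar>real_of_int (i * j' - j * i')\<bar> \<le> G * (Nm y * Lt x)"
    if "\<bar>real_of_int i - ki * real_of_int (c0 x)\<bar> \<le> 3 * M^2 * Lt x" "\<bar>real_of_int j - kj * real_of_int (c0 x)\<bar> \<le> 3 * M^2 * Lt x"
      "\<bar>real_of_int i' - ki * real_of_int (c0 y)\<bar> \<le> 3 * M^2 * Lt y" "\<bar>real_of_int j' - kj * real_of_int (c0 y)\<bar> \<le> 3 * M^2 * Lt y"
      "\<bar>ki\<bar> \<le> M^3" "\<bar>kj\<bar> \<le> M^3" for i j i' j' ki kj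
  proof -
    have "real_of_int (i * j' - j * i') = 
      det3 (real_of_int i) (real_of_int j) 0 (real_of_int i') (real_of_int j') 0 0 0 1"
      by (simp add: det3_def)
    define r s r' s' where rs: "r = real_of_int i - ki * real_of_int (c0 x)" "s = real_of_int j - kj * real_of_int (c0 x)"
      "r' = real_of_int i' - ki * real_of_int (c0 y)" "s' = real_of_int j' - kj * real_of_int (c0 y)"
    have eq: "real_of_int (i * j' - j * i') = r * real_of_int j' + - (s * real_of_int i') + ki * real_of_int (c0 x) * s' + - (kj * real_of_int (c0 x) * r')"
      by (simp add: rs algebra_simps)
    note L0 = Lt_nonneg[of x] Lt_nonneg[of y]
    have N0: "0 \<le> Nm x" "0 \<le> Nm y" by (simp_all add: Nm_def)
    have M3: "0 \<le> M^3" "0 \<le> M^2" "0 \<le> M" using M_ge(1) by simp_all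
    have big: "\<bar>real_of_int h\<bar> \<le> 4 * M^3 * Nm y" if "\<bar>real_of_int h - k * real_of_int (c0 y)\<bar> \<le> 3 * M^2 * Lt y" "\<bar>k\<bar> \<le> M^3" for h k
    proof -
      have "3 * M^2 * Lt y \<le> 3 * M^3 * Nm y"
        using assms M_ge(1) L0 by (intro mult_mono power_increasing) auto
      moreover have "\<bar>k * real_of_int (c0 y)\<bar> \<le> M^3 * Nm y"
        unfolding abs_mult Nm_def using that(2) by (intro mult_right_mono) auto
      ultimately show ?thesis using that(1) by linarith
    qed
    have t1: "\<bar>f * real_of_int h\<bar> \<le> 3 * M^2 * Lt x * (4 * M^3 * Nm y)" if "\<bar>f\<bar> \<le> 3 * M^2 * Lt x" "\<bar>real_of_int h\<bar> \<le> 4 * M^3 * Nm y" for f h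
      unfolding abs_mult using that M3 L0 by (intro mult_mono) auto
    have t2: "\<bar>k * real_of_int (c0 x) * f\<bar> \<le> M^3 * Nm y * (3 * M^2 * Lt x)" if "\<bar>k\<bar> \<le> M^3" "\<bar>f\<bar> \<le> 3 * M^2 * Lt y" for f k
    proof -
      have "3 * M^2 * Lt y \<le> 3 * M^2 * Lt x" using assms M3 by (intro mult_left_mono) auto
      then show ?thesis unfolding abs_mult using that M3 N0 assms L0 by (intro mult_mono) (auto simp: Nm_def)
    qed
    have "\<bar>real_of_int (i * j' - j * i')\<bar> \<le> 3 * M^2 * Lt x * (4 * M^3 * Nm y) + 3 * M^2 * Lt x * (4 * M^3 * Nm y)
      + M^3 * Nm y * (3 * M^2 * Lt x) + M^3 * Nm y * (3 * M^2 * Lt x)"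
      unfolding eq
      by (intro abs_sum4_le; (simp only: abs_minus_cancel)?; (rule t1 t2); (rule big)?; use that in \<open>simp add: rs\<close>)
    also have "\<dots> = 30 * M^5 * (Nm y * Lt x)" by algebra
    also have "\<dots> \<le> G * (Nm y * Lt x)"
    proof (rule mult_right_mono)
      have "1000 * M^5 \<le> G" by (rule G_ge) simp
      moreover have "0 \<le> M^5" using M3 by simp
      ultimately show "30 * M^5 \<le> G" by linarith
    qed (use L0 N0 in simp)
    finally show ?thesis .
  qed
  show "\<bar>real_of_int (c0 x * c1 y - c1 x * c0 y)\<bar> \<le> G * (Nm y * Lt x)"
    "\<bar>real_of_int (c0 x * c3 y - c3 x * c0 y)\<bar> \<le> G * (Nm y * Lt x)"
    "\<bar>real_of_int (c2 x * c3 y - c3 x * c2 y)\<bar> \<le> G * (Nm y * Lt x)"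
    by (rule *[OF coords_near(1,2) coords_near(1,2) powers_le(1,2)] *[OF coords_near(1,4) coords_near(1,4) powers_le(1,4)]
      *[OF coords_near(3,4) coords_near(3,4) powers_le(3,4)])+
qed

lemma e_cmb:
  "e0 (cmb r a s b) = real_of_int r * e0 a + real_of_int s * e0 b"
  "e1 (cmb r a s b) = real_of_int r * e1 a + real_of_int s * e1 b"
  "e2 (cmb r a s b) = real_of_int r * e2 a + real_of_int s * e2 b"
  by (simp_all add: e0_def e1_def e2_def algebra_simps)

end

section \<open>Heights of planes and of three-dimensional spaces\<close>

context minimal_points
begin

definition kap :: real where "kap = 10 * ln G + \<bar>ln c\<bar>"

lemma kap_ge: "0 \<le> kap" "10 * ln G \<le> kap" "\<bar>ln c\<bar> \<le> kap"
  using lnG by (simp_all add: kap_def)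

lemma nonzero: "v k \<noteq> nul" "y k \<noteq> nul" "u k \<noteq> nul"
  unfolding v_def y_def u_def by (rule x_nonzero)+

lemma norms_ge1: "1 \<le> Nm (v k)" "1 \<le> Nm (y k)" "1 \<le> Nm (u k)"
  unfolding v_def y_def u_def by (rule norm_ge1)+

lemma Lt_le_norms: "Lt (v k) \<le> Nm (v k)" "Lt (y k) \<le> Nm (y k)" "Lt (u k) \<le> Nm (u k)"
  unfolding v_def y_def u_def by (rule Lt_le_norm)+

lemma Lt_poss: "0 < Lt (v k)" "0 < Lt (y k)" "0 < Lt (u k)"
  using nonzero Lt_pos by blast+

lemma log_order:
  "0 \<le> n (y k)" "n (y k) \<le> n (u k)" "n (u k) \<le> n (y (Suc k))"
  "0 \<le> d (v k)" "d (v k) \<le> d (y k)" "d (y k) \<le> d (v (Suc k))" "d (y k) \<le> d (u k)" "d (u k) \<le> d (y (Suc k))"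
proof -
  show "0 \<le> n (y k)" using norms_ge1(2) by (simp add: n_def)
  show "n (y k) \<le> n (u k)" "n (u k) \<le> n (y (Suc k))"
    by (rule n_mono[OF order_facts(3) norms_ge1(2)] n_mono[OF order_facts(4) norms_ge1(3)])+
  show "0 \<le> d (v k)" using order_facts(10)[of k] Lt_poss(1)[of k] by (simp add: d_def)
  show "d (v k) \<le> d (y k)" "d (y k) \<le> d (v (Suc k))" "d (y k) \<le> d (u k)" "d (u k) \<le> d (y (Suc k))"
    by (rule d_mono[OF order_facts(6) nonzero(2)] d_mono[OF order_facts(9) nonzero(1)]
      d_mono[OF order_facts(7) nonzero(3)] d_mono[OF order_facts(8) nonzero(2)])+
qed

lemma log_decay:
  "849/2000 * n (u k) - kap \<le> d (y k)" "849/2000 * n (y k) - kap \<le> d (v k)"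
proof -
  have *: "849/2000 * n q - kap \<le> d p" if "Lt p \<le> c * Nm q powr - (849/2000)" "0 < Lt p" "1 \<le> Nm q" for p q
  proof -
    have "ln (Lt p) \<le> ln (c * Nm q powr - (849/2000))" using that by (intro ln_mono) auto
    also have "\<dots> = ln c - 849/2000 * n q" using c_pos that(3) by (simp add: ln_mult ln_powr n_def)
    finally show ?thesis using kap_ge(3) unfolding d_def by linarith
  qed
  show "849/2000 * n (u k) - kap \<le> d (y k)" "849/2000 * n (y k) - kap \<le> d (v k)"
    by (rule *[OF decay_facts(1) Lt_poss(2) norms_ge1(3)] *[OF decay_facts(2) Lt_poss(1) norms_ge1(2)])+
qed

text \<open>If the norm grows by a factor of at least 3/2, the first product dominates. Otherwise
  the second point may be replaced by its sum or difference with the first, which has smaller norm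
  and therefore, by minimality, no smaller error than the first point.\<close>

lemma wedge_lower:
  "\<exists>j. (j = e0 \<or> j = e1 \<or> j = e2) \<and>
     Nm (x (Suc i)) * Lt (x i) \<le> 3 * \<bar>real_of_int (c0 (x (Suc i))) * j (x i) - real_of_int (c0 (x i)) * j (x (Suc i))\<bar>"
proof -
  let ?p = "x i" and ?q = "x (Suc i)"
  note nn = norm_ge1[of i] norm_Suc[of i] Lt_x_pos[of i] Lt_Suc[of i]
  have Lj: "\<exists>j. (j = e0 \<or> j = e1 \<or> j = e2) \<and> \<bar>j w\<bar> = Lt w" for w using Lt_cases[of w] by metis
  have jle: "\<bar>j w\<bar> \<le> Lt w" if "j = e0 \<or> j = e1 \<or> j = e2" for j w using that e_le by auto
  have diff: "\<bar>a * b\<bar> - \<bar>a' * b'\<bar> \<le> \<bar>a * b - a' * b'\<bar>" for a b a' b' :: real by linarith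
  show ?thesis
  proof (cases "3 * Nm ?p \<le> 2 * Nm ?q")
    case True
    obtain j where j: "j = e0 \<or> j = e1 \<or> j = e2" "\<bar>j ?p\<bar> = Lt ?p" using Lj by blast
    have "\<bar>real_of_int (c0 ?p) * j ?q\<bar> \<le> Nm ?p * Lt ?p"
      unfolding abs_mult Nm_def using jle[OF j(1), of ?q] nn by (intro mult_mono) auto
    moreover have "\<bar>real_of_int (c0 ?q) * j ?p\<bar> = Nm ?q * Lt ?p" by (simp add: abs_mult Nm_def j(2))
    moreover have "3 * (Nm ?p * Lt ?p) \<le> 2 * (Nm ?q * Lt ?p)" using True nn(3) by (simp add: mult_right_mono[of _ _ "Lt ?p"] flip: mult.assoc)
    moreover have "Q \<le> 3 * (A - B)" if "B \<le> S" "A = Q" "3 * S \<le> 2 * Q" for Q A B S :: real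
      using that by (simp add: algebra_simps)
    ultimately have "Nm ?q * Lt ?p \<le> 3 * (\<bar>real_of_int (c0 ?q) * j ?p\<bar> - \<bar>real_of_int (c0 ?p) * j ?q\<bar>)" by blast
    also have "\<dots> \<le> 3 * \<bar>real_of_int (c0 ?q) * j ?p - real_of_int (c0 ?p) * j ?q\<bar>"
      by (rule mult_left_mono[OF diff]) simp
    finally have "Nm ?q * Lt ?p \<le> 3 * \<bar>real_of_int (c0 ?q) * j ?p - real_of_int (c0 ?p) * j ?q\<bar>" .
    then show ?thesis using j(1) by blast
  next
    case False
    \<comment> \<open>The sign is chosen so that the leading coordinates partly cancel.\<close>
    define s where "s = sgn (c0 ?p) * sgn (c0 ?q)"
    define w where "w = cmb 1 ?q (- s) ?p"
    have w0: "\<bar>real_of_int (c0 w)\<bar> = Nm ?q - Nm ?p"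
    proof -
      have "\<bar>c0 ?p\<bar> < \<bar>c0 ?q\<bar>" using nn(2) unfolding Nm_def by linarith
      then have "\<bar>c0 ?q - s * c0 ?p\<bar> = \<bar>c0 ?q\<bar> - \<bar>c0 ?p\<bar>"
        unfolding s_def using x_nonzero(1)[of i] x_nonzero(1)[of "Suc i"]
        by (auto simp: sgn_if abs_if split: if_splits)
      moreover have "c0 w = c0 ?q - s * c0 ?p" by (simp add: w_def)
      ultimately show ?thesis unfolding Nm_def by (metis of_int_abs of_int_diff)
    qed
    have "w \<noteq> nul" using w0 nn(2) by auto
    moreover have "Nm w < Nm ?q" using w0 nn(1) by (simp add: Nm_def)
    ultimately have Lw: "Lt ?p \<le> Lt w" by (rule minimal)
    obtain j where j: "j = e0 \<or> j = e1 \<or> j = e2" "\<bar>j w\<bar> = Lt w" using Lj by blast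
    have "j w = j ?q - real_of_int s * j ?p" using j(1) unfolding w_def by (auto simp: e_cmb)
    moreover have "real_of_int (c0 w) = real_of_int (c0 ?q) - real_of_int s * real_of_int (c0 ?p)" by (simp add: w_def)
    ultimately have "real_of_int (c0 ?q) * j ?p - real_of_int (c0 ?p) * j ?q
        = real_of_int (c0 w) * j ?p - real_of_int (c0 ?p) * j w"
      by algebra
    moreover have "\<bar>real_of_int (c0 w) * j ?p\<bar> \<le> (Nm ?q - Nm ?p) * Lt ?p"
      unfolding abs_mult w0 using jle[OF j(1), of ?p] nn by (intro mult_left_mono) auto
    moreover have "Nm ?p * Lt ?p \<le> \<bar>real_of_int (c0 ?p) * j w\<bar>"
      unfolding abs_mult j(2) Nm_def[symmetric] using Lw nn by (intro mult_left_mono) auto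
    ultimately have "Nm ?p * Lt ?p - (Nm ?q - Nm ?p) * Lt ?p \<le> \<bar>real_of_int (c0 ?q) * j ?p - real_of_int (c0 ?p) * j ?q\<bar>"
      using diff[of "real_of_int (c0 ?p)" "j w" "real_of_int (c0 w)" "j ?p"] by linarith
    moreover have "Nm ?q * Lt ?p \<le> 3 * (Nm ?p * Lt ?p - (Nm ?q - Nm ?p) * Lt ?p)"
    proof -
      have "Nm ?q * Lt ?p \<le> (6 * Nm ?p - 3 * Nm ?q) * Lt ?p" using False nn(3) by (intro mult_right_mono) auto
      then show ?thesis by (simp add: algebra_simps)
    qed
    ultimately show ?thesis using j(1) by fastforce
  qed
qed

text \<open>\<open>y k, u k\<close> and \<open>v (Suc k), y (Suc k)\<close> span the same plane. The
  minors of the first pair are those of the second times a nonzero integer, so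
  \<open>wedge_lower\<close> for the second pair can be compared with the upper bound for the
  first.\<close>

lemma log_height: "n (y (Suc k)) - d (v (Suc k)) \<le> n (u k) - d (y k) + kap"
proof -
  let ?p = "v (Suc k)" and ?q = "y (Suc k)"
  obtain r1 s1 r2 s2 where yu: "y k = cmb r1 ?p s1 ?q" "u k = cmb r2 ?p s2 ?q"
    using lattice_next(1,2)[of k] unfolding lat_def by blast
  define D where "D = r1 * s2 - r2 * s1"
  obtain j where j: "j = e0 \<or> j = e1 \<or> j = e2"
    and lower: "Nm ?q * Lt ?p \<le> 3 * \<bar>real_of_int (c0 ?q) * j ?p - real_of_int (c0 ?p) * j ?q\<bar>"
    using wedge_lower[of "ix (Suc k)"] unfolding v_def[symmetric] y_def[symmetric] by blast
  have jc: "j (cmb r a s b) = real_of_int r * j a + real_of_int s * j b" for r a s b using j by (auto simp: e_cmb)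
  have eq: "real_of_int (c0 (u k)) * j (y k) - real_of_int (c0 (y k)) * j (u k) =
      real_of_int D * (real_of_int (c0 ?q) * j ?p - real_of_int (c0 ?p) * j ?q)"
    unfolding yu jc D_def by (simp add: algebra_simps)
  have "D \<noteq> 0"
  proof
    assume "D = 0"
    have "c0 (y k) * c1 (u k) - c1 (y k) * c0 (u k) = D * (c0 ?p * c1 ?q - c1 ?p * c0 ?q)"
      "c0 (y k) * c2 (u k) - c2 (y k) * c0 (u k) = D * (c0 ?p * c2 ?q - c2 ?p * c0 ?q)"
      "c0 (y k) * c3 (u k) - c3 (y k) * c0 (u k) = D * (c0 ?p * c3 ?q - c3 ?p * c0 ?q)"
      unfolding yu D_def by (simp_all add: algebra_simps)
    then show False using not_proportional[of "Suc (ix k)"] \<open>D = 0\<close> unfolding y_def u_def by simp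
  qed
  then have D1: "1 \<le> \<bar>real_of_int D\<bar>" by linarith
  have "Nm ?q * Lt ?p \<le> 3 * \<bar>real_of_int (c0 (u k)) * j (y k) - real_of_int (c0 (y k)) * j (u k)\<bar>"
  proof -
    let ?w = "\<bar>real_of_int (c0 ?q) * j ?p - real_of_int (c0 ?p) * j ?q\<bar>"
    have "1 * ?w \<le> \<bar>real_of_int D\<bar> * ?w" using D1 by (intro mult_right_mono) auto
    then show ?thesis using lower unfolding eq abs_mult by linarith
  qed
  also have "\<dots> \<le> 3 * (Nm (u k) * Lt (y k) + Nm (u k) * Lt (y k))"
  proof -
    have jle: "\<bar>j w\<bar> \<le> Lt w" for w using j e_le by auto
    have "\<bar>real_of_int (c0 (u k)) * j (y k)\<bar> \<le> Nm (u k) * Lt (y k)"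
      unfolding abs_mult Nm_def using jle by (intro mult_left_mono) auto
    moreover have "\<bar>real_of_int (c0 (y k)) * j (u k)\<bar> \<le> Nm (u k) * Lt (y k)"
      unfolding abs_mult Nm_def[symmetric] using order_facts(3,7)[of k] jle[of "u k"] by (intro mult_mono) (auto simp: Nm_def)
    ultimately show ?thesis
      by (intro mult_left_mono order_trans[OF abs_triangle_ineq4] add_mono) auto
  qed
  finally have "Nm ?q * Lt ?p \<le> 6 * (Nm (u k) * Lt (y k))" by simp
  then have "ln (Nm ?q * Lt ?p) \<le> ln (6 * (Nm (u k) * Lt (y k)))"
    using norms_ge1(2)[of "Suc k"] Lt_poss(1)[of "Suc k"] by (intro ln_mono) auto
  then have "n ?q - d ?p \<le> ln 6 + n (u k) - d (y k)"
    using norms_ge1(2)[of "Suc k"] Lt_poss(1)[of "Suc k"] norms_ge1(3)[of k] Lt_poss(2)[of k]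
    by (simp add: ln_mult n_def d_def)
  then show ?thesis using lnG kap_ge(2) by linarith
qed

text \<open>This expresses \<open>W\<^sub>k = W\<^sub>k\<^sub>+\<^sub>1\<close>: since
  \<open>v (Suc k)\<close> and \<open>y (Suc k)\<close> lie in the first space anyway,
  \<open>u (Suc k)\<close> decides.\<close>

definition same :: "nat \<Rightarrow> bool" where
  "same k \<longleftrightarrow> dot (nrm (v k) (y k) (u k)) (u (Suc k)) = 0"

lemma dot_y_Suc:
  assumes "dot f (y k) = 0" "dot f (u k) = 0"
  shows "dot f (v (Suc k)) = 0" "dot f (y (Suc k)) = 0"
  using lattice_next(3,4)[of k] assms by (auto simp: lat_def dot_cmb)

lemma dot_y_back:
  assumes "dot f (v (Suc k)) = 0" "dot f (y (Suc k)) = 0"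
  shows "dot f (y k) = 0" "dot f (u k) = 0"
  using lattice_next(1,2)[of k] assms by (auto simp: lat_def dot_cmb)

lemma same_dot:
  assumes "same k"
  shows "dot (nrm (v k) (y k) (u k)) (v (Suc k)) = 0" "dot (nrm (v k) (y k) (u k)) (y (Suc k)) = 0"
    "dot (nrm (v k) (y k) (u k)) (u (Suc k)) = 0"
    "par (nrm (v k) (y k) (u k)) (nrm (v (Suc k)) (y (Suc k)) (u (Suc k)))"
proof -
  let ?f = "nrm (v k) (y k) (u k)"
  show *: "dot ?f (v (Suc k)) = 0" "dot ?f (y (Suc k)) = 0" "dot ?f (u (Suc k)) = 0"
    using dot_y_Suc[of ?f k] assms by (simp_all add: same_def)
  show "par ?f (nrm (v (Suc k)) (y (Suc k)) (u (Suc k)))" by (rule par_nrm[OF *])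
qed

lemma not_same_dot:
  assumes "\<not> same k"
  shows "dot (nrm (v (Suc k)) (y (Suc k)) (u (Suc k))) (v k) \<noteq> 0"
proof
  let ?g = "nrm (v (Suc k)) (y (Suc k)) (u (Suc k))"
  assume z: "dot ?g (v k) = 0"
  have "dot ?g (y k) = 0" "dot ?g (u k) = 0" using dot_y_back[of ?g k] by simp_all
  then have "par ?g (nrm (v k) (y k) (u k))" using z by (intro par_nrm)
  then have "par (nrm (v k) (y k) (u k)) ?g" by (rule par_sym)
  then have "dot (nrm (v k) (y k) (u k)) (u (Suc k)) = 0" by (rule par_dot[OF _ nrm_vyu]) simp
  then show False using assms by (simp add: same_def)
qed

lemma ln_nk: "ln (mx (nrm (v k) (y k) (u k))) \<le> ln G + n (u k) - d (v k) - d (y k)"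
  using order_facts[of k] Lt_le_norms norms_ge1 nonzero nrm_vyu by (intro ln_nrm) (auto intro: order_trans)

text \<open>The later space contains \<open>y k\<close> and \<open>u k\<close>, so if the spaces
  differ it misses \<open>v k\<close>. Its normal vector then has a nonzero integer product with
  \<open>v k\<close>, which limits how small the height can be.\<close>

lemma log_not_same:
  assumes "\<not> same k"
  shows "0 \<le> n (u (Suc k)) - d (y (Suc k)) - d (v (Suc k)) - d (v k) + kap"
proof -
  let ?g = "nrm (v (Suc k)) (y (Suc k)) (u (Suc k))"
  have "Nm (v k) \<le> Nm (y (Suc k))" using order_facts[of k] by linarith
  then have "Lt (y (Suc k)) / Nm (y (Suc k)) * Nm (v k) \<le> Lt (y (Suc k)) * 1"
    using Lt_poss(2)[of "Suc k"] norms_ge1(2)[of "Suc k"] by (simp add: field_simps)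
  also have "\<dots> \<le> Lt (v k)" using order_facts[of k] by linarith
  finally have "0 \<le> ln G + ln (mx ?g) + ln (Lt (v k))"
    using norms_ge1(2)[of "Suc k"] Lt_poss(1) nrm_vyu by (intro ln_dot[OF not_same_dot[OF assms], of "y (Suc k)"]) auto
  then show ?thesis using ln_nk[of "Suc k"] kap_ge(2) lnG by (simp add: d_def)
qed

lemma log_far:
  assumes "f \<noteq> nul" "dot f (y j) = 0" "dot f (u j) \<noteq> 0"
  shows "0 \<le> ln (mx f) + n (u j) - d (y j) - n (y j) + ln G"
  by (rule ln_far[OF assms nonzero(2) norms_ge1(2) order_facts(3) order_facts(7)])

text \<open>A repeated space contains \<open>y (k + 2)\<close> but not \<open>u (k + 2)\<close>,
  which bounds its height from below, while the upper bound may be taken from the much shorter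
  points of index \<open>k\<close>. The second claim exploits three equal spaces in the same
  way.\<close>

lemma log_same_not_same:
  assumes "same k" "\<not> same (Suc k)"
  shows "0 \<le> (n (u k) - d (y k) - d (v k)) + n (u (k + 2)) - d (y (k + 2)) - n (y (k + 2)) + kap"
    and "k = Suc j \<Longrightarrow> same j \<Longrightarrow>
      0 \<le> (n (u j) - d (y j) - d (v j)) + n (u (j + 3)) - d (y (j + 3)) - n (y (j + 3)) + kap"
proof -
  let ?f = "nrm (v k) (y k) (u k)" and ?g = "nrm (v (Suc k)) (y (Suc k)) (u (Suc k))"
  have fg: "par ?f ?g" by (rule same_dot[OF assms(1)])
  have y2: "dot ?f (y (k + 2)) = 0" using dot_y_Suc[of ?f "Suc k"] same_dot[OF assms(1)] by simp
  have u2: "dot ?f (u (k + 2)) \<noteq> 0"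
  proof
    assume "dot ?f (u (k + 2)) = 0"
    then have "dot ?g (u (k + 2)) = 0" using par_dot[OF par_sym[OF fg] nrm_vyu] by simp
    then show False using assms(2) by (simp add: same_def)
  qed
  show "0 \<le> (n (u k) - d (y k) - d (v k)) + n (u (k + 2)) - d (y (k + 2)) - n (y (k + 2)) + kap"
    using log_far[OF nrm_vyu y2 u2] ln_nk[of k] kap_ge(2) lnG by linarith
  show "0 \<le> (n (u j) - d (y j) - d (v j)) + n (u (j + 3)) - d (y (j + 3)) - n (y (j + 3)) + kap"
    if "k = Suc j" "same j"
  proof -
    let ?h = "nrm (v j) (y j) (u j)"
    have hf: "par ?h ?f" using same_dot(4)[OF that(2)] that(1) by simp
    have "dot ?h (y (k + 2)) = 0" by (rule par_dot[OF hf nrm_vyu y2])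
    moreover have "dot ?h (u (k + 2)) \<noteq> 0" using u2 par_dot[OF par_sym[OF hf] nrm_vyu] by blast
    ultimately have "0 \<le> ln (mx ?h) + n (u (k + 2)) - d (y (k + 2)) - n (y (k + 2)) + ln G"
      by (rule log_far[OF nrm_vyu])
    then show ?thesis using ln_nk[of j] kap_ge(2) lnG that(1) by (simp add: numeral_eq_Suc)
  qed
qed

lemma not_same_later: "\<exists>k\<ge>m. \<not> same k"
proof (rule ccontr)
  assume "\<not> ?thesis"
  then have s: "same k" if "k \<ge> m" for k using that by blast
  let ?f = "nrm (v m) (y m) (u m)"
  have all: "dot ?f (v k) = 0 \<and> dot ?f (y k) = 0 \<and> dot ?f (u k) = 0" if "k \<ge> m" for k
    using that
  proof (induction k rule: dec_induct)
    case base
    show ?case by simp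
  next
    case (step k)
    have "par ?f (nrm (v k) (y k) (u k))" using step by (intro par_nrm) auto
    from par_dot[OF this nrm_vyu] same_dot(1-3)[OF s[OF step.hyps(1)]] show ?case by simp
  qed
  have "dot ?f (x i) = 0" if i: "i \<ge> Suc (ix m)" for i
  proof -
    define k where "k = (LEAST k. i \<le> ix (Suc k))"
    have ex: "i \<le> ix (Suc i)" using le_ix[of "Suc i"] by linarith
    have k: "i \<le> ix (Suc k)" unfolding k_def by (rule LeastI[of _ i]) (rule ex)
    have km: "m \<le> k"
    proof (rule ccontr)
      assume "\<not> m \<le> k"
      then have "Suc k \<le> m" by simp
      then have "ix (Suc k) \<le> ix m" by (rule lift_Suc_mono_le[of ix, OF less_imp_le[OF ix_Suc]])
      then show False using k i by simp
    qed
    have "Suc (ix k) \<le> i"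
    proof (cases "k = m")
      case True then show ?thesis using i by simp
    next
      case False
      then obtain k' where k': "k = Suc k'" using km by (cases k) auto
      have "\<not> i \<le> ix (Suc k')" using not_less_Least[of k' "\<lambda>k. i \<le> ix (Suc k)"] k' unfolding k_def by simp
      then show ?thesis using k' by simp
    qed
    then have "lat (y k) (u k) (x i)" using lattice_chain k by blast
    then show ?thesis using all[OF km] by (auto simp: lat_def dot_cmb)
  qed
  then have "?f = nul" by (rule form_vanishing)
  then show False using nrm_vyu by simp
qed

text \<open>Otherwise \<open>(wa, wb, wc, 0)\<close> and its shift \<open>(0, wa, wb, wc)\<close>
  both annihilate the space, hence are proportional, which forces the vector to vanish.\<close>

lemma contractions_not_both_zero:
  assumes "\<not> degen (y k)"
  shows "CC (y k) (u k) \<noteq> (0, 0) \<or> CC (y k) (v k) \<noteq> (0, 0)"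
proof (rule ccontr)
  let ?w = "y k"
  define f where "f = Pt (wa ?w) (wb ?w) (wc ?w) 0"
  define g where "g = Pt 0 (wa ?w) (wb ?w) (wc ?w)"
  have C: "Cm ?w p = dot f p" "Cp ?w p = dot g p" for p
    by (simp_all add: Cm_def Cp_def dot_def f_def g_def)
  assume "\<not> ?thesis"
  then have "dot f (u k) = 0" "dot f (v k) = 0" "dot g (u k) = 0" "dot g (v k) = 0"
    by (simp_all add: CC_def C)
  moreover have "dot f (y k) = 0" "dot g (y k) = 0" unfolding C[symmetric] by simp_all
  ultimately have "par f (nrm (v k) (y k) (u k))" "par g (nrm (v k) (y k) (u k))" by (simp_all add: par_nrm)
  then have "par f g" using par_trans[OF _ par_sym nrm_vyu] by blast
  then have "wa ?w * wa ?w = 0" "wa ?w * wb ?w = 0" "wb ?w * wb ?w = wc ?w * wa ?w" "wc ?w * wc ?w = 0"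
    by (simp_all add: par_def f_def g_def)
  then show False using assms by (simp add: degen_def)
qed

text \<open>If \<open>CC (y k) (u k)\<close> vanishes, then the plane spanned by \<open>y k\<close> and \<open>u k\<close> is annihilated by the two shifts of
  a primitive vector, whose size is about the square root of the height of the plane.\<close>

lemma log_contraction_zero:
  assumes nd: "\<not> degen (y k)" and z: "CC (y k) (u k) = (0, 0)" and nz: "CC (y k) (v k) \<noteq> (0, 0)"
  shows "2 * d (v k) \<le> n (u k) - d (y k) + kap"
proof -
  let ?w = "y k"
  define g where "g = gcd (wa ?w) (gcd (wb ?w) (wc ?w))"
  define p q r where "p = wa ?w div g" and "q = wb ?w div g" and "r = wc ?w div g"
  have g0: "g \<noteq> 0" using nd by (auto simp: g_def degen_def)
  have gbc: "g dvd gcd (wb ?w) (wc ?w)" unfolding g_def by (rule gcd_dvd2)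
  have "g dvd wa ?w" unfolding g_def by (rule gcd_dvd1)
  moreover have "g dvd wb ?w" "g dvd wc ?w" by (rule dvd_trans[OF gbc gcd_dvd1] dvd_trans[OF gbc gcd_dvd2])+
  ultimately have "g dvd wa ?w" "g dvd wb ?w" "g dvd wc ?w" by -
  then have w: "wa ?w = g * p" "wb ?w = g * q" "wc ?w = g * r" by (simp_all add: p_def q_def r_def)
  have gn: "\<bar>g\<bar> = g" by (simp add: g_def)
  have "\<bar>g\<bar> = gcd (wa ?w) (gcd (wb ?w) (wc ?w))" by (simp add: g_def)
  also have "\<dots> = gcd (g * p) (gcd (g * q) (g * r))" by (simp only: w)
  also have "\<dots> = \<bar>g\<bar> * gcd p (gcd q r)" by (simp add: gcd_mult_left abs_mult gn)
  finally have prim: "gcd p (gcd q r) = 1" using g0 by simp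
  have C: "Cm ?w t = g * (p * c0 t + q * c1 t + r * c2 t)" "Cp ?w t = g * (p * c1 t + q * c2 t + r * c3 t)" for t
    by (simp_all add: Cm_def Cp_def w algebra_simps)
  have zy: "p * c0 ?w + q * c1 ?w + r * c2 ?w = 0" "p * c1 ?w + q * c2 ?w + r * c3 ?w = 0"
    using C[of ?w] g0 by simp_all
  have zu: "p * c0 (u k) + q * c1 (u k) + r * c2 (u k) = 0" "p * c1 (u k) + q * c2 (u k) + r * c3 (u k) = 0"
    using C[of "u k"] z g0 by (simp_all add: CC_def)
  define s where "s = max \<bar>real_of_int p\<bar> (max \<bar>real_of_int q\<bar> \<bar>real_of_int r\<bar>)"
  have pqr: "p \<noteq> 0 \<or> q \<noteq> 0 \<or> r \<noteq> 0" using prim by auto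
  then have s1: "1 \<le> s" unfolding s_def by (auto simp: le_max_iff_disj)
  have ss: "s * s \<le> 2 * (G * (Nm (u k) * Lt ?w))"
  proof -
    define X where "X = G * (Nm (u k) * Lt ?w)"
    note minor = minor_le[OF Lt_le_norms(2) Lt_le_norms(3) order_facts(3) order_facts(7), of k, folded X_def]
    have ib: "\<bar>i\<bar> \<le> \<lfloor>X\<rfloor>" if "\<bar>real_of_int i\<bar> \<le> X" for i
      using that by (simp add: le_floor_iff)
    have "p * p \<le> 2 * \<lfloor>X\<rfloor> \<and> q * q \<le> 2 * \<lfloor>X\<rfloor> \<and> r * r \<le> 2 * \<lfloor>X\<rfloor>"
      by (rule quadratic_pluecker[OF prim zy zu _ ib[OF minor(1)] ib[OF minor(2)] ib[OF minor(3)]])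
        (use not_proportional[of "Suc (ix k)"] in \<open>simp add: y_def u_def\<close>)
    then have "real_of_int (p * p) \<le> real_of_int (2 * \<lfloor>X\<rfloor>)" "real_of_int (q * q) \<le> real_of_int (2 * \<lfloor>X\<rfloor>)"
      "real_of_int (r * r) \<le> real_of_int (2 * \<lfloor>X\<rfloor>)" by (simp_all only: of_int_le_iff)
    moreover have "real_of_int (2 * \<lfloor>X\<rfloor>) \<le> 2 * X" using of_int_floor_le[of X] by simp
    ultimately have i: "real_of_int (p * p) \<le> 2 * X" "real_of_int (q * q) \<le> 2 * X" "real_of_int (r * r) \<le> 2 * X"
      by linarith+
    have "s = \<bar>real_of_int p\<bar> \<or> s = \<bar>real_of_int q\<bar> \<or> s = \<bar>real_of_int r\<bar>" by (auto simp: s_def max_def)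
    then show ?thesis using i by (auto simp: X_def)
  qed
  have ss': "2 * ln s \<le> ln 2 + ln G + n (u k) - d ?w"
  proof -
    have "ln (s * s) \<le> ln (2 * (G * (Nm (u k) * Lt ?w)))" using ss s1 by (intro ln_mono) auto
    then show ?thesis
      using s1 norms_ge1(3)[of k] Lt_poss(2)[of k] G_ge1000 by (simp add: ln_mult n_def d_def)
  qed
  have "0 \<le> ln G + ln s + ln (Lt (v k))"
  proof -
    have *: "0 \<le> ln G + ln s + ln (Lt (v k))"
      if "dot f (v k) \<noteq> 0" "dot f ?w = 0" "mx f = s" for f
    proof -
      have "Lt ?w / Nm ?w * Nm (v k) \<le> Lt ?w * 1"
        using order_facts(2)[of k] Lt_poss(2)[of k] norms_ge1(2)[of k] by (simp add: field_simps)
      also have "\<dots> \<le> Lt (v k)" using order_facts(6)[of k] by simp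
      finally have "0 \<le> ln G + ln (mx f) + ln (Lt (v k))"
        using that norms_ge1(2)[of k] Lt_poss(1)[of k] by (intro ln_dot[of f "v k" ?w]) (auto simp: dot_def)
      then show ?thesis using that(3) by simp
    qed
    have "p * c0 (v k) + q * c1 (v k) + r * c2 (v k) \<noteq> 0 \<or> p * c1 (v k) + q * c2 (v k) + r * c3 (v k) \<noteq> 0"
      using nz C[of "v k"] by (auto simp: CC_def)
    then show ?thesis
    proof
      assume "p * c0 (v k) + q * c1 (v k) + r * c2 (v k) \<noteq> 0"
      then show ?thesis by (intro *[of "Pt p q r 0"]) (use zy in \<open>auto simp: dot_def mx_def s_def max_def\<close>)
    next
      assume "p * c1 (v k) + q * c2 (v k) + r * c3 (v k) \<noteq> 0"
      then show ?thesis by (intro *[of "Pt 0 p q r"]) (use zy in \<open>auto simp: dot_def mx_def s_def max_def\<close>)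
    qed
  qed
  then show ?thesis using ss' kap_ge(2) lnG by (simp add: d_def)
qed

text \<open>If contraction with \<open>y (Suc k)\<close> kills the plane, its cross product is
  orthogonal to both shifts of \<open>y k\<close>, hence proportional to the cross product of
  \<open>y k\<close>, and so contraction with \<open>y k\<close> kills \<open>u k\<close> as
  well.\<close>

lemma contraction_zero_back:
  assumes nd: "\<not> degen (y (Suc k))" and z: "CC (y (Suc k)) (v (Suc k)) = (0, 0)"
  shows "CC (y k) (u k) = (0, 0)"
proof -
  let ?w = "y (Suc k)"
  have lin: "Cm ?w t = 0 \<and> Cp ?w t = 0" if "lat (v (Suc k)) ?w t" for t
    using that z by (auto simp: lat_def Cm_cmb Cp_cmb CC_def)
  have y: "Cm ?w (y k) = 0" "Cp ?w (y k) = 0" and u: "Cm ?w (u k) = 0" "Cp ?w (u k) = 0"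
    using lin lattice_next(1,2) by blast+
  have p: "wa (y k) * wb ?w = wb (y k) * wa ?w" "wa (y k) * wc ?w = wc (y k) * wa ?w" "wb (y k) * wc ?w = wc (y k) * wb ?w"
    using y unfolding Cm_def Cp_def w_defs[of "y k"] by algebra+
  have "wa ?w * Cm (y k) (u k) = wa (y k) * Cm ?w (u k)" "wb ?w * Cm (y k) (u k) = wb (y k) * Cm ?w (u k)"
    "wc ?w * Cm (y k) (u k) = wc (y k) * Cm ?w (u k)"
    "wa ?w * Cp (y k) (u k) = wa (y k) * Cp ?w (u k)" "wb ?w * Cp (y k) (u k) = wb (y k) * Cp ?w (u k)"
    "wc ?w * Cp (y k) (u k) = wc (y k) * Cp ?w (u k)"
    unfolding Cm_def[of _ "u k"] Cp_def[of _ "u k"] using p by algebra+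
  then show ?thesis using u nd by (auto simp: degen_def CC_def)
qed

lemma log_q:
  assumes "CC (y k) (v k) \<noteq> (0, 0)"
  shows "d (y k) + d (v k) \<le> n (y k) + kap"
  using ln_CC(3)[OF assms Lt_le_norms(2) norms_ge1(2) nonzero(2) nonzero(1) norms_ge1(1) order_facts(2) order_facts(6)]
    ln_CC(4)[OF assms Lt_le_norms(2) norms_ge1(2) nonzero(2) nonzero(1) norms_ge1(1)]
    kap_ge(2) lnG by linarith

lemma n_at_top: "filterlim (\<lambda>k. n (u k)) at_top sequentially"
proof -
  have "filterlim (\<lambda>k. Nm (u k)) at_top sequentially"
  proof (rule filterlim_at_top_mono[OF filterlim_real_sequentially])
    have "real k \<le> Nm (u k)" for k
      using norm_ge_index[of "Suc (Suc (ix k))"] le_ix[of k] unfolding u_def by linarith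
    then show "\<forall>\<^sub>F k in sequentially. real k \<le> Nm (u k)" by simp
  qed
  then show ?thesis unfolding n_def by (rule filterlim_compose[OF ln_at_top])
qed

lemma contractions_nonzero:
  "\<exists>k0. \<forall>k\<ge>k0. CC (y k) (u k) \<noteq> (0, 0) \<and> CC (y k) (v k) \<noteq> (0, 0)"
proof -
  obtain i0 where i0: "\<And>i. i \<ge> i0 \<Longrightarrow> \<not> degen (x i)" using eventually_not_degen by blast
  have nd: "\<not> degen (y k)" if "k \<ge> i0" for k
    using that le_ix[of k] unfolding y_def by (intro i0) linarith
  have "\<forall>\<^sub>F k in sequentially. 1000000 * kap + 1 \<le> n (u k)"
    using n_at_top unfolding filterlim_at_top by blast
  then obtain k1 where k1: "\<And>k. k \<ge> k1 \<Longrightarrow> 1000000 * kap + 1 \<le> n (u k)"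
    unfolding eventually_sequentially by blast
  have p: "CC (y (Suc k)) (u (Suc k)) \<noteq> (0, 0)" if "k \<ge> max i0 k1" for k
  proof
    assume z: "CC (y (Suc k)) (u (Suc k)) = (0, 0)"
    have nd': "\<not> degen (y (Suc k))" using that by (intro nd) simp
    have nz: "CC (y (Suc k)) (v (Suc k)) \<noteq> (0, 0)" using contractions_not_both_zero[OF nd'] z by blast
    have big: "1000000 * kap + 1 \<le> n (u (Suc k))" using that by (intro k1) simp
    \<comment> \<open>Write m for \<open>d (v (Suc k))\<close> and a for
      \<open>n (y (Suc k))\<close>. The height and decay estimates give m at least about 0.4245 a,
      the vanishing contraction at most about 0.404 a.\<close>
    show False
      using big log_contraction_zero[OF nd' z nz] log_q[OF nz] log_height[of k] log_decay(1)[of k] log_decay(1)[of "Suc k"]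
        log_order[of k] log_order(2)[of "Suc k"] kap_ge(1)
      by linarith
  qed
  have q: "CC (y (Suc (Suc k))) (v (Suc (Suc k))) \<noteq> (0, 0)" if "k \<ge> max i0 k1" for k
    using contraction_zero_back[of "Suc k"] p[OF that] nd[of "Suc (Suc k)"] that by fastforce
  have "CC (y k) (u k) \<noteq> (0, 0) \<and> CC (y k) (v k) \<noteq> (0, 0)" if "k \<ge> Suc (Suc (max i0 k1))" for k
  proof -
    define j where "j = k - 2"
    have "k = Suc (Suc j)" "j \<ge> max i0 k1" using that unfolding j_def by linarith+
    then show ?thesis using p[of "Suc j"] q[of j] by simp
  qed
  then show ?thesis by blast
qed

end

section \<open>Linear inequalities between the logarithms\<close>

lemma primitive_vector:
  assumes "p \<noteq> (0, 0)"
  shows "\<exists>e. (\<exists>g. g \<noteq> 0 \<and> p = scl g e) \<and> e \<noteq> (0, 0) \<and> (\<forall>r. crs e r = 0 \<longrightarrow> (\<exists>t. r = scl t e))"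
proof -
  define g where "g = gcd (fst p) (snd p)"
  have g0: "g \<noteq> 0" using assms by (cases p) (auto simp: g_def)
  define e where "e = (fst p div g, snd p div g)"
  have pe: "p = scl g e" by (cases p) (simp add: e_def scl_def g_def)
  obtain s t where st: "s * fst p + t * snd p = g" using bezout_int unfolding g_def by blast
  then have "g * (s * fst e + t * snd e) = g * 1" unfolding pe scl_def by (simp add: algebra_simps)
  then have b: "s * fst e + t * snd e = 1" using g0 by simp
  have "\<exists>c. r = scl c e" if "crs e r = 0" for r
  proof -
    have "fst r = (s * fst r + t * snd r) * fst e" "snd r = (s * fst r + t * snd r) * snd e"
      using b that unfolding crs_def by algebra+
    then show ?thesis by (metis prod.collapse scl_def)
  qed
  moreover have "e \<noteq> (0, 0)" using b by auto
  ultimately show ?thesis using pe g0 by blast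
qed

lemma scl_scl: "scl a (scl b p) = scl (a * b) p" by (simp add: scl_def)

lemma scl_zero_iff: "scl a p = (0, 0) \<longleftrightarrow> a = 0 \<or> p = (0, 0)"
  by (cases p) (auto simp: scl_def)

abbreviation (input) suc2 where "suc2 k \<equiv> Suc (Suc k)"
abbreviation (input) suc3 where "suc3 k \<equiv> Suc (Suc (Suc k))"
abbreviation (input) suc4 where "suc4 k \<equiv> Suc (Suc (Suc (Suc k)))"
abbreviation (input) suc5 where "suc5 k \<equiv> Suc (Suc (Suc (Suc (Suc k))))"
abbreviation (input) suc6 where "suc6 k \<equiv> Suc (Suc (Suc (Suc (Suc (Suc k)))))"
abbreviation (input) suc7 where "suc7 k \<equiv> Suc (Suc (Suc (Suc (Suc (Suc (Suc k))))))"
abbreviation (input) suc8 where "suc8 k \<equiv> Suc (Suc (Suc (Suc (Suc (Suc (Suc (Suc k)))))))"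
abbreviation (input) suc9 where "suc9 k \<equiv> Suc (Suc (Suc (Suc (Suc (Suc (Suc (Suc (Suc k))))))))"

text \<open>A tail of the sequences above, so far out that the additive constant \<open>K\<close> of all estimates is negligible.\<close>

locale regular_points = cubic_independent +
  fixes v y u :: "nat \<Rightarrow> pt" and K :: real
  assumes K_ge1: "1 \<le> K" and K_lnG: "10 * ln G \<le> K"
    and K_small: "\<And>k. 1000000 * K \<le> n (u k)"
    and n_at_top: "filterlim (\<lambda>k. n (u k)) at_top sequentially"
    and irrationality: "\<And>p. p \<noteq> (0, 0) \<Longrightarrow> - (236/100) * ln (sz p) - K \<le> ln (er p)"
    and nrm_vyu: "\<And>k. nrm (v k) (y k) (u k) \<noteq> nul"
    and nonzero: "\<And>k. v k \<noteq> nul" "\<And>k. y k \<noteq> nul" "\<And>k. u k \<noteq> nul"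
    and norms_ge1: "\<And>k. 1 \<le> Nm (v k)" "\<And>k. 1 \<le> Nm (y k)" "\<And>k. 1 \<le> Nm (u k)"
    and Lt_le_norms: "\<And>k. Lt (v k) \<le> Nm (v k)" "\<And>k. Lt (y k) \<le> Nm (y k)" "\<And>k. Lt (u k) \<le> Nm (u k)"
    and norm_order: "\<And>k. Nm (v k) \<le> Nm (y k)" "\<And>k. Nm (y k) \<le> Nm (u k)" "\<And>k. Nm (u k) \<le> Nm (y (Suc k))"
    and Lt_order: "\<And>k. Lt (y k) \<le> Lt (v k)" "\<And>k. Lt (u k) \<le> Lt (y k)" "\<And>k. Lt (y (Suc k)) \<le> Lt (u k)"
      "\<And>k. Lt (v (Suc k)) \<le> Lt (y k)" "\<And>k. Lt (y (Suc k)) < Lt (y k)"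
    and lattice: "\<And>k. lat (v (Suc k)) (y (Suc k)) (y k)" "\<And>k. lat (v (Suc k)) (y (Suc k)) (u k)"
      "\<And>k. lat (y k) (u k) (v (Suc k))" "\<And>k. lat (y k) (u k) (y (Suc k))"
    and contractions: "\<And>k. CC (y k) (u k) \<noteq> (0, 0)" "\<And>k. CC (y k) (v k) \<noteq> (0, 0)"
    and log_decay: "\<And>k. 849/2000 * n (u k) - K \<le> d (y k)" "\<And>k. 849/2000 * n (y k) - K \<le> d (v k)"
    and log_height: "\<And>k. n (y (Suc k)) - d (v (Suc k)) \<le> n (u k) - d (y k) + K"
    and log_not_same: "\<And>k. dot (nrm (v k) (y k) (u k)) (u (Suc k)) \<noteq> 0 \<Longrightarrow>
      0 \<le> n (u (Suc k)) - d (y (Suc k)) - d (v (Suc k)) - d (v k) + K"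
    and log_tight: "\<And>k. dot (nrm (v k) (y k) (u k)) (u (Suc k)) = 0 \<Longrightarrow>
      dot (nrm (v (Suc k)) (y (Suc k)) (u (Suc k))) (u (suc2 k)) \<noteq> 0 \<Longrightarrow>
      0 \<le> n (u k) - d (y k) - d (v k) + n (u (suc2 k)) - d (y (suc2 k)) - n (y (suc2 k)) + K"
    and log_triple: "\<And>k. dot (nrm (v k) (y k) (u k)) (u (Suc k)) = 0 \<Longrightarrow>
      dot (nrm (v (Suc k)) (y (Suc k)) (u (Suc k))) (u (suc2 k)) = 0 \<Longrightarrow>
      dot (nrm (v (suc2 k)) (y (suc2 k)) (u (suc2 k))) (u (suc3 k)) \<noteq> 0 \<Longrightarrow>
      0 \<le> n (u k) - d (y k) - d (v k) + n (u (suc3 k)) - d (y (suc3 k)) - n (y (suc3 k)) + K"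
    and not_same_later: "\<And>k. \<exists>j\<ge>k. dot (nrm (v j) (y j) (u j)) (u (Suc j)) \<noteq> 0"

theorem (in minimal_points) regular_points_exist: "\<exists>v y u K. regular_points \<xi> v y u K"
proof -
  obtain K0 where K0: "0 \<le> K0" "\<And>p. p \<noteq> (0, 0) \<Longrightarrow> ln (er p) \<ge> - (236/100) * ln (sz p) - K0"
    using irrationality_measure by blast
  define K where "K = K0 + kap"
  have K: "kap \<le> K" "K0 \<le> K" using K0(1) kap_ge(1) by (simp_all add: K_def)
  have "exp 1 \<le> G" using exp_le G_ge1000 by linarith
  then have "1 \<le> ln G" using G_ge1000 by (subst ln_ge_iff) auto
  then have K1: "1 \<le> K" "10 * ln G \<le> K" using kap_ge(2) K by linarith+
  obtain k0 where k0: "\<And>k. k \<ge> k0 \<Longrightarrow> CC (y k) (u k) \<noteq> (0, 0)" "\<And>k. k \<ge> k0 \<Longrightarrow> CC (y k) (v k) \<noteq> (0, 0)"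
    using contractions_nonzero by blast
  have "\<forall>\<^sub>F k in sequentially. 1000000 * K \<le> n (u k)"
    using n_at_top unfolding filterlim_at_top by blast
  then obtain k1 where k1: "\<And>k. k \<ge> k1 \<Longrightarrow> 1000000 * K \<le> n (u k)"
    unfolding eventually_sequentially by blast
  define N where "N = k0 + k1"
  define f where "f k = N + k" for k
  have f: "f (Suc k) = Suc (f k)" "k0 \<le> f k" "k1 \<le> f k" "k \<le> f k" for k by (simp_all add: f_def N_def)
  have strict: "Lt (y (Suc k)) < Lt (y k)" for k
  proof -
    have "Lt (y (Suc k)) \<le> Lt (u k)" by (rule order_facts)
    also have "Lt (u k) < Lt (y k)" unfolding u_def y_def by (rule Lt_Suc)
    finally show ?thesis .
  qed
  have dk: "0 \<le> X + K" if "0 \<le> X + kap" for X using that K by linarith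
  have "regular_points \<xi> (\<lambda>k. v (f k)) (\<lambda>k. y (f k)) (\<lambda>k. u (f k)) K"
  proof (unfold_locales, unfold f(1))
    show "filterlim (\<lambda>k. n (u (f k))) at_top sequentially"
      by (rule filterlim_compose[OF n_at_top filterlim_subseq]) (simp add: strict_mono_def f_def)
    show "- (236/100) * ln (sz p) - K \<le> ln (er p)" if "p \<noteq> (0, 0)" for p using K0(2)[OF that] K by linarith
    show "849/2000 * n (u (f k)) - K \<le> d (y (f k))" "849/2000 * n (y (f k)) - K \<le> d (v (f k))" for k
      using log_decay[of "f k"] K by linarith+
    show "n (y (Suc (f k))) - d (v (Suc (f k))) \<le> n (u (f k)) - d (y (f k)) + K" for k
      using log_height[of "f k"] K by linarith
    show "\<exists>j\<ge>k. dot (nrm (v (f j)) (y (f j)) (u (f j))) (u (Suc (f j))) \<noteq> 0" for k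
    proof -
      obtain i where i: "i \<ge> f k" "\<not> same i" using not_same_later by blast
      then have "i = f (i - N)" "i - N \<ge> k" by (auto simp: f_def)
      then show ?thesis using i(2) unfolding same_def by metis
    qed
    fix k
    assume s: "dot (nrm (v (f k)) (y (f k)) (u (f k))) (u (Suc (f k))) = 0"
    then have "same (f k)" by (simp add: same_def)
    show "0 \<le> n (u (f k)) - d (y (f k)) - d (v (f k)) + n (u (Suc (Suc (f k)))) - d (y (Suc (Suc (f k)))) - n (y (Suc (Suc (f k)))) + K"
      if "dot (nrm (v (Suc (f k))) (y (Suc (f k))) (u (Suc (f k)))) (u (Suc (Suc (f k)))) \<noteq> 0"
      using log_same_not_same(1)[of "f k"] s that K by (simp add: same_def)
    show "0 \<le> n (u (f k)) - d (y (f k)) - d (v (f k)) + n (u (Suc (Suc (Suc (f k))))) - d (y (Suc (Suc (Suc (f k)))))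
        - n (y (Suc (Suc (Suc (f k))))) + K"
      if "dot (nrm (v (Suc (f k))) (y (Suc (f k))) (u (Suc (f k)))) (u (Suc (Suc (f k)))) = 0"
        "dot (nrm (v (Suc (Suc (f k)))) (y (Suc (Suc (f k)))) (u (Suc (Suc (f k))))) (u (Suc (Suc (Suc (f k))))) \<noteq> 0"
      using log_same_not_same(2)[of "Suc (f k)" "f k"] s that K by (simp add: same_def numeral_eq_Suc)
  next
    show "0 \<le> n (u (Suc (f k))) - d (y (Suc (f k))) - d (v (Suc (f k))) - d (v (f k)) + K"
      if "dot (nrm (v (f k)) (y (f k)) (u (f k))) (u (Suc (f k))) \<noteq> 0" for k
      using log_not_same[of "f k"] that K by (simp add: same_def)
  qed (use K1 k1 k0 f nrm_vyu nonzero norms_ge1 Lt_le_norms order_facts strict lattice_next in \<open>auto\<close>)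
  then show ?thesis by blast
qed

section \<open>Consequences of the size estimates\<close>

context regular_points
begin

abbreviation a where "a k \<equiv> n (y k)"
abbreviation z where "z k \<equiv> n (u k)"
abbreviation l where "l k \<equiv> d (y k)"
abbreviation m where "m k \<equiv> d (v k)"

definition same :: "nat \<Rightarrow> bool" where
  "same k \<longleftrightarrow> dot (nrm (v k) (y k) (u k)) (u (Suc k)) = 0"

lemmas not_same = log_not_same[folded same_def]
lemmas same_not_same = log_tight[folded same_def]
lemmas same_same_not_same = log_triple[folded same_def]

lemma log_order: "0 \<le> a k" "a k \<le> z k" "z k \<le> a (Suc k)" "m k \<le> l k" "l k \<le> m (Suc k)"
proof -
  show "0 \<le> a k" using norms_ge1(2) by (simp add: n_def)
  show "a k \<le> z k" "z k \<le> a (Suc k)"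
    by (rule n_mono[OF norm_order(2) norms_ge1(2)] n_mono[OF norm_order(3) norms_ge1(3)])+
  show "m k \<le> l k" "l k \<le> m (Suc k)"
    by (rule d_mono[OF Lt_order(1) nonzero(2)] d_mono[OF Lt_order(4) nonzero(1)])+
qed

lemma log_q: "l k + m k \<le> a k + K"
  using ln_CC(3)[OF contractions(2) Lt_le_norms(2) norms_ge1(2) nonzero(2) nonzero(1) norms_ge1(1) norm_order(1) Lt_order(1), of k]
    ln_CC(4)[OF contractions(2) Lt_le_norms(2) norms_ge1(2) nonzero(2) nonzero(1) norms_ge1(1), of k]
    K_lnG lnG by linarith

text \<open>Go to the end of the run of equal spaces, which exists by \<open>not_same_later\<close>.
  There the shortest points of three equal spaces bound a height that must allow for a much later
  point.\<close>

lemma not_same_Suc: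
  assumes "same j"
  shows "\<not> same (Suc j)"
proof
  assume s1: "same (Suc j)"
  define t where "t = (LEAST t. t \<ge> j \<and> \<not> same t)"
  have "\<exists>t\<ge>j. \<not> same t" using not_same_later unfolding same_def by blast
  then have t: "t \<ge> j" "\<not> same t" unfolding t_def by (metis (mono_tags, lifting) LeastI)+
  have before: "same i" if "j \<le> i" "i < t" for i using not_less_Least[of i "\<lambda>t. t \<ge> j \<and> \<not> same t"] that unfolding t_def by blast
  have "t \<noteq> j" "t \<noteq> Suc j" using t assms s1 by auto
  then obtain i where i: "t = suc2 i" "j \<le> i" using t(1)
    by (intro that[of "t - 2"]) linarith+
  have s: "same i" "same (Suc i)" "\<not> same (suc2 i)" using before t i by auto
  show False
    using K_ge1 log_decay(1)[of i] log_decay(2)[of i] log_q[of i] K_small[of i] log_decay(1)[of "(Suc i)"] log_decay(2)[of "(Suc i)"]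
      log_decay(2)[of "(suc2 i)"] log_decay(1)[of "(suc3 i)"] log_decay(2)[of "(suc3 i)"] log_q[of "(suc3 i)"] log_order(3)[of i] log_order(3)[of "(Suc i)"]
      same_same_not_same[OF s] same_not_same[OF s(2,3)] not_same[OF s(3)]
    by linarith
qed

abbreviation S where "S r \<equiv> ln (sz r)"
abbreviation E where "E r \<equiv> ln (er r)"

lemma S_nonneg: "r \<noteq> (0, 0) \<Longrightarrow> 0 \<le> S r"
  using sz_ge1[of r] by simp

lemma log_scl:
  assumes "g \<noteq> 0" "r \<noteq> (0, 0)"
  shows "S (scl g r) = ln \<bar>real_of_int g\<bar> + S r" "E (scl g r) = ln \<bar>real_of_int g\<bar> + E r" "0 \<le> ln \<bar>real_of_int g\<bar>"
proof -
  have "1 \<le> \<bar>real_of_int g\<bar>" using assms(1) by linarith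
  then show "S (scl g r) = ln \<bar>real_of_int g\<bar> + S r" "E (scl g r) = ln \<bar>real_of_int g\<bar> + E r" "0 \<le> ln \<bar>real_of_int g\<bar>"
    using er_pos[OF assms(2)] sz_ge1[OF assms(2)] by (simp_all add: sz_scl er_scl ln_mult)
qed

lemma ln_sum_cases:
  fixes X Y Y' :: real
  assumes "0 < X" "X \<le> Y + Y'" "0 < Y" "0 < Y'"
  shows "ln X \<le> ln 2 + ln Y \<or> ln X \<le> ln 2 + ln Y'"
proof -
  consider "X \<le> 2 * Y" | "X \<le> 2 * Y'" using assms by linarith
  then show ?thesis
  proof cases
    case 1
    then have "ln X \<le> ln (2 * Y)" using assms by (intro ln_mono) auto
    then show ?thesis using assms by (simp add: ln_mult)
  next
    case 2
    then have "ln X \<le> ln (2 * Y')" using assms by (intro ln_mono) auto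
    then show ?thesis using assms by (simp add: ln_mult)
  qed
qed

lemma ln2: "ln 2 \<le> K / 10"
proof -
  have "ln 2 \<le> ln G" using G_ge1000 by simp
  then show ?thesis using K_lnG by simp
qed

text \<open>This is the source of all parallelism: pairs whose sizes do not compensate each other's
  errors have determinant less than 1 in absolute value.\<close>

lemma log_crs:
  assumes "crs r s \<noteq> 0"
  shows "0 \<le> S r + E s + K \<or> 0 \<le> S s + E r + K"
proof -
  have ne: "r \<noteq> (0, 0)" "s \<noteq> (0, 0)" using assms by (auto simp: crs_def)
  note pos = er_pos[OF ne(1)] er_pos[OF ne(2)] sz_ge1[OF ne(1)] sz_ge1[OF ne(2)]
  have "1 \<le> \<bar>real_of_int (crs r s)\<bar>" using assms by linarith
  also have "\<dots> \<le> sz s * er r + sz r * er s" by (rule crs_le)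
  finally have "1 \<le> sz s * er r + sz r * er s" .
  from ln_sum_cases[OF _ this] pos have "0 \<le> ln 2 + ln (sz s * er r) \<or> 0 \<le> ln 2 + ln (sz r * er s)" by simp
  then show ?thesis using pos ln2 K_ge1 by (auto simp: ln_mult)
qed

section \<open>Contractions of successive points and the lines they span\<close>

definition p where "p k = CC (y k) (y (Suc k))"
definition q where "q k = CC (y (Suc k)) (y k)"

lemma CC_cmb: "CC w (cmb r s t x) = (r * Cm w s + t * Cm w x, r * Cp w s + t * Cp w x)"
  by (simp add: CC_def Cm_cmb Cp_cmb)

text \<open>A multiple of \<open>y k\<close> could not have a smaller error. As contraction with
  \<open>y k\<close> kills \<open>y k\<close> itself, the contraction with \<open>y (Suc k)\<close>
  is a nonzero multiple of that with \<open>u k\<close>.\<close>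

lemma y_combination:
  obtains r s where "s \<noteq> 0" "y (Suc k) = cmb r (y k) s (u k)"
proof -
  obtain r s where rs: "y (Suc k) = cmb r (y k) s (u k)" using lattice(4)[of k] by (auto simp: lat_def)
  have "s \<noteq> 0"
  proof
    assume "s = 0"
    then have eq: "y (Suc k) = cmb r (y k) 0 (u k)" using rs by simp
    then have "r \<noteq> 0" using nonzero(2)[of "Suc k"] by (auto simp: pt_eq_iff)
    then have r1: "1 \<le> \<bar>real_of_int r\<bar>" by linarith
    have "e0 (y (Suc k)) = r * e0 (y k)" "e1 (y (Suc k)) = r * e1 (y k)" "e2 (y (Suc k)) = r * e2 (y k)"
      unfolding eq e_cmb by simp_all
    then have "Lt (y (Suc k)) = \<bar>real_of_int r\<bar> * Lt (y k)"
      unfolding Lt_def by (simp add: abs_mult max_mult_distrib_left)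
    then show False using Lt_order(5)[of k] mult_right_mono[OF r1 Lt_nonneg[of "y k"]] by simp
  qed
  then show thesis using rs by (rule that)
qed

lemma y_combination_back:
  obtains r s where "r \<noteq> 0" "y k = cmb r (v (Suc k)) s (y (Suc k))"
proof -
  obtain r s where rs: "y k = cmb r (v (Suc k)) s (y (Suc k))" using lattice(1)[of k] by (auto simp: lat_def)
  have "r \<noteq> 0"
  proof
    assume "r = 0"
    then have eq: "y k = cmb 0 (v (Suc k)) s (y (Suc k))" using rs by simp
    obtain r' s' where rs': "s' \<noteq> 0" "y (Suc k) = cmb r' (y k) s' (u k)" by (rule y_combination)
    have "CC (y k) (y (Suc k)) = scl s' (CC (y k) (u k))"
      unfolding rs' CC_cmb by (simp add: CC_def scl_def)
    then have "CC (y k) (y (Suc k)) \<noteq> (0, 0)" using contractions(1)[of k] rs'(1) by (simp add: scl_zero_iff)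
    moreover have "CC (y k) (y k) = scl s (CC (y k) (y (Suc k)))" by (subst (2) eq) (simp only: CC_cmb; simp add: CC_def scl_def)
    ultimately have "s = 0" by (metis scl_zero_iff C_self(3))
    then show False using eq nonzero(2)[of k] by (simp add: pt_eq_iff)
  qed
  then show thesis using rs by (rule that)
qed

lemma p_multiple: obtains g where "g \<noteq> 0" "p k = scl g (CC (y k) (u k))"
proof -
  obtain r s where rs: "s \<noteq> 0" "y (Suc k) = cmb r (y k) s (u k)" by (rule y_combination)
  then show thesis by (intro that[of s]) (simp_all add: p_def CC_cmb, simp add: CC_def scl_def)
qed

lemma q_multiple: obtains g where "g \<noteq> 0" "q k = scl g (CC (y (Suc k)) (v (Suc k)))"
proof -
  obtain r s where rs: "r \<noteq> 0" "y k = cmb r (v (Suc k)) s (y (Suc k))" by (rule y_combination_back)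
  have "q k = CC (y (Suc k)) (cmb r (v (Suc k)) s (y (Suc k)))" unfolding q_def by (rule arg_cong[OF rs(2)])
  also have "\<dots> = scl r (CC (y (Suc k)) (v (Suc k)))" unfolding CC_cmb by (simp add: CC_def scl_def)
  finally have "q k = scl r (CC (y (Suc k)) (v (Suc k)))" .
  then show thesis using rs(1) by (rule that[rotated])
qed

lemma p_nonzero: "p k \<noteq> (0, 0)" and q_nonzero: "q k \<noteq> (0, 0)"
  using p_multiple[of k] q_multiple[of k] contractions[of k] contractions[of "Suc k"] by (metis scl_zero_iff)+

lemmas CC_prems = Lt_le_norms(2) norms_ge1(2) nonzero(2) nonzero(2) norms_ge1(2)

lemma y_order: "i \<le> k \<Longrightarrow> Nm (y i) \<le> Nm (y k)" "i \<le> k \<Longrightarrow> Lt (y k) \<le> Lt (y i)"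
  by (rule lift_Suc_mono_le[of "\<lambda>k. Nm (y k)"], rule order_trans[OF norm_order(2,3)], assumption)
    (rule lift_Suc_antimono_le[of "\<lambda>k. Lt (y k)"], rule less_imp_le[OF Lt_order(5)], assumption)

lemma log_CC:
  assumes "CC (y i) (y k) \<noteq> (0, 0)"
  shows "E (CC (y i) (y k)) \<le> a i - l i - l k + K / 5"
    and "i \<le> k \<Longrightarrow> S (CC (y i) (y k)) \<le> a k - 2 * l i + K / 5"
    and "k \<le> i \<Longrightarrow> S (CC (y i) (y k)) \<le> a i - l i - l k + K / 5"
  using ln_CC(1)[OF assms CC_prems] ln_CC(2)[OF assms CC_prems y_order] ln_CC(3)[OF assms CC_prems y_order] K_lnG lnG by simp_all

lemma p_size: "S (p k) \<le> a (Suc k) - 2 * l k + K" "E (p k) \<le> a k - l k - l (Suc k) + K" "0 \<le> S (p k)"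
  and q_size: "S (q k) \<le> a (Suc k) - l (Suc k) - l k + K" "E (q k) \<le> a (Suc k) - l (Suc k) - l k + K" "0 \<le> S (q k)"
  using log_CC[of k "Suc k"] log_CC[of "Suc k" k] p_nonzero[of k] q_nonzero[of k] S_nonneg[OF p_nonzero] S_nonneg[OF q_nonzero] K_ge1
  unfolding p_def q_def by auto

text \<open>This is, up to sign, the generator of all integer pairs parallel to
  \<open>p k\<close>.\<close>

definition e where
  "e k = (SOME e. (\<exists>g. g \<noteq> 0 \<and> p k = scl g e) \<and> e \<noteq> (0, 0) \<and> (\<forall>r. crs e r = 0 \<longrightarrow> (\<exists>t. r = scl t e)))"

lemma e_props: "\<exists>g. g \<noteq> 0 \<and> p k = scl g (e k)" "e k \<noteq> (0, 0)" "crs (e k) r = 0 \<Longrightarrow> \<exists>t. r = scl t (e k)"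
  using someI_ex[OF primitive_vector[OF p_nonzero[of k]], folded e_def] by blast+

lemma e_multiple:
  assumes "crs (e k) r = 0" "r \<noteq> (0, 0)"
  obtains t where "t \<noteq> 0" "r = scl t (e k)"
  using e_props(3)[OF assms(1)] assms(2) by (metis scl_zero_iff)

lemma e_minimal:
  assumes "crs (e k) r = 0" "r \<noteq> (0, 0)"
  shows "S (e k) \<le> S r" "E (e k) \<le> E r"
proof -
  obtain t where t: "t \<noteq> 0" "r = scl t (e k)" using assms by (rule e_multiple)
  then show "S (e k) \<le> S r" "E (e k) \<le> E r" using log_scl[OF t(1) e_props(2)[of k]] by simp_all
qed

text \<open>The two bounds come from different multiples of \<open>e k\<close>: the size from the
  contraction with the shorter point \<open>u k\<close>, the error from that with the more accurate
  point \<open>y (Suc k)\<close>.\<close>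

lemma e_size: "0 \<le> S (e k)" "S (e k) \<le> z k - 2 * l k + K" "E (e k) \<le> a k - l k - l (Suc k) + K"
proof -
  show "0 \<le> S (e k)" by (rule S_nonneg[OF e_props(2)])
  obtain g where g: "g \<noteq> 0" "p k = scl g (CC (y k) (u k))" by (rule p_multiple)
  obtain g' where g': "g' \<noteq> 0" "p k = scl g' (e k)" using e_props(1) by blast
  have pp: "crs (e k) (p k) = 0" using g' by simp
  then have "crs (e k) (CC (y k) (u k)) = 0" using g by simp
  from e_minimal(1)[OF this contractions(1)]
  show "S (e k) \<le> z k - 2 * l k + K"
    using ln_CC(2)[OF contractions(1) Lt_le_norms(2) norms_ge1(2) nonzero(2) nonzero(3) norms_ge1(3) norm_order(2) Lt_order(2), of k] K_lnG lnG by linarith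
  show "E (e k) \<le> a k - l k - l (Suc k) + K"
    using e_minimal(2)[OF pp p_nonzero] p_size(2)[of k] by linarith
qed

lemma e_parallel_size:
  assumes "crs (e j) (e k) = 0"
  shows "S (e j) = S (e k)" "E (e j) = E (e k)"
proof -
  have "crs (e k) (e j) = 0" using assms crs_anti[of "e k" "e j"] by simp
  then show "S (e j) = S (e k)" "E (e j) = E (e k)"
    using e_minimal[OF assms e_props(2)] e_minimal[OF _ e_props(2), of k j] by simp_all
qed

text \<open>Two changes of space in a row make both products in \<open>log_crs\<close> too small.
  For the second product a further inequality is needed, and which one exists depends on whether the
  next two spaces agree.\<close>

lemma lines_parallel:
  assumes "\<not> same j" "\<not> same (Suc j)"
  shows "crs (e (Suc j)) (e (suc2 j)) = 0"
proof (rule ccontr)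
  assume "\<not> ?thesis"
  from log_crs[OF this] consider
    "0 \<le> S (e (suc2 j)) + E (e (Suc j)) + K" | "0 \<le> S (e (Suc j)) + E (e (suc2 j)) + K" by blast
  then show False
  proof cases
    case h: 1
    show False
      using K_ge1 not_same[OF assms(1)] not_same[OF assms(2)] h K_small[of j] log_decay(1,2)[of j] log_height[of j]
      log_q[of j] e_size(3)[of "Suc j"] log_decay(1,2)[of "Suc j"] log_order(3)[of "Suc j"]
      e_size(2)[of "suc2 j"] log_decay(1,2)[of "suc2 j"]
      by linarith
  next
    case h: 2
    show False
    proof (cases "same (suc2 j)")
      case True
      then have ns: "\<not> same (suc3 j)" by (rule not_same_Suc)
      show False
        using K_ge1 not_same[OF assms(2)] not_same[OF ns] same_not_same[OF True ns] h K_small[of j] log_order(3)[of j]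
      e_size(2)[of "Suc j"] log_decay(1,2)[of "Suc j"] log_order(3)[of "Suc j"] e_size(3)[of "suc2 j"]
      log_decay(1,2)[of "suc2 j"] log_order(3)[of "suc2 j"] log_decay(1,2)[of "suc3 j"]
      log_height[of "suc3 j"] log_decay(1,2)[of "suc4 j"]
      log_q[of "suc4 j"]
        by linarith
    next
      case False
      show False
        using K_ge1 not_same[OF assms(2)] not_same[OF False] h K_small[of j] log_order(3)[of j] e_size(2)[of "Suc j"]
      log_decay(1,2)[of "Suc j"] log_height[of "Suc j"] log_q[of "Suc j"] e_size(3)[of "suc2 j"]
      log_decay(1,2)[of "suc2 j"] log_order(3)[of "suc2 j"] log_decay(1,2)[of "suc3 j"]
        by linarith
    qed
  qed
qed

text \<open>For the conclusion that the errors tend to 0 any positive factor would serve in place of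
  1/5.\<close>

lemma error_bound:
  assumes "\<not> same j" "\<not> same (Suc j)"
  shows "E (p (Suc j)) \<le> - (1/5) * z (Suc j)"
  using K_ge1 not_same[OF assms(1)] not_same[OF assms(2)] K_small[of j] log_decay(1,2)[of j] log_height[of j]
      log_q[of j] log_decay(1,2)[of "Suc j"] log_order(3)[of "Suc j"] p_size(2)[of "Suc j"]
      log_decay(1,2)[of "suc2 j"]
  by linarith

lemma same_infinitely_often: "\<exists>k\<ge>N. same k"
proof (rule ccontr)
  assume "\<not> ?thesis"
  then have ns: "\<not> same k" if "k \<ge> N" for k using that by blast
  have par: "crs (e (Suc N)) (e k) = 0" if "k \<ge> Suc N" for k
    using that
  proof (induction k rule: dec_induct)
    case base
    show ?case by simp
  next
    case (step k)
    obtain i where i: "k = Suc i" "N \<le> i" using step.hyps(1) by (cases k) auto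
    have "crs (e k) (e (Suc k)) = 0" unfolding i by (rule lines_parallel) (use i ns[of i] ns[of "Suc i"] in auto)
    then show ?case by (rule crs_zero_trans[OF step.IH _ e_props(2)])
  qed
  have "z k \<le> - 5 * E (e (Suc N))" if k: "k \<ge> Suc N" for k
  proof -
    obtain i where i: "k = Suc i" "N \<le> i" using k by (cases k) auto
    obtain g where g: "g \<noteq> 0" "p k = scl g (e k)" using e_props(1) by blast
    then have "crs (e (Suc N)) (p k) = 0" using par[OF k] by simp
    then have "E (e (Suc N)) \<le> E (p k)" by (rule e_minimal(2)[OF _ p_nonzero])
    also have "\<dots> \<le> - (1/5) * z k" unfolding i by (rule error_bound) (use i ns[of i] ns[of "Suc i"] in auto)
    finally show ?thesis by simp
  qed
  moreover have "\<forall>\<^sub>F k in sequentially. - 5 * E (e (Suc N)) + 1 \<le> z k" using n_at_top unfolding filterlim_at_top by blast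
  then obtain k1 where "\<And>k. k \<ge> k1 \<Longrightarrow> - 5 * E (e (Suc N)) + 1 \<le> z k" unfolding eventually_sequentially by blast
  ultimately show False by (metis max.cobounded1 max.cobounded2 add_le_same_cancel1 not_one_le_zero order_trans)
qed

text \<open>Blocks are indexed by the point \<open>y j\<close> preceding the repeated space, so \<open>tight j\<close> means \<open>W\<^sub>j\<^sub>+\<^sub>1 = W\<^sub>j\<^sub>+\<^sub>2\<close>.\<close>

definition tight where "tight j \<longleftrightarrow> same (Suc j)"

lemma tight_not_same: "tight j \<Longrightarrow> \<not> same j" "tight j \<Longrightarrow> \<not> same (suc2 j)"
  using not_same_Suc by (auto simp: tight_def)

lemma tight_ineq:
  assumes "tight j"
  shows "0 \<le> z (Suc j) - l (Suc j) - m (Suc j) - m j + K"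
    "0 \<le> z (Suc j) - l (Suc j) - m (Suc j) + z (suc3 j) - l (suc3 j) - a (suc3 j) + K"
    "0 \<le> z (suc3 j) - l (suc3 j) - m (suc3 j) - m (suc2 j) + K"
  using not_same[OF tight_not_same(1)[OF assms]] not_same[OF tight_not_same(2)[OF assms]]
    same_not_same[OF _ tight_not_same(2)[OF assms]] assms by (simp_all add: tight_def)

text \<open>This is the case not covered by \<open>lines_parallel\<close>: here the space is
  repeated, and the height inequalities around the repetition replace the missing one.\<close>

lemma tight_lines:
  assumes "tight j"
  shows "crs (e (Suc j)) (e (suc2 j)) = 0"
proof (rule ccontr)
  assume "\<not> ?thesis"
  from log_crs[OF this] consider
    "0 \<le> S (e (suc2 j)) + E (e (Suc j)) + K" | "0 \<le> S (e (Suc j)) + E (e (suc2 j)) + K" by blast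
  then show False
  proof cases
    case h: 1
    show False
      using K_ge1 h K_small[of j] log_order(3)[of j] tight_ineq(2,3)[OF assms] e_size(3)[of "Suc j"]
      log_decay(1,2)[of "Suc j"] log_order(3)[of "Suc j"] e_size(2)[of "suc2 j"]
      log_decay(1,2)[of "suc2 j"] log_height[of "suc2 j"] log_decay(1,2)[of "suc3 j"]
      log_q[of "suc3 j"]
      by linarith
  next
    case h: 2
    show False
      using K_ge1 h K_small[of j] log_order(3)[of j] tight_ineq(2,3)[OF assms] e_size(2)[of "Suc j"]
      log_decay(1,2)[of "Suc j"] log_order(3)[of "Suc j"] e_size(3)[of "suc2 j"]
      log_decay(1,2)[of "suc2 j"] log_height[of "suc2 j"] log_decay(1,2)[of "suc3 j"]
      log_q[of "suc3 j"]
      by linarith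
  qed
qed

text \<open>The constants are the extreme values of the linear program given by the preceding inequalities, rounded outwards. For the
  exponent \<open>\<lambda>\<^sub>3\<close> itself they would coincide in pairs; then \<open>z (j + 2)\<close> is \<open>z j\<close> times the golden ratio.\<close>

lemma tight_bounds:
  assumes "tight j"
  shows "4043/2500 * z j \<le> z (suc2 j)"
    "z (suc2 j) \<le> 8093/5000 * z j"
    "1061/2500 * z j \<le> l j"
    "l j \<le> 4247/10000 * z j"
    "719/1250 * z j \<le> l (Suc j)"
    "l (Suc j) \<le> 1439/2500 * z j"
    "429/625 * z j \<le> l (suc2 j)"
    "l (suc2 j) \<le> 859/1250 * z j"
    "4653/5000 * z j \<le> l (suc3 j)"
    "l (suc3 j) \<le> 2329/2500 * z j"
    "a (Suc j) \<le> 10003/10000 * z j"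
    "13551/10000 * z j \<le> a (suc2 j)"
    "a (suc2 j) \<le> 13561/10000 * z j"
    "4043/2500 * z j \<le> a (suc3 j)"
    "a (suc3 j) \<le> 8093/5000 * z j"
    "877/400 * z j \<le> z (suc3 j)"
    "z (suc3 j) \<le> 2743/1250 * z j"
proof -
  show "4043/2500 * z j \<le> z (suc2 j)"
    using K_ge1 K_small[of j] log_order(3)[of j] tight_ineq(2,3)[OF assms] log_decay(1,2)[of "Suc j"]
      log_order(3)[of "Suc j"] log_decay(1,2)[of "suc2 j"] log_height[of "suc2 j"]
      log_decay(1,2)[of "suc3 j"] log_q[of "suc3 j"]
    by linarith
  show "z (suc2 j) \<le> 8093/5000 * z j"
    using K_ge1 K_small[of j] log_decay(1)[of j] log_height[of j] tight_ineq(2)[OF assms] log_decay(1,2)[of "Suc j"]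
      log_q[of "Suc j"] log_order(3)[of "suc2 j"] log_decay(1,2)[of "suc3 j"]
      log_q[of "suc3 j"]
    by linarith
  show "1061/2500 * z j \<le> l j"
    using K_ge1 K_small[of j] log_decay(1)[of j]
    by linarith
  show "l j \<le> 4247/10000 * z j"
    using K_ge1 K_small[of j] log_height[of j] log_order(5)[of j] tight_ineq(2,3)[OF assms] log_decay(1)[of "Suc j"]
      log_order(3)[of "Suc j"] log_q[of "Suc j"] log_decay(2)[of "suc2 j"]
      log_decay(1,2)[of "suc3 j"] log_q[of "suc3 j"]
    by linarith
  show "719/1250 * z j \<le> l (Suc j)"
    using K_ge1 K_small[of j] log_order(3)[of j] tight_ineq(2,3)[OF assms] log_decay(1,2)[of "Suc j"]
      log_order(3)[of "Suc j"] log_decay(2)[of "suc2 j"] log_decay(1,2)[of "suc3 j"]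
      log_q[of "suc3 j"]
    by linarith
  show "l (Suc j) \<le> 1439/2500 * z j"
    using K_ge1 K_small[of j] log_decay(1)[of j] log_height[of j] log_q[of "Suc j"]
    by linarith
  show "429/625 * z j \<le> l (suc2 j)"
    using K_ge1 K_small[of j] log_order(3)[of j] tight_ineq(2,3)[OF assms] log_decay(1,2)[of "Suc j"]
      log_order(3)[of "Suc j"] log_decay(1,2)[of "suc2 j"] log_height[of "suc2 j"]
      log_decay(1,2)[of "suc3 j"] log_q[of "suc3 j"]
    by linarith
  show "l (suc2 j) \<le> 859/1250 * z j"
    using K_ge1 K_small[of j] log_decay(1)[of j] log_height[of j] tight_ineq(2)[OF assms] log_decay(1,2)[of "Suc j"]
      log_q[of "Suc j"] log_order(5)[of "suc2 j"] log_decay(1,2)[of "suc3 j"]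
      log_q[of "suc3 j"]
    by linarith
  show "4653/5000 * z j \<le> l (suc3 j)"
    using K_ge1 K_small[of j] log_order(3)[of j] tight_ineq(2,3)[OF assms] log_decay(1,2)[of "Suc j"]
      log_order(3)[of "Suc j"] log_decay(2)[of "suc2 j"] log_decay(1,2)[of "suc3 j"]
      log_q[of "suc3 j"]
    by linarith
  show "l (suc3 j) \<le> 2329/2500 * z j"
    using K_ge1 K_small[of j] log_decay(1)[of j] log_height[of j] tight_ineq(2)[OF assms] log_decay(1,2)[of "Suc j"]
      log_q[of "Suc j"] log_decay(1,2)[of "suc3 j"] log_q[of "suc3 j"]
    by linarith
  show "a (Suc j) \<le> 10003/10000 * z j"
    using K_ge1 K_small[of j] log_decay(1)[of j] log_height[of j] tight_ineq(2,3)[OF assms] log_decay(1)[of "Suc j"]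
      log_order(3)[of "Suc j"] log_q[of "Suc j"] log_decay(2)[of "suc2 j"]
      log_decay(1,2)[of "suc3 j"] log_q[of "suc3 j"]
    by linarith
  show "13551/10000 * z j \<le> a (suc2 j)"
    using K_ge1 K_small[of j] log_order(3)[of j] tight_ineq(2,3)[OF assms] log_decay(1,2)[of "Suc j"]
      log_order(3)[of "Suc j"] log_decay(2)[of "suc2 j"] log_decay(1,2)[of "suc3 j"]
      log_q[of "suc3 j"]
    by linarith
  show "a (suc2 j) \<le> 13561/10000 * z j"
    using K_ge1 K_small[of j] log_decay(1)[of j] log_height[of j] tight_ineq(2,3)[OF assms]
      log_decay(1,2)[of "Suc j"] log_height[of "Suc j"] log_q[of "Suc j"] log_decay(1,2)[of "suc3 j"]
      log_q[of "suc3 j"]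
    by linarith
  show "4043/2500 * z j \<le> a (suc3 j)"
    using K_ge1 K_small[of j] log_order(3)[of j] tight_ineq(2,3)[OF assms] log_decay(1,2)[of "Suc j"]
      log_order(3)[of "Suc j"] log_decay(2)[of "suc2 j"] log_decay(1,2)[of "suc3 j"]
      log_q[of "suc3 j"]
    by linarith
  show "a (suc3 j) \<le> 8093/5000 * z j"
    using K_ge1 K_small[of j] log_decay(1)[of j] log_height[of j] tight_ineq(2)[OF assms] log_decay(1,2)[of "Suc j"]
      log_q[of "Suc j"] log_decay(1,2)[of "suc3 j"] log_q[of "suc3 j"]
    by linarith
  show "877/400 * z j \<le> z (suc3 j)"
    using K_ge1 K_small[of j] log_order(3)[of j] tight_ineq(2,3)[OF assms] log_decay(1,2)[of "Suc j"]
      log_order(3)[of "Suc j"] log_decay(2)[of "suc2 j"] log_decay(1,2)[of "suc3 j"]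
      log_q[of "suc3 j"]
    by linarith
  show "z (suc3 j) \<le> 2743/1250 * z j"
    using K_ge1 K_small[of j] log_decay(1)[of j] log_height[of j] tight_ineq(2)[OF assms] log_decay(1,2)[of "Suc j"]
      log_q[of "Suc j"] log_decay(1,2)[of "suc3 j"] log_q[of "suc3 j"]
    by linarith
qed

end

section \<open>The relation between four consecutive points\<close>

lemma crs_add [simp]: "crs (r + s) t = crs r t + crs s t" "crs t (r + s) = crs t r + crs t s"
  by (simp_all add: crs_def algebra_simps)

lemma crs_zero [simp]: "crs (0, 0) r = 0" "crs r (0, 0) = 0"
  by (simp_all add: crs_def)

lemma crs_both_zero:
  assumes "crs r p = 0" "crs r q = 0" "crs p q \<noteq> 0"
  shows "r = (0, 0)"
proof -
  have "fst r * crs p q = 0" "snd r * crs p q = 0"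
    using assms(1,2) unfolding crs_def by algebra+
  then show ?thesis using assms(3) by (cases r) simp
qed

text \<open>The names refer to the contractions \<open>p0 = C(y\<^sub>0,y\<^sub>1)\<close>, \<open>q1 = C(y\<^sub>1,y\<^sub>0)\<close>, \<open>scl m1 e = C(y\<^sub>1,y\<^sub>2)\<close>,
  \<open>q2 = C(y\<^sub>2,y\<^sub>1)\<close>, \<open>scl m2 e = C(y\<^sub>2,y\<^sub>3)\<close>, \<open>q3 = C(y\<^sub>3,y\<^sub>2)\<close>, \<open>t = C(y\<^sub>1,y\<^sub>3)\<close>, \<open>s = C(y\<^sub>3,y\<^sub>1)\<close> of four points
  related by \<open>A y\<^sub>0 + B y\<^sub>1 + C y\<^sub>2 + D y\<^sub>3 = 0\<close>.\<close>

lemma block_algebra: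
  assumes R1: "scl A q1 + scl C (scl m1 e) + scl D t = (0, 0)"
    and R2: "scl A r + scl B q2 + scl D (scl m2 e) = (0, 0)"
    and R3: "scl A r' + scl B s + scl C q3 = (0, 0)"
    and d: "crs (scl m1 e) q3 = - \<Delta>" "crs t (scl m2 e) = \<Delta>" "crs q2 s = \<Delta>"
      "crs p0 q2 = - crs q1 r" "crs p0 s = - crs q1 r'"
  shows "crs e (scl (A * m2) q1 + scl (D * m1) q3) = 0"
    and "scl (A * m2) q1 + scl (D * m1) q3 = (0, 0) \<Longrightarrow> A \<noteq> 0 \<Longrightarrow> D \<noteq> 0 \<Longrightarrow> m1 \<noteq> 0 \<Longrightarrow> m2 \<noteq> 0 \<Longrightarrow> \<Delta> \<noteq> 0 \<Longrightarrow>
      scl (A * A) p0 + scl (- (A * B)) q1 = scl (D * D) s"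
proof -
  have "crs (scl A q1 + scl C (scl m1 e) + scl D t) e = 0" using R1 by simp
  then have 1: "A * crs q1 e + D * crs t e = 0" by simp
  have 2: "m1 * crs e q3 = - \<Delta>" "m2 * crs t e = \<Delta>" using d(1,2) by simp_all
  have "crs e q1 = - crs q1 e" by (rule crs_anti)
  then have "A * m2 * crs e q1 + D * m1 * crs e q3 = 0" using 1 2 by algebra
  then show "crs e (scl (A * m2) q1 + scl (D * m1) q3) = 0" by simp
  \<comment> \<open>Now \<open>q1\<close> and \<open>q3\<close> are proportional, so contracting the
    third relation with \<open>q1\<close> removes the term with \<open>C\<close>.\<close>
  assume w: "scl (A * m2) q1 + scl (D * m1) q3 = (0, 0)" and nz: "A \<noteq> 0" "D \<noteq> 0" "m1 \<noteq> 0" "m2 \<noteq> 0" "\<Delta> \<noteq> 0"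
  have wc: "A * m2 * crs q1 c + D * m1 * crs q3 c = 0" for c
  proof -
    have "crs (scl (A * m2) q1 + scl (D * m1) q3) c = 0" using w by simp
    then show ?thesis by simp
  qed
  have 3: "crs q1 q3 = 0" using wc[of q3] nz by simp
  have R3': "A * crs q1 r' + B * crs q1 s = 0"
  proof -
    have "crs q1 (scl A r' + scl B s + scl C q3) = 0" using R3 by simp
    then show ?thesis using 3 by simp
  qed
  have R2': "A * crs q1 r + B * crs q1 q2 + D * m2 * crs q1 e = 0"
  proof -
    have "crs q1 (scl A r + scl B q2 + scl D (scl m2 e)) = 0" using R2 by simp
    then show ?thesis by (simp add: algebra_simps)
  qed
  \<comment> \<open>\<open>X\<close> vanishes because it is parallel to both \<open>s\<close> and
    \<open>q2\<close>, whose determinant \<open>\<Delta>\<close> is not zero.\<close>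
  define X where "X = scl (A * A) p0 + scl (- (A * B)) q1 + scl (- (D * D)) s"
  have "crs X s = A * (A * crs p0 s - B * crs q1 s)" by (simp add: X_def algebra_simps)
  also have "\<dots> = 0" using R3' d(5) by algebra
  finally have Xs: "crs X s = 0" .
  have q3e: "crs q3 e = - crs e q3" "crs s q2 = - crs q2 s" by (rule crs_anti)+
  have "crs X q2 = A * (A * crs p0 q2 - B * crs q1 q2) - D * D * crs s q2" by (simp add: X_def algebra_simps)
  also have "A * (A * crs p0 q2 - B * crs q1 q2) = D * (A * m2 * crs q1 e)" using R2' d(4) by algebra
  also have "A * m2 * crs q1 e = D * (m1 * crs e q3)" using wc[of e] q3e(1) by algebra
  also have "D * (D * (m1 * crs e q3)) - D * D * crs s q2 = 0" using 2(1) d(3) q3e(2) by algebra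
  finally have "crs X q2 = 0" .
  then have "X = (0, 0)" using crs_both_zero[of X q2 s] Xs d(3) nz(5) by simp
  then show "scl (A * A) p0 + scl (- (A * B)) q1 = scl (D * D) s"
    by (simp add: X_def scl_def prod_eq_iff)
qed

lemma primitive_point:
  assumes "f \<noteq> nul"
  shows "\<exists>P. P \<noteq> nul \<and> par P f \<and> (\<forall>g. par P g \<longrightarrow> (\<exists>t. g = cmb t P 0 nul))"
proof -
  define g1 where "g1 = gcd (c0 f) (c1 f)"
  define g2 where "g2 = gcd (c2 f) (c3 f)"
  define g where "g = gcd g1 g2"
  have g0: "g \<noteq> 0" using assms by (auto simp: g_def g1_def g2_def pt_eq_iff)
  have "g dvd g1" "g dvd g2" by (simp_all add: g_def)
  moreover have "g1 dvd c0 f" "g1 dvd c1 f" "g2 dvd c2 f" "g2 dvd c3 f" by (simp_all add: g1_def g2_def)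
  ultimately have "g dvd c0 f" "g dvd c1 f" "g dvd c2 f" "g dvd c3 f" using dvd_trans by blast+
  then obtain a b c d where f: "c0 f = g * a" "c1 f = g * b" "c2 f = g * c" "c3 f = g * d" by (auto simp: dvd_def)
  obtain i1 j1 where 1: "i1 * c0 f + j1 * c1 f = g1" using bezout_int unfolding g1_def by blast
  obtain i2 j2 where 2: "i2 * c2 f + j2 * c3 f = g2" using bezout_int unfolding g2_def by blast
  obtain i j where "i * g1 + j * g2 = g" using bezout_int unfolding g_def by blast
  then have "g * (i * i1 * a + i * j1 * b + j * i2 * c + j * j2 * d) = g * 1"
    unfolding 1[symmetric] 2[symmetric] f by (simp add: algebra_simps)
  then obtain ka kb kc kd where b: "ka * a + kb * b + kc * c + kd * d = 1" using g0 by (metis mult_cancel_left)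
  let ?P = "Pt a b c d"
  have "\<exists>t. h = cmb t ?P 0 nul" if h: "par ?P h" for h
  proof -
    let ?t = "ka * c0 h + kb * c1 h + kc * c2 h + kd * c3 h"
    have p: "a * c1 h = b * c0 h" "a * c2 h = c * c0 h" "a * c3 h = d * c0 h" "b * c2 h = c * c1 h" "b * c3 h = d * c1 h"
      "c * c3 h = d * c2 h" using h by (simp_all add: par_def)
    have "?t * a = c0 h * (ka * a + kb * b + kc * c + kd * d)" using p(1-3) by algebra
    moreover have "?t * b = c1 h * (ka * a + kb * b + kc * c + kd * d)" using p(1,4,5) by algebra
    moreover have "?t * c = c2 h * (ka * a + kb * b + kc * c + kd * d)" using p(2,4,6) by algebra
    moreover have "?t * d = c3 h * (ka * a + kb * b + kc * c + kd * d)" using p(3,5,6) by algebra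
    ultimately have "h = cmb ?t ?P 0 nul" using b by (simp add: pt_eq_iff)
    then show ?thesis by blast
  qed
  moreover have "?P \<noteq> nul" using b by (auto simp: pt_eq_iff)
  moreover have "par ?P f" by (simp add: par_def f)
  ultimately show ?thesis by blast
qed

lemma dot_scale: "dot (cmb t f 0 nul) w = t * dot f w"
  by (simp add: dot_def algebra_simps)

lemma nrm_scale: "nrm (cmb r x s y) y (cmb r' y s' z) = cmb (r * s') (nrm x y z) 0 nul"
  by (simp add: pt_eq_iff nrm_def det3_def algebra_simps)

context cubic_independent
begin

lemma mx_scale: "mx (cmb t f 0 nul) = \<bar>real_of_int t\<bar> * mx f"
  by (simp add: mx_def abs_mult max_mult_distrib_left)

end

section \<open>The relation inside a repeated space\<close>

context regular_points
begin

lemma nrm_successive: "nrm (y k) (y (Suc k)) (y (suc2 k)) \<noteq> nul"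
proof -
  obtain r s where rs: "r \<noteq> 0" "y k = cmb r (v (Suc k)) s (y (Suc k))" by (rule y_combination_back)
  obtain r' s' where rs': "s' \<noteq> 0" "y (suc2 k) = cmb r' (y (Suc k)) s' (u (Suc k))" by (rule y_combination)
  have "nrm (y k) (y (Suc k)) (y (suc2 k)) = cmb (r * s') (nrm (v (Suc k)) (y (Suc k)) (u (Suc k))) 0 nul"
    unfolding rs(2) rs'(2) by (rule nrm_scale)
  then show ?thesis using rs(1) rs'(1) nrm_vyu[of "Suc k"] by (auto simp: pt_eq_iff)
qed

lemma log_nrm:
  assumes "nrm (y i) (y j) (y k) \<noteq> nul" "i \<le> k" "j \<le> k"
  shows "ln (mx (nrm (y i) (y j) (y k))) \<le> K / 10 + a k - l i - l j"
  using ln_nrm[OF assms(1) Lt_le_norms(2) Lt_le_norms(2) Lt_le_norms(2) y_order(1)[OF assms(2)] y_order(1)[OF assms(3)]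
    y_order(2)[OF assms(2)] y_order(2)[OF assms(3)] norms_ge1(2) nonzero(2) nonzero(2)] K_lnG by linarith

lemma log_far:
  assumes "f \<noteq> nul" "dot f (y j) = 0" "dot f (u j) \<noteq> 0"
  shows "0 \<le> ln (mx f) + z j - l j - a j + K / 10"
  using ln_far[OF assms nonzero(2) norms_ge1(2) norm_order(2) Lt_order(2)] K_lnG by linarith

lemma dot_lat: "lat r s t \<Longrightarrow> dot f r = 0 \<Longrightarrow> dot f s = 0 \<Longrightarrow> dot f t = 0"
  by (auto simp: lat_def dot_cmb)

text \<open>All four points lie in the repeated space, so the normal vectors of their triples are
  integer multiples of one primitive vector \<open>P\<close>. Dividing
  \<open>cofactor_relation\<close> by \<open>P\<close> leaves exactly these multiples as
  coefficients.\<close>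

lemma block_relation:
  assumes "tight j"
  obtains A B C D :: int where "A \<noteq> 0" "D \<noteq> 0"
    "\<And>w. scl A (CC w (y j)) + scl B (CC w (y (Suc j))) + scl C (CC w (y (suc2 j))) + scl D (CC w (y (suc3 j))) = (0, 0)"
    "ln \<bar>real_of_int A\<bar> \<le> z (suc3 j) - l (Suc j) - l (suc2 j) - l (suc3 j) + K"
    "ln \<bar>real_of_int D\<bar> \<le> a (suc2 j) - l j - l (Suc j) + z (suc3 j) - l (suc3 j) - a (suc3 j) + K"
    "C \<noteq> 0 \<Longrightarrow> ln \<bar>real_of_int C\<bar> \<le> z (suc3 j) - l j - l (Suc j) - l (suc3 j) + K"
proof -
  let ?j1 = "Suc j" and ?j2 = "suc2 j" and ?j3 = "suc3 j"
  let ?f = "nrm (v ?j1) (y ?j1) (u ?j1)"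
  obtain P where P: "P \<noteq> nul" "par P ?f" "\<And>g. par P g \<Longrightarrow> \<exists>t. g = cmb t P 0 nul"
    using primitive_point[OF nrm_vyu] by blast
  have dP: "dot P w = 0" if "dot ?f w = 0" for w by (rule par_dot[OF P(2) nrm_vyu that])
  have P1: "dot P (v ?j1) = 0" "dot P (y ?j1) = 0" "dot P (u ?j1) = 0" by (rule dP, simp)+
  have P2: "dot P (v ?j2) = 0" "dot P (y ?j2) = 0" by (rule dot_lat[OF lattice(3) P1(2,3)] dot_lat[OF lattice(4) P1(2,3)])+
  have U2: "dot P (u ?j2) = 0" by (rule dP) (use assms in \<open>simp add: tight_def same_def\<close>)
  have P3: "dot P (y ?j3) = 0" by (rule dot_lat[OF lattice(4) P2(2) U2])
  have P0: "dot P (y j) = 0" by (rule dot_lat[OF lattice(1) P1(1,2)])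
  have U3: "dot P (u ?j3) \<noteq> 0"
  proof
    assume z3: "dot P (u ?j3) = 0"
    have "par P (nrm (v ?j2) (y ?j2) (u ?j2))" by (rule par_nrm[OF P2 U2])
    from par_dot[OF par_sym[OF this] P(1) z3] show False
      using tight_not_same(2)[OF assms] by (simp add: same_def)
  qed
  \<comment> \<open>Since \<open>P\<close> annihilates \<open>y (suc3 j)\<close> but not
    \<open>u (suc3 j)\<close>, it is long. This is what makes the coefficients small.\<close>
  have h: "0 \<le> ln (mx P) + z ?j3 - l ?j3 - a ?j3 + K / 10" by (rule log_far[OF P(1) P3 U3])
  have mult: "\<exists>t. nrm x1 x2 x3 = cmb t P 0 nul" if "dot P x1 = 0" "dot P x2 = 0" "dot P x3 = 0" for x1 x2 x3
    by (rule P(3)[OF par_nrm[OF that]])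
  obtain A where A: "nrm (y ?j1) (y ?j2) (y ?j3) = cmb A P 0 nul" using mult P1 P2 P3 by blast
  obtain B where B: "nrm (y j) (y ?j2) (y ?j3) = cmb B P 0 nul" using mult P0 P2 P3 by blast
  obtain C where C: "nrm (y j) (y ?j1) (y ?j3) = cmb C P 0 nul" using mult P0 P1 P3 by blast
  obtain D where D: "nrm (y j) (y ?j1) (y ?j2) = cmb D P 0 nul" using mult P0 P1 P2 by blast
  have A0: "A \<noteq> 0" using nrm_successive[of ?j1] unfolding A by (auto simp: pt_eq_iff)
  have D0: "D \<noteq> 0" using nrm_successive[of j] unfolding D by (auto simp: pt_eq_iff)
  have "dot (nrm (y j) (y ?j1) (y ?j2)) (y ?j3) = 0" using P3 by (simp add: D dot_scale)
  note rel = cofactor_relation[OF this, unfolded A B C D cmb_sel nul_sel]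
  have coord: "A * i0 - B * i1 + C * i2 - D * i3 = 0"
    if "A * c0 P * i0 - B * c0 P * i1 + C * c0 P * i2 - D * c0 P * i3 = 0"
      "A * c1 P * i0 - B * c1 P * i1 + C * c1 P * i2 - D * c1 P * i3 = 0"
      "A * c2 P * i0 - B * c2 P * i1 + C * c2 P * i2 - D * c2 P * i3 = 0"
      "A * c3 P * i0 - B * c3 P * i1 + C * c3 P * i2 - D * c3 P * i3 = 0" for i0 i1 i2 i3
  proof -
    have "c0 P * (A * i0 - B * i1 + C * i2 - D * i3) = 0" "c1 P * (A * i0 - B * i1 + C * i2 - D * i3) = 0"
      "c2 P * (A * i0 - B * i1 + C * i2 - D * i3) = 0" "c3 P * (A * i0 - B * i1 + C * i2 - D * i3) = 0"
      using that by (simp_all add: algebra_simps)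
    then show ?thesis using P(1) by (auto simp: pt_eq_iff)
  qed
  have co: "A * c0 (y j) - B * c0 (y ?j1) + C * c0 (y ?j2) - D * c0 (y ?j3) = 0"
    "A * c1 (y j) - B * c1 (y ?j1) + C * c1 (y ?j2) - D * c1 (y ?j3) = 0"
    "A * c2 (y j) - B * c2 (y ?j1) + C * c2 (y ?j2) - D * c2 (y ?j3) = 0"
    "A * c3 (y j) - B * c3 (y ?j1) + C * c3 (y ?j2) - D * c3 (y ?j3) = 0"
    by (rule coord; use rel in simp)+
  have size: "ln \<bar>real_of_int g\<bar> \<le> X + z ?j3 - l ?j3 - a ?j3 + K"
    if g: "g \<noteq> 0" "f = cmb g P 0 nul" "ln (mx f) \<le> K / 10 + X" for g f X
  proof -
    have "1 \<le> \<bar>real_of_int g\<bar>" using g(1) by linarith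
    then have "ln (mx f) = ln \<bar>real_of_int g\<bar> + ln (mx P)"
      unfolding g(2) mx_scale using mx_ge1[OF P(1)] by (simp add: ln_mult)
    then show ?thesis using g(3) h K_ge1 by linarith
  qed
  have lA: "ln \<bar>real_of_int A\<bar> \<le> (a ?j3 - l ?j1 - l ?j2) + z ?j3 - l ?j3 - a ?j3 + K"
    by (rule size[OF A0 A]) (use log_nrm[OF nrm_successive, of ?j1] in simp)
  have lD: "ln \<bar>real_of_int D\<bar> \<le> (a ?j2 - l j - l ?j1) + z ?j3 - l ?j3 - a ?j3 + K"
    by (rule size[OF D0 D]) (use log_nrm[OF nrm_successive, of j] in simp)
  have lC: "ln \<bar>real_of_int C\<bar> \<le> (a ?j3 - l j - l ?j1) + z ?j3 - l ?j3 - a ?j3 + K" if "C \<noteq> 0"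
  proof (rule size[OF that C])
    have "nrm (y j) (y ?j1) (y ?j3) \<noteq> nul" unfolding C using that P(1) by (auto simp: pt_eq_iff)
    from log_nrm[OF this] show "ln (mx (nrm (y j) (y ?j1) (y ?j3))) \<le> K / 10 + (a ?j3 - l j - l ?j1)" by simp
  qed
  have cc: "scl A (CC w (y j)) + scl (- B) (CC w (y ?j1)) + scl C (CC w (y ?j2)) + scl (- D) (CC w (y ?j3)) = (0, 0)" for w
  proof -
    have "A * Cm w (y j) - B * Cm w (y ?j1) + C * Cm w (y ?j2) - D * Cm w (y ?j3) =
      wa w * (A * c0 (y j) - B * c0 (y ?j1) + C * c0 (y ?j2) - D * c0 (y ?j3)) +
      wb w * (A * c1 (y j) - B * c1 (y ?j1) + C * c1 (y ?j2) - D * c1 (y ?j3)) +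
      wc w * (A * c2 (y j) - B * c2 (y ?j1) + C * c2 (y ?j2) - D * c2 (y ?j3))"
      by (simp add: Cm_def algebra_simps)
    moreover have "A * Cp w (y j) - B * Cp w (y ?j1) + C * Cp w (y ?j2) - D * Cp w (y ?j3) =
      wa w * (A * c1 (y j) - B * c1 (y ?j1) + C * c1 (y ?j2) - D * c1 (y ?j3)) +
      wb w * (A * c2 (y j) - B * c2 (y ?j1) + C * c2 (y ?j2) - D * c2 (y ?j3)) +
      wc w * (A * c3 (y j) - B * c3 (y ?j1) + C * c3 (y ?j2) - D * c3 (y ?j3))"
      by (simp add: Cp_def algebra_simps)
    ultimately show ?thesis unfolding co by (simp add: CC_def scl_def)
  qed
  show thesis
    by (rule that[OF A0 _ cc]) (use lA lD lC D0 in simp_all)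
qed

end

lemma wdet_cyclic: "wdet y z x = wdet x y z" and wdet_reverse: "wdet z y x = - wdet x y z"
  by (simp_all add: wdet_def det3_def algebra_simps)

context cubic_independent
begin

lemma sz_add: "sz (r + s) \<le> sz r + sz s"
  by (auto simp: sz_def)

lemma er_add: "er (r + s) \<le> er r + er s"
  unfolding er_def fst_add snd_add of_int_add distrib_left by linarith

lemma fit_near:
  "\<bar>real_of_int (fst r * c1 w - snd r * c0 w) - (\<xi> * real_of_int (fst r) - real_of_int (snd r)) * real_of_int (c0 w)\<bar> \<le> sz r * Lt w"
proof -
  have "real_of_int (fst r * c1 w - snd r * c0 w) - (\<xi> * real_of_int (fst r) - real_of_int (snd r)) * real_of_int (c0 w)
    = real_of_int (fst r) * e0 w"
    by (simp add: e0_def algebra_simps)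
  then show ?thesis unfolding abs_mult using sz_ge(1)[of r] e_le(1)[of w] Lt_nonneg[of w] by (simp add: abs_mult mult_mono)
qed

text \<open>The first line of \<open>C_relation\<close> equates, up to sign, the misfit of C(x, y)
  at \<open>y\<close> with that of C(y, x) at \<open>x\<close>. Each misfit is error times norm up
  to size times error of the point, so errors transfer between the two pairs.\<close>

lemma er_swap: "er (CC y x) * Nm x \<le> er (CC x y) * Nm y + sz (CC x y) * Lt y + sz (CC y x) * Lt x"
proof -
  have z: "real_of_int (fst (CC x y) * c1 y - snd (CC x y) * c0 y) + real_of_int (fst (CC y x) * c1 x - snd (CC y x) * c0 x) = 0"
    using C_relation(1)[of x y] unfolding CC_def fst_conv snd_conv of_int_add[symmetric] by simp
  show ?thesis
    using fit_near[of "CC x y" y] fit_near[of "CC y x" x] z unfolding er_def Nm_def abs_mult[symmetric] by linarith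
qed

end

text \<open>The entries of \<open>C(y,x) \<circ> x = - C(x,y) \<circ> y\<close> are multiples of the content of \<open>C(x,y)\<close>, hence so are the
  entries of \<open>C(y,x)\<close> times the minors of \<open>x\<close>.\<close>

lemma content_dvd:
  assumes "CC x y = scl g r"
  shows "g dvd fst (CC y x) * Cm x s" "g dvd fst (CC y x) * Cp x s" "g dvd snd (CC y x) * Cm x s" "g dvd snd (CC y x) * Cp x s"
proof -
  obtain f h where q: "CC y x = (f, h)" by (cases "CC y x")
  have C: "Cm x y = g * fst r" "Cp x y = g * snd r" "Cm y x = f" "Cp y x = h"
    using assms q by (simp_all add: CC_def scl_def)
  have fit: "g dvd f * c1 x - h * c0 x" "g dvd f * c2 x - h * c1 x" "g dvd f * c3 x - h * c2 x"
  proof -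
    have "f * c1 x - h * c0 x = g * (snd r * c0 y - fst r * c1 y)" "f * c2 x - h * c1 x = g * (snd r * c1 y - fst r * c2 y)"
      "f * c3 x - h * c2 x = g * (snd r * c2 y - fst r * c3 y)"
      using C_relation[of x y] unfolding C by (simp_all add: algebra_simps)
    then show "g dvd f * c1 x - h * c0 x" "g dvd f * c2 x - h * c1 x" "g dvd f * c3 x - h * c2 x" by simp_all
  qed
  have w: "g dvd f * wa x" "g dvd f * wb x" "g dvd f * wc x" "g dvd h * wa x" "g dvd h * wb x" "g dvd h * wc x"
  proof -
    have "f * wa x = (f * c3 x - h * c2 x) * c1 x - (f * c2 x - h * c1 x) * c2 x"
      "f * wb x = (f * c1 x - h * c0 x) * c2 x - (f * c3 x - h * c2 x) * c0 x"
      "f * wc x = (f * c2 x - h * c1 x) * c0 x - (f * c1 x - h * c0 x) * c1 x"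
      "h * wa x = (f * c3 x - h * c2 x) * c2 x - (f * c2 x - h * c1 x) * c3 x"
      "h * wb x = (f * c1 x - h * c0 x) * c3 x - (f * c3 x - h * c2 x) * c1 x"
      "h * wc x = (f * c2 x - h * c1 x) * c1 x - (f * c1 x - h * c0 x) * c2 x"
      by (simp_all add: w_defs algebra_simps)
    then show "g dvd f * wa x" "g dvd f * wb x" "g dvd f * wc x" "g dvd h * wa x" "g dvd h * wb x" "g dvd h * wc x"
      using fit by (metis dvd_diff dvd_mult2)+
  qed
  have lin: "g dvd k * (wa x * i0 + wb x * i1 + wc x * i2)" if "g dvd k * wa x" "g dvd k * wb x" "g dvd k * wc x" for k i0 i1 i2
  proof -
    have "k * (wa x * i0 + wb x * i1 + wc x * i2) = k * wa x * i0 + k * wb x * i1 + k * wc x * i2" by (simp add: algebra_simps)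
    then show ?thesis using that by (simp only: dvd_add dvd_mult2)
  qed
  show "g dvd fst (CC y x) * Cm x s" "g dvd fst (CC y x) * Cp x s" "g dvd snd (CC y x) * Cm x s" "g dvd snd (CC y x) * Cp x s"
    unfolding q fst_conv snd_conv Cm_def[of x s] Cp_def[of x s] by (rule lin; use w in simp)+
qed

section \<open>Contents, errors and the equation of a block\<close>

context regular_points
begin

text \<open>By \<open>content_dvd\<close> the content \<open>g\<close> divides products of an entry
  of \<open>CC w x\<close> and an entry of \<open>CC x x'\<close>. Choose a nonzero product.\<close>

lemma log_content:
  assumes "CC x w = scl g r" "CC w x \<noteq> (0, 0)" "CC x x' \<noteq> (0, 0)" "g \<noteq> 0"
  shows "ln \<bar>real_of_int g\<bar> \<le> S (CC w x) + S (CC x x')"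
proof -
  have *: "ln \<bar>real_of_int g\<bar> \<le> S (CC w x) + S (CC x x')"
    if "g dvd h * i" "h \<noteq> 0" "i \<noteq> 0" "\<bar>real_of_int h\<bar> \<le> sz (CC w x)" "\<bar>real_of_int i\<bar> \<le> sz (CC x x')" for h i
  proof -
    have "\<bar>g\<bar> \<le> \<bar>h * i\<bar>" using dvd_imp_le_int[OF _ that(1)] that(2,3) by simp
    then have "\<bar>real_of_int g\<bar> \<le> \<bar>real_of_int h\<bar> * \<bar>real_of_int i\<bar>" by (metis abs_mult of_int_abs of_int_le_iff of_int_mult)
    also have "\<dots> \<le> sz (CC w x) * sz (CC x x')" using that(4,5) by (intro mult_mono) auto
    finally have "ln \<bar>real_of_int g\<bar> \<le> ln (sz (CC w x) * sz (CC x x'))" using assms(4) by (intro ln_mono) auto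
    then show ?thesis using sz_ge1[OF assms(2)] sz_ge1[OF assms(3)] by (simp add: ln_mult)
  qed
  note dv = content_dvd[OF assms(1), of x']
  consider "fst (CC w x) \<noteq> 0" "Cm x x' \<noteq> 0" | "fst (CC w x) \<noteq> 0" "Cp x x' \<noteq> 0" | "snd (CC w x) \<noteq> 0" "Cm x x' \<noteq> 0" | "snd (CC w x) \<noteq> 0" "Cp x x' \<noteq> 0"
    using assms(2,3) by (cases "CC w x") (auto simp: CC_def)
  then show ?thesis
  proof cases
    case 1 show ?thesis by (rule *[OF dv(1) 1 sz_ge(1)]) (use sz_ge(1)[of "CC x x'"] in \<open>simp add: CC_def\<close>)
  next
    case 2 show ?thesis by (rule *[OF dv(2) 2 sz_ge(1)]) (use sz_ge(2)[of "CC x x'"] in \<open>simp add: CC_def\<close>)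
  next
    case 3 show ?thesis by (rule *[OF dv(3) 3 sz_ge(2)]) (use sz_ge(1)[of "CC x x'"] in \<open>simp add: CC_def\<close>)
  next
    case 4 show ?thesis by (rule *[OF dv(4) 4 sz_ge(2)]) (use sz_ge(2)[of "CC x x'"] in \<open>simp add: CC_def\<close>)
  qed
qed

lemma ln_sum3_cases:
  fixes X Y Y' Y'' :: real
  assumes "0 < X" "X \<le> Y + Y' + Y''" "0 < Y" "0 < Y'" "0 < Y''"
  shows "ln X \<le> K / 5 + ln Y \<or> ln X \<le> K / 5 + ln Y' \<or> ln X \<le> K / 5 + ln Y''"
proof -
  have "ln X \<le> ln 2 + ln (Y + Y') \<or> ln X \<le> ln 2 + ln Y''" by (rule ln_sum_cases) (use assms in auto)
  moreover have "ln (Y + Y') \<le> ln 2 + ln Y \<or> ln (Y + Y') \<le> ln 2 + ln Y'" by (rule ln_sum_cases) (use assms in auto)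
  moreover have "0 \<le> ln (2::real)" by simp
  ultimately show ?thesis using ln2 by linarith
qed

lemma log_er_swap:
  assumes "CC (y i) (y k) \<noteq> (0, 0)" "CC (y k) (y i) \<noteq> (0, 0)"
  shows "E (CC (y k) (y i)) + a i \<le> K + E (CC (y i) (y k)) + a k \<or> E (CC (y k) (y i)) + a i \<le> K + S (CC (y i) (y k)) - l k \<or>
    E (CC (y k) (y i)) + a i \<le> K + S (CC (y k) (y i)) - l i"
proof -
  note pos = er_pos[OF assms(1)] er_pos[OF assms(2)] sz_ge1[OF assms(1)] sz_ge1[OF assms(2)]
    norms_ge1(2)[of i] norms_ge1(2)[of k] Lt_pos[OF nonzero(2)[of i]] Lt_pos[OF nonzero(2)[of k]]
  from ln_sum3_cases[OF _ er_swap[of "y k" "y i"]] pos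
  have "ln (er (CC (y k) (y i)) * Nm (y i)) \<le> K / 5 + ln (er (CC (y i) (y k)) * Nm (y k)) \<or>
    ln (er (CC (y k) (y i)) * Nm (y i)) \<le> K / 5 + ln (sz (CC (y i) (y k)) * Lt (y k)) \<or>
    ln (er (CC (y k) (y i)) * Nm (y i)) \<le> K / 5 + ln (sz (CC (y k) (y i)) * Lt (y i))" by simp
  moreover have "ln (er (CC (y k) (y i)) * Nm (y i)) = E (CC (y k) (y i)) + a i" "ln (er (CC (y i) (y k)) * Nm (y k)) = E (CC (y i) (y k)) + a k"
    "ln (sz (CC (y i) (y k)) * Lt (y k)) = S (CC (y i) (y k)) - l k" "ln (sz (CC (y k) (y i)) * Lt (y i)) = S (CC (y k) (y i)) - l i"
    using pos by (simp_all add: ln_mult n_def d_def)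
  ultimately show ?thesis using K_ge1 by linarith
qed

text \<open>For \<open>tight j\<close> the sizes of \<open>q j\<close> and \<open>q (suc2 j)\<close>
  are nearly 0, so this keeps their errors from being small and singles out one alternative in the
  exchange of errors.\<close>

lemma q_irr: "- (236/100) * S (q k) - K \<le> E (q k)"
  by (rule irrationality[OF q_nonzero])

definition t where "t j = CC (y (Suc j)) (y (suc3 j))"
definition s where "s j = CC (y (suc3 j)) (y (Suc j))"

text \<open>A long primitive vector \<open>e (Suc j)\<close> makes the first combination in
  \<open>block_algebra\<close> too short to be a nonzero multiple of it. In units of
  \<open>z j\<close> the size of its first term is at most about 0.093. The second involves the
  content of \<open>p (Suc j)\<close>, at most about 0.205 minus the size of
  \<open>e (Suc j)\<close>; 13/125 lies just above half of 0.205.\<close>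

lemma block_equation:
  assumes "tight j" "13/125 * z j \<le> S (e (Suc j))"
  obtains A B D where "A \<noteq> 0" "D \<noteq> 0" "ln \<bar>real_of_int A\<bar> \<le> 1/2500 * z j" "ln \<bar>real_of_int D\<bar> \<le> 1/2500 * z j"
    "scl (A * A) (p j) + scl (- (A * B)) (q j) = scl (D * D) (s j)"
    "s j \<noteq> (0, 0)" "t j \<noteq> (0, 0)" "S (t j) \<le> S (p (Suc j)) + 33/125 * z j"
proof -
  let ?y0 = "y j" and ?y1 = "y (Suc j)" and ?y2 = "y (suc2 j)" and ?y3 = "y (suc3 j)" and ?e = "e (Suc j)"
  obtain A B C D where AD: "A \<noteq> 0" "D \<noteq> 0"
    and rel: "\<And>w. scl A (CC w ?y0) + scl B (CC w ?y1) + scl C (CC w ?y2) + scl D (CC w ?y3) = (0, 0)"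
    and lA: "ln \<bar>real_of_int A\<bar> \<le> z (suc3 j) - l (Suc j) - l (suc2 j) - l (suc3 j) + K"
    and lD: "ln \<bar>real_of_int D\<bar> \<le> a (suc2 j) - l j - l (Suc j) + z (suc3 j) - l (suc3 j) - a (suc3 j) + K"
    and lC: "C \<noteq> 0 \<Longrightarrow> ln \<bar>real_of_int C\<bar> \<le> z (suc3 j) - l j - l (Suc j) - l (suc3 j) + K"
    by (rule block_relation[OF assms(1)]) blast
  obtain m1 where m1: "m1 \<noteq> 0" "p (Suc j) = scl m1 ?e" using e_props(1) by blast
  obtain m2' where "m2' \<noteq> 0" "p (suc2 j) = scl m2' (e (suc2 j))" using e_props(1) by blast
  then have "crs ?e (p (suc2 j)) = 0" using tight_lines[OF assms(1)] by simp
  then obtain m2 where m2: "m2 \<noteq> 0" "p (suc2 j) = scl m2 ?e" using e_multiple p_nonzero by blast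
  define \<Delta> where "\<Delta> = wdet ?y1 ?y2 ?y3"
  have zz: "scl 0 r = (0, 0)" "scl g (0, 0) = (0, 0)" "(0, 0) + r = r" "r + (0, 0) = r" for g and r :: "int \<times> int"
    by (simp_all add: scl_def prod_eq_iff)
  have R: "scl A (q j) + scl C (scl m1 ?e) + scl D (t j) = (0, 0)"
    "scl A (CC ?y2 ?y0) + scl B (q (Suc j)) + scl D (scl m2 ?e) = (0, 0)"
    "scl A (CC ?y3 ?y0) + scl B (s j) + scl C (q (suc2 j)) = (0, 0)"
    using rel[of ?y1] rel[of ?y2] rel[of ?y3] unfolding m1(2)[symmetric] m2(2)[symmetric] q_def p_def t_def s_def
    by (simp_all add: zz)
  have d: "crs (scl m1 ?e) (q (suc2 j)) = - \<Delta>" "crs (t j) (scl m2 ?e) = \<Delta>" "crs (q (Suc j)) (s j) = \<Delta>"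
    "crs (p j) (q (Suc j)) = - crs (q j) (CC ?y2 ?y0)" "crs (p j) (s j) = - crs (q j) (CC ?y3 ?y0)"
    unfolding m1(2)[symmetric] m2(2)[symmetric] q_def p_def t_def s_def crs_C \<Delta>_def
    by (rule wdet_swap(1) refl wdet_cyclic wdet_reverse)+
  \<comment> \<open>Both pairs have size almost 0 in units of \<open>z j\<close>, less than that of
    the primitive vector, so they are not multiples of it.\<close>
  have nq: "crs ?e (q j) \<noteq> 0" "crs ?e (q (suc2 j)) \<noteq> 0"
  proof -
    show "crs ?e (q j) \<noteq> 0"
    proof
      assume "crs ?e (q j) = 0"
      then have h: "S ?e \<le> S (q j)" by (rule e_minimal(1)[OF _ q_nonzero])
      show False
        using K_ge1 assms(2) h K_small[of j] log_decay(1)[of j] q_size(1)[of j] tight_bounds(5)[OF assms(1)]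
      tight_bounds(11)[OF assms(1)]
        by linarith
    qed
    show "crs ?e (q (suc2 j)) \<noteq> 0"
    proof
      assume "crs ?e (q (suc2 j)) = 0"
      then have h: "S ?e \<le> S (q (suc2 j))" by (rule e_minimal(1)[OF _ q_nonzero])
      show False
        using K_ge1 assms(2) h K_small[of j] tight_bounds(7,9)[OF assms(1)] tight_bounds(15)[OF assms(1)]
      q_size(1)[of "suc2 j"]
        by linarith
    qed
  qed
  have \<Delta>: "\<Delta> \<noteq> 0" using d(1) nq(2) m1(1) by auto
  have st: "s j \<noteq> (0, 0)" "t j \<noteq> (0, 0)" using d(2,3) \<Delta> by auto
  have m1l: "S (p (Suc j)) = ln \<bar>real_of_int m1\<bar> + S ?e" unfolding m1(2) by (rule log_scl(1)[OF m1(1) e_props(2)])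
  then have m1: "m1 \<noteq> 0" "p (Suc j) = scl m1 ?e" and m1': "ln \<bar>real_of_int m1\<bar> + S ?e \<le> S (p (Suc j))" using m1 by simp_all
  \<comment> \<open>The multiplier of \<open>p (suc2 j)\<close> needs a bound independent of the
    length of the primitive vector; divisibility gives about 0.093 in units of
    \<open>z j\<close>.\<close>
  have m2': "ln \<bar>real_of_int m2\<bar> \<le> S (q (suc2 j)) + S (q (Suc j))"
    using log_content[OF m2(2)[unfolded p_def] q_nonzero[unfolded q_def] q_nonzero[unfolded q_def] m2(1)] unfolding q_def .
  let ?w = "scl (A * m2) (q j) + scl (D * m1) (q (suc2 j))"
  have w: "?w = (0, 0)"
  proof (rule ccontr)
    assume nz: "?w \<noteq> (0, 0)"
    have "crs ?e ?w = 0" by (rule block_algebra(1)[OF R d])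
    then have "S ?e \<le> S ?w" by (rule e_minimal(1)[OF _ nz])
    moreover have "S ?w \<le> ln 2 + S (scl (A * m2) (q j)) \<or> S ?w \<le> ln 2 + S (scl (D * m1) (q (suc2 j)))"
    proof (rule ln_sum_cases[OF _ sz_add])
      show "0 < sz ?w" using sz_ge1[OF nz] by simp
      show "0 < sz (scl (A * m2) (q j))" "0 < sz (scl (D * m1) (q (suc2 j)))"
        using sz_ge1[of "scl (A * m2) (q j)"] sz_ge1[of "scl (D * m1) (q (suc2 j))"] AD m1(1) m2(1) q_nonzero by (auto simp: scl_zero_iff)
    qed
    moreover have "S (scl (A * m2) (q j)) = ln \<bar>real_of_int A\<bar> + ln \<bar>real_of_int m2\<bar> + S (q j)"
      "S (scl (D * m1) (q (suc2 j))) = ln \<bar>real_of_int D\<bar> + ln \<bar>real_of_int m1\<bar> + S (q (suc2 j))"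
      using AD m1(1) m2(1) by (simp_all add: log_scl q_nonzero abs_mult ln_mult)
    ultimately consider "S ?e \<le> K + ln \<bar>real_of_int A\<bar> + ln \<bar>real_of_int m2\<bar> + S (q j)"
      | "S ?e \<le> K + ln \<bar>real_of_int D\<bar> + ln \<bar>real_of_int m1\<bar> + S (q (suc2 j))" using ln2 K_ge1 by linarith
    then show False
    proof cases
      case h: 1
      note m2 = m2'
      show False
        using K_ge1 assms(2) lA m2 h K_small[of j] log_decay(1)[of j] q_size(1)[of j] tight_bounds(5,7)[OF assms(1)]
      tight_bounds(11)[OF assms(1)] tight_bounds(13)[OF assms(1)] tight_bounds(15)[OF assms(1)]
      tight_bounds(17)[OF assms(1)] q_size(1)[of "Suc j"] q_size(1)[of "suc2 j"]
      log_decay(1)[of "suc3 j"]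
        by linarith
    next
      case h: 2
      note m1 = m1'
      show False
        using K_ge1 assms(2) lD m1 h K_small[of j] log_decay(1)[of j] tight_bounds(5)[OF assms(1)]
      tight_bounds(13)[OF assms(1)] tight_ineq(3)[OF assms(1)] log_decay(1)[of "Suc j"] log_height[of "Suc j"]
      p_size(1)[of "Suc j"] log_decay(1)[of "suc2 j"] log_height[of "suc2 j"]
      q_size(1)[of "suc2 j"] log_decay(1,2)[of "suc3 j"] log_q[of "suc3 j"]
        by linarith
    qed
  qed
  have eq: "scl (A * A) (p j) + scl (- (A * B)) (q j) = scl (D * D) (s j)"
    by (rule block_algebra(2)[OF R d w AD m1(1) m2(1) \<Delta>])
  have lA': "ln \<bar>real_of_int A\<bar> \<le> 1/2500 * z j" and lD': "ln \<bar>real_of_int D\<bar> \<le> 1/2500 * z j"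
  proof -
    show "ln \<bar>real_of_int A\<bar> \<le> 1/2500 * z j"
      using K_ge1 lA K_small[of j] log_order(3)[of j] tight_bounds(17)[OF assms(1)] tight_ineq(2)[OF assms(1)]
      log_decay(1,2)[of "Suc j"] log_decay(1)[of "suc2 j"] log_height[of "suc2 j"]
      log_decay(1,2)[of "suc3 j"] log_q[of "suc3 j"]
      by linarith
    show "ln \<bar>real_of_int D\<bar> \<le> 1/2500 * z j"
      using K_ge1 lD K_small[of j] log_decay(1)[of j] log_height[of j] tight_bounds(17)[OF assms(1)]
      tight_ineq(3)[OF assms(1)] log_decay(1)[of "Suc j"] log_height[of "Suc j"] log_q[of "Suc j"]
      log_decay(1,2)[of "suc3 j"] log_q[of "suc3 j"]
      by linarith
  qed
  \<comment> \<open>33/125 rounds up the bound of about 0.2625 for the logarithm of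
    \<open>C\<close>; the term with \<open>A\<close> is much smaller.\<close>
  have tsize: "S (t j) \<le> S (p (Suc j)) + 33/125 * z j"
  proof -
    have Dt: "scl (- D) (t j) = scl A (q j) + scl C (p (Suc j))"
      using R(1) unfolding m1(2)[symmetric] by (simp add: scl_def prod_eq_iff)
    have "S (t j) \<le> S (scl (- D) (t j))" using log_scl[of "- D" "t j"] AD(2) st(2) by simp
    moreover have "S (scl (- D) (t j)) \<le> K + ln \<bar>real_of_int A\<bar> + S (q j) \<or>
      (C \<noteq> 0 \<and> S (scl (- D) (t j)) \<le> K + ln \<bar>real_of_int C\<bar> + S (p (Suc j)))"
    proof (cases "C = 0")
      case True
      then have "scl (- D) (t j) = scl A (q j)" using Dt by (simp add: zz)
      then show ?thesis using log_scl(1)[OF AD(1) q_nonzero[of j]] K_ge1 by simp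
    next
      case False
      have nz: "scl (- D) (t j) \<noteq> (0, 0)" using st(2) AD(2) by (simp add: scl_zero_iff)
      have "S (scl (- D) (t j)) \<le> ln 2 + S (scl A (q j)) \<or> S (scl (- D) (t j)) \<le> ln 2 + S (scl C (p (Suc j)))"
      proof (rule ln_sum_cases)
        show "0 < sz (scl (- D) (t j))" using sz_ge1[OF nz] by simp
        show "sz (scl (- D) (t j)) \<le> sz (scl A (q j)) + sz (scl C (p (Suc j)))" unfolding Dt by (rule sz_add)
        show "0 < sz (scl A (q j))" "0 < sz (scl C (p (Suc j)))"
          using sz_ge1[of "scl A (q j)"] sz_ge1[of "scl C (p (Suc j))"] AD False q_nonzero p_nonzero by (auto simp: scl_zero_iff)
      qed
      then show ?thesis using log_scl(1)[OF AD(1) q_nonzero[of j]] log_scl(1)[OF False p_nonzero[of "(Suc j)"]] ln2 K_ge1 False by auto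
    qed
    ultimately consider "S (t j) \<le> K + ln \<bar>real_of_int A\<bar> + S (q j)" | "C \<noteq> 0" "S (t j) \<le> K + ln \<bar>real_of_int C\<bar> + S (p (Suc j))" by linarith
    then show ?thesis
    proof cases
      case h: 1
      show ?thesis
        using K_ge1 lA h K_small[of j] log_decay(1)[of j] q_size(1)[of j] tight_bounds(5,7)[OF assms(1)]
      tight_bounds(11)[OF assms(1)] tight_bounds(17)[OF assms(1)] p_size(3)[of "Suc j"]
      log_decay(1)[of "suc3 j"]
        by linarith
    next
      case 2
      note h = 2(2) and lC = lC[OF 2(1)]
      show ?thesis
        using K_ge1 lC h K_small[of j] log_decay(1)[of j] tight_bounds(5)[OF assms(1)] tight_bounds(17)[OF assms(1)]
      log_decay(1)[of "suc3 j"]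
        by linarith
    qed
  qed
  show thesis by (rule that[OF AD lA' lD' eq st tsize])
qed

lemma s_size: "s j \<noteq> (0, 0) \<Longrightarrow> E (s j) \<le> a (suc3 j) - l (suc3 j) - l (Suc j) + K"
  "s j \<noteq> (0, 0) \<Longrightarrow> S (s j) \<le> a (suc3 j) - l (suc3 j) - l (Suc j) + K"
  unfolding s_def using log_CC(1,3)[of "(suc3 j)" "(Suc j)"] K_ge1 by fastforce+

text \<open>Taking determinants with \<open>q j\<close> in the block equation removes the unknown
  \<open>B\<close>: up to the small factors \<open>A\<close> and \<open>D\<close>, the pair
  \<open>p j\<close> meets \<open>q j\<close> like \<open>s j\<close> does. As \<open>q j\<close> is
  short and not very close to slope \<xi>, \<open>p j\<close> is hardly longer than
  \<open>s j\<close>, whose size is about 0.111 in units of \<open>z j\<close>; the direct bound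
  would be about 0.151.\<close>

lemma first_size:
  assumes "tight j" "13/125 * z j \<le> S (e (Suc j))"
  shows "S (p j) \<le> 113/1000 * z j"
proof -
  obtain A B D where AD: "A \<noteq> 0" "D \<noteq> 0" and lA: "ln \<bar>real_of_int A\<bar> \<le> 1/2500 * z j" and lD: "ln \<bar>real_of_int D\<bar> \<le> 1/2500 * z j"
    and eq: "scl (A * A) (p j) + scl (- (A * B)) (q j) = scl (D * D) (s j)" and s0: "s j \<noteq> (0, 0)"
    using block_equation[OF assms] by metis
  note ss = s_size[OF s0]
  have "crs (scl (A * A) (p j) + scl (- (A * B)) (q j)) (q j) = crs (scl (D * D) (s j)) (q j)" unfolding eq ..
  then have cr: "A * A * crs (p j) (q j) = D * D * crs (s j) (q j)" by simp
  note pos = er_pos[OF p_nonzero[of j]] er_pos[OF q_nonzero[of j]] er_pos[OF s0] sz_ge1[OF p_nonzero[of j]] sz_ge1[OF q_nonzero[of j]] sz_ge1[OF s0]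
  define Da where "Da = \<bar>real_of_int D\<bar>"
  have D1: "1 \<le> Da" using AD(2) unfolding Da_def by linarith
  have lD: "ln Da \<le> 1/2500 * z j" using lD unfolding Da_def .
  let ?f = "\<bar>real_of_int (fst (p j))\<bar>"
  have "\<bar>crs (p j) (q j)\<bar> \<le> \<bar>A * A * crs (p j) (q j)\<bar>"
  proof -
    have "1 * \<bar>crs (p j) (q j)\<bar> \<le> \<bar>A * A\<bar> * \<bar>crs (p j) (q j)\<bar>"
      by (rule mult_right_mono) (use AD(1) in \<open>auto simp: abs_mult int_one_le_iff_zero_less zero_less_mult_iff\<close>)
    then show ?thesis by (simp add: abs_mult)
  qed
  then have "\<bar>real_of_int (crs (p j) (q j))\<bar> \<le> Da * Da * \<bar>real_of_int (crs (s j) (q j))\<bar>"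
    unfolding cr Da_def by (simp add: abs_mult flip: of_int_abs of_int_mult)
  also have "\<dots> \<le> Da * Da * (sz (q j) * er (s j) + sz (s j) * er (q j))"
    by (intro mult_left_mono crs_le) (use D1 in auto)
  finally have f: "?f * er (q j) \<le> Da * Da * (sz (q j) * er (s j)) + Da * Da * (sz (s j) * er (q j)) + sz (q j) * er (p j)"
    using fst_er_le[of "p j" "q j"] by (simp add: algebra_simps)
  have lnM: "0 \<le> ln M" "ln M \<le> K / 10"
  proof -
    have "1 * M \<le> 1000 * M ^ 10" using M_ge(1) self_le_power[of M 10] by (intro mult_mono) auto
    then have "ln M \<le> ln G" unfolding G_def using M_ge(1) by (intro ln_mono) auto
    then show "ln M \<le> K / 10" "0 \<le> ln M" using K_lnG M_ge(1) by simp_all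
  qed
  consider "S (p j) \<le> K + E (p j)"
    | "S (p j) + E (q j) \<le> K + 2 * ln Da + S (q j) + E (s j)"
    | "S (p j) + E (q j) \<le> K + 2 * ln Da + S (s j) + E (q j)"
    | "S (p j) + E (q j) \<le> K + S (q j) + E (p j)"
  proof (cases "?f = 0")
    case True
    then have "S (p j) \<le> E (p j)" using sz_le[of "p j"] pos by (intro ln_mono) auto
    then show thesis using that(1) K_ge1 by linarith
  next
    case False
    then have "fst (p j) \<noteq> 0" by simp
    then have f1: "1 \<le> ?f" by linarith
    have "S (p j) \<le> ln 2 + ln (M * ?f) \<or> S (p j) \<le> ln 2 + E (p j)"
      by (rule ln_sum_cases[OF _ sz_le]) (use pos f1 M_ge(1) in auto)
    moreover have "ln (M * ?f) = ln M + ln ?f" using f1 M_ge(1) by (simp add: ln_mult)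
    moreover have "ln (?f * er (q j)) = ln ?f + E (q j)" using f1 pos by (simp add: ln_mult)
    moreover have "ln (?f * er (q j)) \<le> K / 5 + ln (Da * Da * (sz (q j) * er (s j))) \<or>
      ln (?f * er (q j)) \<le> K / 5 + ln (Da * Da * (sz (s j) * er (q j))) \<or> ln (?f * er (q j)) \<le> K / 5 + ln (sz (q j) * er (p j))"
      by (rule ln_sum3_cases[OF _ f]) (use pos f1 D1 in auto)
    moreover have "ln (Da * Da * (sz (q j) * er (s j))) = 2 * ln Da + S (q j) + E (s j)"
      "ln (Da * Da * (sz (s j) * er (q j))) = 2 * ln Da + S (s j) + E (q j)" "ln (sz (q j) * er (p j)) = S (q j) + E (p j)"
      using pos D1 by (simp_all add: ln_mult)
    ultimately have "S (p j) \<le> K + E (p j) \<or> S (p j) + E (q j) \<le> K + 2 * ln Da + S (q j) + E (s j) \<or>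
      S (p j) + E (q j) \<le> K + 2 * ln Da + S (s j) + E (q j) \<or> S (p j) + E (q j) \<le> K + S (q j) + E (p j)"
      using lnM ln2 K_ge1 by linarith
    then show thesis using that by blast
  qed
  then show ?thesis
  proof cases
    case h: 1
    show ?thesis
      using K_ge1 h K_small[of j] log_decay(1)[of j] log_order(2)[of j] p_size(2)[of j] tight_bounds(5)[OF assms(1)]
      by linarith
  next
    case h: 2
    show ?thesis
      using K_ge1 lD ss(1) h K_small[of j] log_decay(1)[of j] log_height[of j] q_irr[of j] q_size(1)[of j]
      tight_bounds(14)[OF assms(1)] tight_ineq(2,3)[OF assms(1)] log_decay(1)[of "Suc j"]
      log_order(3)[of "Suc j"] log_decay(2)[of "suc2 j"] log_decay(1,2)[of "suc3 j"]
      log_q[of "suc3 j"]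
      by linarith
  next
    case h: 3
    show ?thesis
      using K_ge1 lD ss(2) h K_small[of j] log_order(3)[of j] tight_bounds(15)[OF assms(1)] tight_ineq(2)[OF assms(1)]
      log_decay(1,2)[of "Suc j"] log_decay(1)[of "suc3 j"]
      by linarith
  next
    case h: 4
    show ?thesis
      using K_ge1 h K_small[of j] log_decay(1,2)[of j] p_size(2)[of j] q_irr[of j] q_size(1)[of j]
      tight_bounds(5)[OF assms(1)] tight_bounds(11)[OF assms(1)] tight_ineq(1)[OF assms(1)]
      log_decay(1,2)[of "Suc j"]
      by linarith
  qed
qed

lemma q_swap:
  "E (q k) + a k \<le> K + E (p k) + a (Suc k) \<or> E (q k) + a k \<le> K + S (p k) - l (Suc k) \<or> E (q k) + a k \<le> K + S (q k) - l k"
  using log_er_swap[OF p_nonzero[unfolded p_def] q_nonzero[unfolded q_def], of k] unfolding p_def q_def .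

lemma content_size:
  obtains g where "g \<noteq> 0" "S (p k) = ln \<bar>real_of_int g\<bar> + S (e k)" "E (p k) = ln \<bar>real_of_int g\<bar> + E (e k)"
    "0 \<le> ln \<bar>real_of_int g\<bar>" "ln \<bar>real_of_int g\<bar> \<le> S (q k) + a k - l k - m k + K"
proof -
  obtain g where g: "g \<noteq> 0" "p k = scl g (e k)" using e_props(1) by blast
  have "ln \<bar>real_of_int g\<bar> \<le> S (q k) + S (CC (y k) (v k))"
    unfolding q_def by (rule log_content[OF g(2)[unfolded p_def] q_nonzero[unfolded q_def] contractions(2) g(1)])
  moreover have "S (CC (y k) (v k)) \<le> a k - l k - m k + K"
    using ln_CC(3)[OF contractions(2) Lt_le_norms(2) norms_ge1(2) nonzero(2) nonzero(1) norms_ge1(1) norm_order(1) Lt_order(1), of k] K_lnG lnG by linarith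
  ultimately have "ln \<bar>real_of_int g\<bar> \<le> S (q k) + a k - l k - m k + K" by linarith
  then show thesis by (rule that[OF g(1) log_scl[OF g(1) e_props(2)[of k], folded g(2)]])
qed

lemma parallel_ratio:
  assumes "crs (e k) r = 0" "r \<noteq> (0, 0)"
  shows "S (e k) - E (e k) = S r - E r" "S (e k) \<le> S r"
proof -
  obtain g where g: "g \<noteq> 0" "r = scl g (e k)" using assms by (rule e_multiple)
  then show "S (e k) - E (e k) = S r - E r" "S (e k) \<le> S r" using log_scl[OF g(1) e_props(2)[of k]] by simp_all
qed

text \<open>If the two lines were equal, the small content of \<open>p\<close> would force the preceding line to be different,
  and then the common line is too long for \<open>first_size\<close>.\<close>

lemma tight_not_parallel:
  assumes "tight (suc3 j)"
  shows "crs (e (suc3 j)) (e (suc4 j)) \<noteq> 0"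
proof
  assume par: "crs (e (suc3 j)) (e (suc4 j)) = 0"
  note eq = e_parallel_size[OF par]
  obtain g where m0: "g \<noteq> 0" "S (p (suc3 j)) = ln \<bar>real_of_int g\<bar> + S (e (suc3 j))" "E (p (suc3 j)) = ln \<bar>real_of_int g\<bar> + E (e (suc3 j))"
    "0 \<le> ln \<bar>real_of_int g\<bar>" and m0c: "ln \<bar>real_of_int g\<bar> \<le> S (q (suc3 j)) + a (suc3 j) - l (suc3 j) - m (suc3 j) + K"
    by (rule content_size)
  \<comment> \<open>\<open>q (suc3 j)\<close> is too short to have a small error, which excludes the
    other two alternatives.\<close>
  from q_swap[of "(suc3 j)"] have sw: "E (q (suc3 j)) + a (suc3 j) \<le> K + E (p (suc3 j)) + a (suc4 j)"
  proof (elim disjE)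
    assume h: "E (q (suc3 j)) + a (suc3 j) \<le> K + S (p (suc3 j)) - l (suc4 j)"
    show ?thesis
      using K_ge1 h K_small[of "suc3 j"] log_decay(1,2)[of "suc3 j"]
      log_q[of "suc3 j"] p_size(1)[of "suc3 j"] q_irr[of "suc3 j"]
      q_size(1)[of "suc3 j"] tight_bounds(5)[OF assms] tight_bounds(11)[OF assms]
      by linarith
  next
    assume h: "E (q (suc3 j)) + a (suc3 j) \<le> K + S (q (suc3 j)) - l (suc3 j)"
    show ?thesis
      using K_ge1 h K_small[of "suc3 j"] log_decay(1,2)[of "suc3 j"]
      log_q[of "suc3 j"] q_irr[of "suc3 j"] q_size(1)[of "suc3 j"]
      tight_bounds(5)[OF assms] tight_bounds(11)[OF assms]
      by linarith
  qed
  show False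
  proof (cases "crs (e (suc2 j)) (e (suc3 j)) = 0")
    case True
    note eq2 = e_parallel_size[OF True]
    obtain g2 where mm: "g2 \<noteq> 0" "S (p (suc2 j)) = ln \<bar>real_of_int g2\<bar> + S (e (suc2 j))" "E (p (suc2 j)) = ln \<bar>real_of_int g2\<bar> + E (e (suc2 j))"
      "0 \<le> ln \<bar>real_of_int g2\<bar>" and mmc: "ln \<bar>real_of_int g2\<bar> \<le> S (q (suc2 j)) + a (suc2 j) - l (suc2 j) - m (suc2 j) + K"
      by (rule content_size)
    from q_swap[of "(suc2 j)"] show False
    proof (elim disjE)
      assume h: "E (q (suc2 j)) + a (suc2 j) \<le> K + E (p (suc2 j)) + a (suc3 j)"
      show ?thesis
        using K_ge1 eq(2) m0(3) m0c sw eq2(2) mm(3) mmc h K_small[of "suc2 j"] log_decay(1,2)[of "suc2 j"]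
      log_height[of "suc2 j"] log_q[of "suc2 j"] q_irr[of "suc2 j"] q_size(1)[of "suc2 j"]
      log_decay(1,2)[of "suc3 j"] q_irr[of "suc3 j"] q_size(1)[of "suc3 j"]
      tight_bounds(5,7)[OF assms] tight_bounds(11)[OF assms] e_size(3)[of "suc4 j"]
        by linarith
    next
      assume h: "E (q (suc2 j)) + a (suc2 j) \<le> K + S (p (suc2 j)) - l (suc3 j)"
      show ?thesis
        using K_ge1 h K_small[of "suc2 j"] log_decay(1,2)[of "suc2 j"] log_height[of "suc2 j"]
      log_q[of "suc2 j"] p_size(1)[of "suc2 j"] q_irr[of "suc2 j"] q_size(1)[of "suc2 j"]
      log_order(4)[of "suc3 j"]
        by linarith
    next
      assume h: "E (q (suc2 j)) + a (suc2 j) \<le> K + S (q (suc2 j)) - l (suc2 j)"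
      show ?thesis
        using K_ge1 h K_small[of "suc2 j"] log_decay(1,2)[of "suc2 j"] log_height[of "suc2 j"]
      log_q[of "suc2 j"] q_irr[of "suc2 j"] q_size(1)[of "suc2 j"]
      log_order(4)[of "suc3 j"]
        by linarith
    qed
  next
    case nz: False
    have np: "0 \<le> S (e (suc3 j)) + E (e (suc2 j)) + K"
      using log_crs[OF nz]
    proof
      assume h: "0 \<le> S (e (suc2 j)) + E (e (suc3 j)) + K"
      show ?thesis
        using K_ge1 eq(2) h K_small[of "suc2 j"] e_size(2)[of "suc2 j"] log_decay(1)[of "suc2 j"]
      log_order(3)[of "suc2 j"] log_decay(2)[of "suc3 j"] tight_bounds(5,7)[OF assms]
      tight_bounds(11)[OF assms] tight_ineq(1)[OF assms] e_size(3)[of "suc4 j"]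
      log_decay(1,2)[of "suc4 j"]
        by linarith
    qed
    \<comment> \<open>If the preceding spaces agree, the bounds of that earlier block contradict
      \<open>sw\<close> and \<open>np\<close>. Otherwise \<open>np\<close> makes the common line
      long enough for \<open>first_size\<close>, which in turn makes it too short for
      \<open>np\<close>.\<close>
    show False
    proof (cases "same (suc2 j)")
      case True
      then have T: "tight (Suc j)" by (simp add: tight_def)
      show False
        using K_ge1 eq(2) m0(2) m0(3) sw np K_small[of "Suc j"] tight_bounds(5)[OF T] tight_bounds(11)[OF T]
      tight_bounds(12)[OF T] tight_bounds(15)[OF T] e_size(3)[of "suc2 j"]
      log_decay(1)[of "suc3 j"] p_size(1)[of "suc3 j"] q_irr[of "suc3 j"]
      q_size(1)[of "suc3 j"] tight_bounds(5,7)[OF assms] tight_bounds(11)[OF assms]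
      e_size(3)[of "suc4 j"]
        by linarith
    next
      case False
      have "13/125 * z (suc3 j) \<le> S (e (suc3 j))"
        using K_ge1 np not_same[OF False] K_small[of "suc2 j"] e_size(3)[of "suc2 j"]
      log_decay(1,2)[of "suc2 j"] log_height[of "suc2 j"] log_decay(1,2)[of "suc3 j"]
      log_q[of "suc3 j"]
        by linarith
      then have fs: "S (p (suc3 j)) \<le> 113/1000 * z (suc3 j)" using first_size[OF assms] eq(1) by simp
      show False
        using K_ge1 m0(2) m0(4) np not_same[OF False] fs K_small[of "suc2 j"] e_size(3)[of "suc2 j"]
      log_decay(1,2)[of "suc2 j"] log_height[of "suc2 j"] log_decay(1,2)[of "suc3 j"]
      log_q[of "suc3 j"]
        by linarith
    qed
  qed
qed

text \<open>If the spaces of index \<open>suc2 j\<close> and \<open>suc3 j\<close> differed, two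
  changes in a row would make the lines of \<open>lines_parallel\<close> agree, against
  \<open>tight_not_parallel\<close>.\<close>

lemma tight_back:
  assumes "tight (suc3 j)"
  shows "tight (Suc j)"
  using lines_parallel[of "(suc2 j)"] tight_not_parallel[OF assms] tight_not_same(1)[OF assms] by (auto simp: tight_def)

text \<open>Of the two products in \<open>log_crs\<close> only that of the size of
  \<open>e (suc3 j)\<close> and the error of \<open>e (suc2 j)\<close> can reach 1. That error has
  logarithm about -0.262 in units of \<open>z j\<close>, which is -0.162 in units of
  \<open>z (suc2 j)\<close>.\<close>

lemma line_lower:
  assumes "tight j" "tight (suc2 j)" "crs (e (suc2 j)) (e (suc3 j)) \<noteq> 0"
  shows "161/1000 * z (suc2 j) \<le> S (e (suc3 j))"
  using log_crs[OF assms(3)]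
proof
  assume h: "0 \<le> S (e (suc2 j)) + E (e (suc3 j)) + K"
  show ?thesis
    using K_ge1 h K_small[of j] tight_bounds(9)[OF assms(1)] e_size(2)[of "suc2 j"]
      log_decay(1)[of "suc2 j"] tight_bounds(5,7)[OF assms(2)] tight_bounds(11)[OF assms(2)]
      e_size(3)[of "suc3 j"]
    by linarith
next
  assume h: "0 \<le> S (e (suc3 j)) + E (e (suc2 j)) + K"
  show ?thesis
    using K_ge1 h K_small[of j] tight_bounds(1)[OF assms(1)] tight_bounds(13)[OF assms(1)]
      tight_bounds(16)[OF assms(1)] e_size(3)[of "suc2 j"] log_decay(1)[of "suc2 j"]
      log_decay(1)[of "suc3 j"]
    by linarith
qed

text \<open>The ratio is near 1.3556/1.618 = 0.838. A first point this short lowers the error of its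
  contraction with the next point, by about 0.16 in these units.\<close>

lemma tight_tight_bound:
  assumes "tight j" "tight (suc2 j)"
  shows "a (suc2 j) \<le> 4193/5000 * z (suc2 j)"
  using K_ge1 K_small[of j] tight_bounds(1)[OF assms(1)] tight_ineq(3)[OF assms(1)]
      log_decay(1,2)[of "suc2 j"] log_height[of "suc2 j"] log_decay(1,2)[of "suc3 j"]
      log_q[of "suc3 j"]
  by linarith

text \<open>The two pairs are multiples of the same vector, so their sizes differ as their errors
  do. The error of \<open>p (Suc j)\<close> has logarithm at most, and by \<open>q_swap\<close> that
  of \<open>p (suc2 j)\<close> at least, about -0.262 in units of \<open>z j\<close>.\<close>

lemma second_size:
  assumes "tight j"
  shows "S (p (Suc j)) \<le> S (p (suc2 j)) + 1/500 * z j"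
proof -
  have pe: "crs (e k) (p k) = 0" for k
  proof -
    obtain g where "p k = scl g (e k)" using e_props(1) by blast
    then show ?thesis by simp
  qed
  have ratio: "S (p (suc2 j)) - E (p (suc2 j)) = S (p (Suc j)) - E (p (Suc j))"
    using parallel_ratio(1)[OF pe p_nonzero, of "(Suc j)"] parallel_ratio(1)[OF pe p_nonzero, of "(suc2 j)"] e_parallel_size[OF tight_lines[OF assms]] by simp
  from q_swap[of "(suc2 j)"] show ?thesis
  proof (elim disjE)
    assume h: "E (q (suc2 j)) + a (suc2 j) \<le> K + E (p (suc2 j)) + a (suc3 j)"
    show ?thesis
      using K_ge1 h ratio K_small[of j] log_order(3)[of j] tight_bounds(15)[OF assms] tight_ineq(2,3)[OF assms]
      log_decay(1,2)[of "Suc j"] log_order(3)[of "Suc j"] p_size(2)[of "Suc j"] log_decay(1,2)[of "suc2 j"]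
      log_height[of "suc2 j"] q_irr[of "suc2 j"] q_size(1)[of "suc2 j"]
      log_decay(1)[of "suc3 j"] log_q[of "suc3 j"]
      by linarith
  next
    assume h: "E (q (suc2 j)) + a (suc2 j) \<le> K + S (p (suc2 j)) - l (suc3 j)"
    show ?thesis
      using K_ge1 h K_small[of j] tight_bounds(5,7,9)[OF assms] tight_bounds(15)[OF assms] p_size(1)[of "Suc j"]
      q_irr[of "suc2 j"] q_size(1)[of "suc2 j"]
      by linarith
  next
    assume h: "E (q (suc2 j)) + a (suc2 j) \<le> K + S (q (suc2 j)) - l (suc2 j)"
    show ?thesis
      using K_ge1 h K_small[of j] tight_bounds(7,9)[OF assms] tight_bounds(12)[OF assms] tight_bounds(15)[OF assms]
      q_irr[of "suc2 j"] q_size(1)[of "suc2 j"]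
      by linarith
  qed
qed

lemma scaled_errors:
  assumes "A \<noteq> 0" "D \<noteq> 0" "scl (A * A) r + scl (- (A * B)) q' = scl (D * D) s'" "r \<noteq> (0, 0)" "q' \<noteq> (0, 0)" "s' \<noteq> (0, 0)"
  shows "B \<noteq> 0 \<Longrightarrow> E q' \<le> K + 2 * ln \<bar>real_of_int D\<bar> + E s' \<or> E q' \<le> K + 2 * ln \<bar>real_of_int A\<bar> + E r"
    and "B = 0 \<Longrightarrow> E s' \<le> K + 2 * ln \<bar>real_of_int A\<bar> + E r"
proof -
  have sq: "E (scl (g * g) w) = 2 * ln \<bar>real_of_int g\<bar> + E w" if "g \<noteq> 0" "w \<noteq> (0, 0)" for g w
    using log_scl(2)[OF that(1), of "scl g w"] log_scl(2)[OF that] that by (simp add: scl_scl scl_zero_iff)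
  {
    assume "B \<noteq> 0"
    then have AB: "A * B \<noteq> 0" using assms(1) by simp
    have nz: "scl (A * B) q' \<noteq> (0, 0)" "scl (D * D) s' \<noteq> (0, 0)" "scl (- (A * A)) r \<noteq> (0, 0)" "scl (A * A) r \<noteq> (0, 0)"
      using AB assms by (simp_all add: scl_zero_iff)
    have er_minus: "er (scl (- g) w) = er (scl g w)" for g w by (simp add: er_scl)
    have "scl (- (A * B)) q' = scl (D * D) s' + scl (- (A * A)) r"
      using assms(3) by (simp add: scl_def prod_eq_iff algebra_simps)
    then have "er (scl (A * B) q') \<le> er (scl (D * D) s') + er (scl (A * A) r)"
      using er_add[of "scl (D * D) s'" "scl (- (A * A)) r"] by (simp only: er_minus flip: er_minus[of "A * B"])
    from ln_sum_cases[OF er_pos[OF nz(1)] this er_pos[OF nz(2)] er_pos[OF nz(4)]]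
    have "E (scl (A * B) q') \<le> ln 2 + E (scl (D * D) s') \<or> E (scl (A * B) q') \<le> ln 2 + E (scl (A * A) r)" .
    then show "E q' \<le> K + 2 * ln \<bar>real_of_int D\<bar> + E s' \<or> E q' \<le> K + 2 * ln \<bar>real_of_int A\<bar> + E r"
      using log_scl(2,3)[OF AB assms(5)] sq[OF assms(2,6)] sq[OF assms(1,4)] ln2 K_ge1 by linarith
  }
  assume "B = 0"
  then have "scl (A * A) r = scl (D * D) s'" using assms(3) by (simp add: scl_def prod_eq_iff)
  then have "2 * ln \<bar>real_of_int A\<bar> + E r = 2 * ln \<bar>real_of_int D\<bar> + E s'" using sq[OF assms(1,4)] sq[OF assms(2,6)] by simp
  moreover have "0 \<le> ln \<bar>real_of_int D\<bar>" by (rule log_scl(3)[OF assms(2,6)])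
  ultimately show "E s' \<le> K + 2 * ln \<bar>real_of_int A\<bar> + E r" using K_ge1 by linarith
qed

text \<open>Both \<open>t j\<close> and \<open>p (j + 6)\<close> are so short that they are multiples of \<open>e (j + 6)\<close>. Depending on whether the coefficient \<open>B\<close> of
  the linear relation vanishes, the error of \<open>s j\<close> is bounded from above or from below, hence so is that of \<open>t j\<close>, and either
  \<open>t j\<close> or \<open>p (j + 6)\<close> becomes a multiple too large for its size.\<close>

lemma tight_blocks_impossible:
  assumes T: "tight j" "tight (suc2 j)" "tight (suc4 j)" "tight (suc6 j)"
    and low: "161/1000 * z j \<le> S (e (Suc j))" "161/1000 * z (suc2 j) \<le> S (e (suc3 j))" "161/1000 * z (suc4 j) \<le> S (e (suc5 j))" "161/1000 * z (suc6 j) \<le> S (e (suc7 j))"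
    and aj: "a j \<le> 4193/5000 * z j" "a (suc6 j) \<le> 4193/5000 * z (suc6 j)"
  shows False
proof -
  have long: "13/125 * z k \<le> S (e (Suc k))" if "161/1000 * z k \<le> S (e (Suc k))" for k
    using that K_small[of k] K_ge1 by linarith
  note fs = first_size[OF T(2) long[OF low(2)]] first_size[OF T(4) long[OF low(4)]]
  note second = second_size[OF T(1)]
  obtain A B D where AD: "A \<noteq> 0" "D \<noteq> 0" and lA: "ln \<bar>real_of_int A\<bar> \<le> 1/2500 * z j" and lD: "ln \<bar>real_of_int D\<bar> \<le> 1/2500 * z j"
    and eq: "scl (A * A) (p j) + scl (- (A * B)) (q j) = scl (D * D) (s j)"
    and st: "s j \<noteq> (0, 0)" "t j \<noteq> (0, 0)" and tsize: "S (t j) \<le> S (p (Suc j)) + 33/125 * z j"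
    by (rule block_equation[OF T(1) long[OF low(1)]])
  have tE: "E (t j) \<le> a (Suc j) - l (Suc j) - l (suc3 j) + K"
    using log_CC(1)[OF st(2)[unfolded t_def]] K_ge1 unfolding t_def by simp
  note sS = s_size(2)[OF st(1)]
  have e56: "S (e (suc5 j)) = S (e (suc6 j))" by (rule e_parallel_size[OF tight_lines[OF T(3)]])
  obtain g where g: "g \<noteq> 0" "p (suc6 j) = scl g (e (suc6 j))" using e_props(1) by blast
  \<comment> \<open>In units of \<open>z j\<close> the sizes are at most 0.45 and 0.48, while the
    logarithms of the errors are at most -0.68 for \<open>p (suc6 j)\<close> and -0.50 for
    \<open>t j\<close>.\<close>
  have "crs (t j) (p (suc6 j)) = 0"
  proof (rule ccontr)
    assume "\<not> ?thesis"
    from log_crs[OF this] show False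
    proof
      assume h: "0 \<le> S (t j) + E (p (suc6 j)) + K"
      show False
        using K_ge1 fs(1) second tsize h K_small[of j] tight_bounds(1)[OF T(1)] tight_bounds(1)[OF T(2)]
      tight_bounds(7,9)[OF T(3)] tight_bounds(13)[OF T(3)] p_size(2)[of "suc6 j"] low(3)
        by linarith
    next
      assume h: "0 \<le> S (p (suc6 j)) + E (t j) + K"
      show False
        using K_ge1 fs(2) tE h K_small[of j] tight_bounds(5,9)[OF T(1)] tight_bounds(11)[OF T(1)]
      tight_bounds(2,5)[OF T(2)] tight_bounds(2)[OF T(3)] low(3)
        by linarith
    qed
  qed
  then have "crs (t j) (e (suc6 j)) = 0" using g by simp
  then have et: "crs (e (suc6 j)) (t j) = 0" using crs_anti[of "e (suc6 j)" "t j"] by simp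
  note rt = parallel_ratio[OF et st(2)]
  note rp = parallel_ratio[OF _ p_nonzero, of "(suc6 j)" "(suc6 j)", unfolded g(2) crs_scl crs_self mult_zero_right, OF refl, folded g(2)]
  note low = low(3)
  have swap: "E (s j) + a (Suc j) \<le> K + E (t j) + a (suc3 j) \<or> E (s j) + a (Suc j) \<le> K + S (t j) - l (suc3 j) \<or> E (s j) + a (Suc j) \<le> K + S (s j) - l (Suc j)"
    "E (t j) + a (suc3 j) \<le> K + E (s j) + a (Suc j) \<or> E (t j) + a (suc3 j) \<le> K + S (s j) - l (Suc j) \<or> E (t j) + a (suc3 j) \<le> K + S (t j) - l (suc3 j)"
    using log_er_swap[OF st(2)[unfolded t_def] st(1)[unfolded s_def]] log_er_swap[OF st(1)[unfolded s_def] st(2)[unfolded t_def]]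
    unfolding s_def t_def by blast+
  show False
  proof (cases "B = 0")
    case False
    \<comment> \<open>\<open>q j\<close> has almost size 0, so its error and then that of
      \<open>s j\<close> are not small, and \<open>E (t j)\<close> is at least about -0.62 in units
      of \<open>z j\<close>. Size minus error is constant along the common line, which leaves at
      most 0.39 for the size of \<open>p (suc6 j)\<close>; a multiple of \<open>e (suc6 j)\<close>
      has at least 0.42.\<close>
    have b: "E (q j) \<le> K + 2 * ln \<bar>real_of_int D\<bar> + E (s j)"
      using scaled_errors(1)[OF AD eq p_nonzero q_nonzero st(1) False]
    proof
      assume h: "E (q j) \<le> K + 2 * ln \<bar>real_of_int A\<bar> + E (p j)"
      show ?thesis
        using K_ge1 aj(1) lA h K_small[of j] p_size(2)[of j] q_irr[of j] q_size(1)[of j] tight_bounds(3,5)[OF T(1)]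
      tight_bounds(11)[OF T(1)]
        by linarith
    qed
    from swap(1) show False
    proof (elim disjE)
      assume h: "E (s j) + a (Suc j) \<le> K + E (t j) + a (suc3 j)"
      show False
        using K_ge1 fs(1) second tsize low e56 lD rt(1) rp(1) rp(2) b h K_small[of j] q_irr[of j] q_size(1)[of j]
      tight_bounds(3,5)[OF T(1)] tight_bounds(11)[OF T(1)] tight_bounds(15)[OF T(1)] tight_bounds(1)[OF T(2)]
      tight_bounds(11)[OF T(2)] tight_bounds(7,9)[OF T(3)] tight_bounds(13)[OF T(3)]
      p_size(2)[of "suc6 j"]
        by linarith
    next
      assume h: "E (s j) + a (Suc j) \<le> K + S (t j) - l (suc3 j)"
      show False
        using K_ge1 fs(1) second tsize lD b h K_small[of j] q_irr[of j] q_size(1)[of j] tight_bounds(3,5,9)[OF T(1)]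
      tight_bounds(11)[OF T(1)] tight_bounds(5)[OF T(2)]
        by linarith
    next
      assume h: "E (s j) + a (Suc j) \<le> K + S (s j) - l (Suc j)"
      show False
        using K_ge1 sS lD b h K_small[of j] q_irr[of j] q_size(1)[of j] tight_bounds(3,5)[OF T(1)]
      tight_bounds(11)[OF T(1)] tight_bounds(15)[OF T(1)] tight_bounds(5)[OF T(2)] tight_bounds(11)[OF T(2)]
        by linarith
    qed
  next
    case True
    \<comment> \<open>Here \<open>s j\<close> inherits the small error of \<open>p j\<close>, and
      \<open>E (t j)\<close> drops to about -0.777 in units of \<open>z j\<close>. The lower bound
      \<open>pl\<close> stems from \<open>a (suc6 j) - a (suc7 j)\<close>, about -0.262 in units of
      \<open>z (suc4 j)\<close>. Together they leave at most 0.41 for the size of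
      \<open>t j\<close>, below the 0.42 of \<open>e (suc6 j)\<close>.\<close>
    note b = scaled_errors(2)[OF AD eq p_nonzero q_nonzero st(1) True]
    from q_swap[of "(suc6 j)"] have pl: "- (27/100) * z (suc4 j) \<le> E (p (suc6 j))"
    proof (elim disjE)
      assume h: "E (q (suc6 j)) + a (suc6 j) \<le> K + E (p (suc6 j)) + a (suc7 j)"
      show ?thesis
        using K_ge1 h K_small[of j] tight_bounds(1)[OF T(1)] tight_bounds(1)[OF T(2)] tight_bounds(12)[OF T(3)]
      tight_bounds(15)[OF T(3)] q_irr[of "suc6 j"]
      q_size(1)[of "suc6 j"] tight_bounds(3,5)[OF T(4)] tight_bounds(11)[OF T(4)]
        by linarith
    next
      assume h: "E (q (suc6 j)) + a (suc6 j) \<le> K + S (p (suc6 j)) - l (suc7 j)"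
      show ?thesis
        using K_ge1 fs(2) h K_small[of j] tight_bounds(1)[OF T(1)] tight_bounds(1)[OF T(2)] tight_bounds(9)[OF T(3)]
      tight_bounds(12)[OF T(3)] q_irr[of "suc6 j"]
      q_size(1)[of "suc6 j"] tight_bounds(3,5)[OF T(4)] tight_bounds(11)[OF T(4)]
        by linarith
    next
      assume h: "E (q (suc6 j)) + a (suc6 j) \<le> K + S (q (suc6 j)) - l (suc6 j)"
      show ?thesis
        using K_ge1 h K_small[of j] tight_bounds(1)[OF T(1)] tight_bounds(1)[OF T(2)] tight_bounds(9)[OF T(3)]
      tight_bounds(12)[OF T(3)] q_irr[of "suc6 j"]
      q_size(1)[of "suc6 j"] tight_bounds(3,5)[OF T(4)] tight_bounds(11)[OF T(4)]
        by linarith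
    qed
    from swap(2) show False
    proof (elim disjE)
      assume h: "E (t j) + a (suc3 j) \<le> K + E (s j) + a (Suc j)"
      show False
        using K_ge1 aj(1) fs(2) low e56 lA rt(1) rt(2) rp(1) b pl h K_small[of j] p_size(2)[of j]
      tight_bounds(2,3,5)[OF T(1)] tight_bounds(11)[OF T(1)] tight_bounds(14)[OF T(1)] tight_bounds(2)[OF T(2)]
      tight_bounds(2)[OF T(3)]
        by linarith
    next
      assume h: "E (t j) + a (suc3 j) \<le> K + S (s j) - l (Suc j)"
      show False
        using K_ge1 fs(2) sS low e56 rt(1) rt(2) rp(1) pl h K_small[of j] tight_bounds(5,9)[OF T(1)]
      tight_bounds(2,5)[OF T(2)] tight_bounds(2)[OF T(3)]
        by linarith
    next
      assume h: "E (t j) + a (suc3 j) \<le> K + S (t j) - l (suc3 j)"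
      show False
        using K_ge1 fs(2) rt(1) rp(1) pl h K_small[of j] tight_bounds(2)[OF T(1)] tight_bounds(14)[OF T(1)]
      tight_bounds(2,5)[OF T(2)] tight_bounds(2)[OF T(3)]
        by linarith
    qed
  qed
qed

text \<open>Five successive blocks are used: four for the contradiction, and one before them that
  supplies the length of the first line and the bound on the first point.\<close>

theorem no_regular_points: False
proof -
  obtain T where T: "T \<ge> 20" "same T" using same_infinitely_often by blast
  define h where "h = T - 10"
  have "T = Suc (suc9 h)" using T(1) by (simp add: h_def)
  then have t9: "tight (suc9 h)" using T(2) by (simp add: tight_def)
  have t7: "tight (suc7 h)" by (rule tight_back[OF t9])
  have t5: "tight (suc5 h)" by (rule tight_back[OF t7])
  have t3: "tight (suc3 h)" by (rule tight_back[OF t5])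
  have t1: "tight (Suc h)" by (rule tight_back[OF t3])
  show False
    by (rule tight_blocks_impossible[OF t3 t5 t7 t9
      line_lower[OF t1 t3 tight_not_parallel[OF t3]] line_lower[OF t3 t5 tight_not_parallel[OF t5]]
      line_lower[OF t5 t7 tight_not_parallel[OF t7]] line_lower[OF t7 t9 tight_not_parallel[OF t9]]
      tight_tight_bound[OF t1 t3] tight_tight_bound[OF t7 t9]])
qed

end

section \<open>The degree of the field\<close>

lemma rat_span_scale:
  assumes "w \<in> rat_vs.span S"
  shows "c * w \<in> rat_vs.span ((*) c ` S)"
  using assms
proof (rule rat_vs.span_induct)
  show "rat_vs.subspace {w. c * w \<in> rat_vs.span ((*) c ` S)}"
  proof (rule rat_vs.subspaceI; unfold mem_Collect_eq)
    show "c * 0 \<in> rat_vs.span ((*) c ` S)" by (simp add: rat_vs.span_zero)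
    show "c * (x + y) \<in> rat_vs.span ((*) c ` S)"
      if "c * x \<in> rat_vs.span ((*) c ` S)" "c * y \<in> rat_vs.span ((*) c ` S)" for x y
      using rat_vs.span_add[OF that] by (simp add: distrib_left)
    show "c * (of_rat q * x) \<in> rat_vs.span ((*) c ` S)" if "c * x \<in> rat_vs.span ((*) c ` S)" for q x
      using rat_vs.span_scale[OF that, of q] by (simp add: mult.left_commute)
  qed
qed (auto intro: rat_vs.span_base)

text \<open>Multiplication by \<open>x\<close> sends a basis to an independent set of the same
  cardinality inside the span. That image therefore spans 1, and dividing by \<open>x\<close> gives
  the inverse.\<close>

lemma rat_span_inverse:
  assumes fin: "finite B" and one: "1 \<in> rat_vs.span B" and x: "x \<noteq> 0"
    and closed: "\<And>b. b \<in> B \<Longrightarrow> x * b \<in> rat_vs.span B"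
  shows "inverse x \<in> rat_vs.span B"
proof -
  obtain B0 where B0: "B0 \<subseteq> B" "\<not> rat_vs.dependent B0" "B \<subseteq> rat_vs.span B0"
    using rat_vs.maximal_independent_subset by blast
  have fin0: "finite B0" using B0(1) fin by (rule finite_subset)
  have span0: "rat_vs.span B \<subseteq> rat_vs.span B0" using B0(3) rat_vs.span_minimal rat_vs.subspace_span by blast
  have image: "(*) (inverse x) ` (*) x ` S = S" for S using x by (simp add: image_image mult.assoc[symmetric])
  let ?xB = "(*) x ` B0"
  have inj: "inj_on ((*) x) B0" using x by (auto intro: inj_onI)
  have indep: "\<not> rat_vs.dependent ?xB"
  proof
    assume "rat_vs.dependent ?xB"
    then obtain b where b: "b \<in> B0" "x * b \<in> rat_vs.span (?xB - {x * b})" by (auto simp: rat_vs.dependent_def)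
    have "?xB - {x * b} = (*) x ` (B0 - {b})" using x by auto
    then have "inverse x * (x * b) \<in> rat_vs.span ((*) (inverse x) ` (*) x ` (B0 - {b}))"
      using rat_span_scale[OF b(2), of "inverse x"] by simp
    then have "b \<in> rat_vs.span (B0 - {b})" using x unfolding image by (simp add: mult.assoc[symmetric])
    then show False using B0(2) b(1) by (auto simp: rat_vs.dependent_def)
  qed
  have "1 \<in> rat_vs.span ?xB"
  proof (rule ccontr)
    assume n1: "1 \<notin> rat_vs.span ?xB"
    then have "\<not> rat_vs.dependent (insert 1 ?xB)" using indep rat_vs.independent_insertI by blast
    moreover have "insert 1 ?xB \<subseteq> rat_vs.span B0" using span0 one closed B0(1) by blast
    ultimately have "card (insert 1 ?xB) \<le> card B0" using rat_vs.independent_span_bound[OF fin0] by blast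
    moreover have "1 \<notin> ?xB" using n1 rat_vs.span_base by blast
    ultimately show False using fin0 inj by (simp add: card_image)
  qed
  from rat_span_scale[OF this, of "inverse x"] have "inverse x \<in> rat_vs.span B0" by (simp add: image)
  then show ?thesis using rat_vs.span_mono[OF B0(1)] by auto
qed

lemma cubic_closure:
  fixes \<xi> :: real
  assumes cube: "\<xi>^3 = of_rat r0 + of_rat r1 * \<xi> + of_rat r2 * \<xi>^2"
  shows "is_subfield (rat_vs.span {1, \<xi>, \<xi>^2})"
proof -
  let ?B = "{1, \<xi>, \<xi>^2}"
  let ?V = "rat_vs.span ?B"
  have B: "1 \<in> ?V" "\<xi> \<in> ?V" "\<xi>^2 \<in> ?V" by (auto intro: rat_vs.span_base)
  have lin: "of_rat a * x + of_rat b * y + of_rat c * w \<in> ?V" if "x \<in> ?V" "y \<in> ?V" "w \<in> ?V" for a b c x y w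
    using that by (intro rat_vs.span_add rat_vs.span_scale)
  have repr: "\<exists>a b c. x = of_rat a * 1 + of_rat b * \<xi> + of_rat c * \<xi>^2" if x: "x \<in> ?V" for x
  proof -
    obtain a b c where "x - of_rat a * 1 - of_rat b * \<xi> - of_rat c * \<xi>^2 = 0"
      using x unfolding rat_vs.span_breakdown_eq rat_vs.span_empty by auto
    then show ?thesis by (intro exI[of _ a] exI[of _ b] exI[of _ c]) simp
  qed
  have cube': "\<xi>^3 \<in> ?V" using lin[OF B, of r0 r1 r2] cube by simp
  have step: "\<xi> * x \<in> ?V" if x: "x \<in> ?V" for x
  proof -
    obtain a b c where abc: "x = of_rat a * 1 + of_rat b * \<xi> + of_rat c * \<xi>^2" using repr[OF x] by blast
    have "\<xi> * x = of_rat a * \<xi> + of_rat b * \<xi>^2 + of_rat c * \<xi>^3"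
      unfolding abc by (simp add: algebra_simps power2_eq_square power3_eq_cube)
    then show ?thesis using lin[OF B(2,3) cube'] by simp
  qed
  have mult: "x * y \<in> ?V" if x: "x \<in> ?V" and y: "y \<in> ?V" for x y
  proof -
    obtain a b c where abc: "x = of_rat a * 1 + of_rat b * \<xi> + of_rat c * \<xi>^2" using repr[OF x] by blast
    have "x * y = of_rat a * y + of_rat b * (\<xi> * y) + of_rat c * (\<xi> * (\<xi> * y))"
      unfolding abc by (simp add: algebra_simps power2_eq_square)
    then show ?thesis using lin[OF y step[OF y] step[OF step[OF y]]] by simp
  qed
  have "inverse x \<in> ?V" if "x \<in> ?V" "x \<noteq> 0" for x
    using that B(1) mult by (intro rat_span_inverse) (auto intro: rat_vs.span_base)
  then show ?thesis
    unfolding is_subfield_def using mult B(1) rat_vs.span_zero rat_vs.span_diff by blast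
qed

text \<open>A relation of degree below 3 is multiplied by powers of \<xi> until it has degree 3.
  Then the cube lies in the span of 1, \<xi>, \<xi>^2, which is a field, so the degree is at most
  3.\<close>

lemma cubic_independentI:
  assumes "degree_over_rat (rat_adjoin \<xi>) > 3"
  shows "cubic_independent \<xi>"
proof
  fix f :: pt
  assume z: "real_of_int (c0 f) + real_of_int (c1 f) * \<xi> + real_of_int (c2 f) * \<xi>^2 + real_of_int (c3 f) * \<xi>^3 = 0"
  show "f = nul"
  proof (rule ccontr)
    assume nz: "f \<noteq> nul"
    have rat: "of_rat (- of_int i / of_int j) = - real_of_int i / real_of_int j" for i j
      by (simp add: of_rat_divide of_rat_minus)
    have "\<exists>r0 r1 r2. \<xi>^3 = of_rat r0 + of_rat r1 * \<xi> + of_rat r2 * \<xi>^2"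
    proof -
      have solve: ?thesis if "j \<noteq> 0" "real_of_int i0 + real_of_int i1 * \<xi> + real_of_int i2 * \<xi>^2 + real_of_int j * \<xi>^3 = 0" for i0 i1 i2 j
      proof (intro exI)
        have "real_of_int j * \<xi>^3 = - real_of_int i0 - real_of_int i1 * \<xi> - real_of_int i2 * \<xi>^2" using that(2) by linarith
        then have "\<xi>^3 = (- real_of_int i0 - real_of_int i1 * \<xi> - real_of_int i2 * \<xi>^2) / real_of_int j"
          using that(1) by (simp add: field_simps)
        then show "\<xi>^3 = of_rat (- of_int i0 / of_int j) + of_rat (- of_int i1 / of_int j) * \<xi> + of_rat (- of_int i2 / of_int j) * \<xi>^2"
          unfolding rat by (simp add: add_divide_distrib diff_divide_distrib)
      qed
      have zx: "real_of_int 0 + real_of_int (c0 f) * \<xi> + real_of_int (c1 f) * \<xi>^2 + real_of_int (c2 f) * \<xi>^3 = 0" if "c3 f = 0"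
      proof -
        have "real_of_int (c0 f) + real_of_int (c1 f) * \<xi> + real_of_int (c2 f) * \<xi>^2 = 0" using z that by simp
        then have "\<xi> * (real_of_int (c0 f) + real_of_int (c1 f) * \<xi> + real_of_int (c2 f) * \<xi>^2) = 0" by simp
        then show ?thesis by (simp add: algebra_simps power2_eq_square power3_eq_cube)
      qed
      have zxx: "real_of_int 0 + real_of_int 0 * \<xi> + real_of_int (c0 f) * \<xi>^2 + real_of_int (c1 f) * \<xi>^3 = 0" if "c3 f = 0" "c2 f = 0"
      proof -
        have "real_of_int (c0 f) * \<xi> + real_of_int (c1 f) * \<xi>^2 = 0" using zx[OF that(1)] that(2) by simp
        then have "\<xi> * (real_of_int (c0 f) * \<xi> + real_of_int (c1 f) * \<xi>^2) = 0" by simp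
        then show ?thesis by (simp add: algebra_simps power2_eq_square power3_eq_cube)
      qed
      have "\<not> (c1 f = 0 \<and> c2 f = 0 \<and> c3 f = 0)"
      proof
        assume *: "c1 f = 0 \<and> c2 f = 0 \<and> c3 f = 0"
        then have "c0 f = 0" using z by simp
        then show False using nz * by (simp add: pt_eq_iff)
      qed
      then consider "c3 f \<noteq> 0" | "c3 f = 0" "c2 f \<noteq> 0" | "c3 f = 0" "c2 f = 0" "c1 f \<noteq> 0" by blast
      then show ?thesis
      proof cases
        case 1 show ?thesis by (rule solve[OF 1 z])
      next
        case 2 show ?thesis by (rule solve[OF 2(2) zx[OF 2(1)]])
      next
        case 3 show ?thesis by (rule solve[OF 3(3) zxx[OF 3(1,2)]])
      qed
    qed
    then obtain r0 r1 r2 where cube: "\<xi>^3 = of_rat r0 + of_rat r1 * \<xi> + of_rat r2 * \<xi>^2" by blast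
    let ?B = "{1, \<xi>, \<xi>^2}"
    have one: "1 \<in> rat_vs.span ?B" and x: "\<xi> \<in> rat_vs.span ?B" by (auto intro: rat_vs.span_base)
    have "of_rat r \<in> rat_vs.span ?B" for r using rat_vs.span_scale[OF one, of r] by simp
    then have "insert \<xi> \<rat> \<subseteq> rat_vs.span ?B" using x by (auto simp: Rats_def)
    then have sub: "rat_adjoin \<xi> \<subseteq> rat_vs.span ?B"
      unfolding rat_adjoin_def using cubic_closure[OF cube] by (rule hull_minimal)
    then have "rat_vs.dim (rat_adjoin \<xi>) \<le> card ?B" by (rule rat_vs.dim_le_card) simp
    also have "\<dots> \<le> 3" by (simp add: card_insert_if)
    finally have "rat_vs.dim (rat_adjoin \<xi>) \<le> 3" .
    then have "enat (rat_vs.dim (rat_adjoin \<xi>)) \<le> 3" unfolding numeral_eq_enat by (simp only: enat_ord_simps)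
    moreover have "\<exists>B. finite B \<and> rat_adjoin \<xi> \<subseteq> rat_vs.span B" by (rule exI[of _ ?B]) (use sub in blast)
    then have "degree_over_rat (rat_adjoin \<xi>) = enat (rat_vs.dim (rat_adjoin \<xi>))"
      unfolding degree_over_rat_def by (rule if_P)
    ultimately show False using assms by (metis leD)
  qed
qed

section \<open>The value of \<open>lambda3\<close> and the final reduction\<close>

lemma lambda3_lower: "849/2000 < lambda3"
proof -
  let ?g = golden_ratio
  define w where "w = sqrt (5::real)"
  have w2: "w * w = 5" by (simp add: w_def)
  have w: "2236/1000 \<le> w" unfolding w_def by (rule real_le_rsqrt) (simp add: power2_eq_square)
  have g: "?g = (1 + w) / 2" by (simp add: golden_ratio_def w_def)
  have g2: "?g^2 = ?g + 1" unfolding g by (simp add: power2_eq_square algebra_simps w2)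
  have g3: "?g^3 = 2 + w"
  proof -
    have "?g^3 = ?g * ?g^2" by (simp add: power2_eq_square power3_eq_cube)
    also have "\<dots> = ?g^2 + ?g" by (simp add: g2 algebra_simps power2_eq_square[symmetric])
    also have "\<dots> = 2 + w" unfolding g2 unfolding g by simp
    finally show ?thesis .
  qed
  have "?g^6 = (?g^3)^2" by (simp flip: power_mult)
  then have g6: "?g^6 = 9 + 4 * w" unfolding g3 by (simp add: power2_eq_square algebra_simps w2)
  \<comment> \<open>After squaring, both sides are linear in the square root \<open>w\<close> of 5,
    and the claim becomes 0.302 w > 0.675199, that is w > 2.23576.\<close>
  have "sqrt (?g^6 - 4 * ?g) < ?g^3 - 849/1000"
  proof (rule real_less_lsqrt)
    have "(?g^3 - 849/1000)^2 = w * w + 2302/1000 * w + 1324801/1000000"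
      unfolding g3 by (simp add: power2_eq_square field_simps)
    moreover have "?g^6 - 4 * ?g = 7 + 2 * w" unfolding g6 unfolding g by (simp add: field_simps)
    ultimately show "?g^6 - 4 * ?g < (?g^3 - 849/1000)^2" using w w2 by linarith
    show "0 \<le> ?g^3 - 849/1000" unfolding g3 using w by simp
  qed
  then show ?thesis unfolding lambda3_closed_form by simp
qed

theorem theorem1p2:
  fixes \<xi> c lam :: real
  assumes "degree_over_rat (rat_adjoin \<xi>) > 3"
    and "c > 0" and "lam > 0"
    and "\<forall>\<^sub>F X::real in at_top. \<exists>x::nat \<Rightarrow> int.
           (\<exists>i\<in>{0..3}. x i \<noteq> 0) \<and>
           \<bar>real_of_int (x 0)\<bar> \<le> X \<and>
           (MAX i\<in>{1..3}. \<bar>real_of_int (x 0) * \<xi> ^ i - real_of_int (x i)\<bar>) \<le> c * X powr (- lam)"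
  shows "lam < lambda3"
proof (rule ccontr)
  assume "\<not> lam < lambda3"
  then have lam: "849/2000 \<le> lam" using lambda3_lower by simp
  interpret cubic_independent \<xi> by (rule cubic_independentI[OF assms(1)])
  let ?c = "M * c"
  have M0: "0 < M" using M_ge(1) by linarith
  have pt: "\<exists>w. w \<noteq> nul \<and> Nm w \<le> X \<and> Lt w \<le> ?c * X powr - (849/2000)"
    if X: "1 \<le> X" and x: "\<exists>i\<in>{0..3}. x i \<noteq> 0" "\<bar>real_of_int (x 0)\<bar> \<le> X"
      "(MAX i\<in>{1..3}. \<bar>real_of_int (x 0) * \<xi> ^ i - real_of_int (x i)\<bar>) \<le> c * X powr (- lam)" for X and x :: "nat \<Rightarrow> int"
  proof -
    define w where "w = Pt (x 0) (x 1) (x 2) (x 3)"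
    define T where "T = c * X powr (- lam)"
    have d: "\<bar>real_of_int (x 0) * \<xi> ^ i - real_of_int (x i)\<bar> \<le> T" if "i \<in> {1..3}" for i
    proof -
      have "\<bar>real_of_int (x 0) * \<xi> ^ i - real_of_int (x i)\<bar> \<le> (MAX i\<in>{1..3}. \<bar>real_of_int (x 0) * \<xi> ^ i - real_of_int (x i)\<bar>)"
        using that by (intro Max_ge) auto
      then show ?thesis using x(3) unfolding T_def by linarith
    qed
    have T0: "0 \<le> T" using d[of 1] by simp
    \<comment> \<open>Each successive error is \<xi> times one given difference minus the next,
      hence at most 1 + |\<xi>| = \<open>M\<close> times the given bound.\<close>
    have shift: "\<bar>b - \<xi> * a\<bar> \<le> M * T" if "\<bar>a'\<bar> \<le> T" "\<bar>b'\<bar> \<le> T" "b - \<xi> * a = \<xi> * a' - b'" for a b a' b' :: real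
    proof -
      have "\<bar>b - \<xi> * a\<bar> \<le> \<bar>\<xi>\<bar> * \<bar>a'\<bar> + \<bar>b'\<bar>" unfolding that(3) abs_mult[symmetric] by linarith
      also have "\<dots> \<le> \<bar>\<xi>\<bar> * T + T" using that by (intro add_mono mult_left_mono) auto
      finally show ?thesis by (simp add: M_def algebra_simps)
    qed
    have "\<bar>e0 w\<bar> \<le> M * T" unfolding e0_def w_def pt.sel
      by (rule shift[OF _ d[of 1], of 0]) (use T0 in \<open>simp_all add: algebra_simps\<close>)
    moreover have "\<bar>e1 w\<bar> \<le> M * T" unfolding e1_def w_def pt.sel
      by (rule shift[OF d[of 1] d[of 2]]) (simp_all add: algebra_simps power2_eq_square)
    moreover have "\<bar>e2 w\<bar> \<le> M * T" unfolding e2_def w_def pt.sel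
      by (rule shift[OF d[of 2] d[of 3]]) (simp_all add: algebra_simps power2_eq_square power3_eq_cube)
    ultimately have "Lt w \<le> M * T" by (simp add: Lt_def)
    \<comment> \<open>For X at least 1 the exponent may be lowered from \<open>lam\<close> to
      849/2000.\<close>
    also have "M * T \<le> M * (c * X powr - (849/2000))"
      unfolding T_def using M0 X lam assms(2) by (intro mult_left_mono powr_mono) auto
    finally have "Lt w \<le> ?c * X powr - (849/2000)" by (simp add: mult.assoc)
    moreover have "w \<noteq> nul"
    proof
      assume "w = nul"
      then have "x 0 = 0" "x 1 = 0" "x 2 = 0" "x 3 = 0" by (simp_all add: w_def nul_def)
      moreover obtain i where "i \<le> 3" "x i \<noteq> 0" using x(1) by auto
      moreover have "i = 0 \<or> i = 1 \<or> i = 2 \<or> i = 3" using \<open>i \<le> 3\<close> by auto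
      ultimately show False by auto
    qed
    moreover have "Nm w \<le> X" using x(2) by (simp add: Nm_def w_def)
    ultimately show ?thesis by blast
  qed
  have "\<forall>\<^sub>F X in at_top. \<exists>w. w \<noteq> nul \<and> Nm w \<le> X \<and> Lt w \<le> ?c * X powr - (849/2000)"
    using assms(4) eventually_ge_at_top[of "1::real"]
  proof eventually_elim
    case (elim X)
    then show ?case using pt by blast
  qed
  moreover have "0 < ?c" using M0 assms(2) by simp
  ultimately obtain x c' where x: "c' > 0" "\<And>i. 1 \<le> Nm (x i)" "\<And>i. Nm (x i) < Nm (x (Suc i))"
    "\<And>i. Lt (x (Suc i)) < Lt (x i)" "\<And>i. Lt (x i) \<le> 1"
    "\<And>i y. y \<noteq> nul \<Longrightarrow> Nm y < Nm (x (Suc i)) \<Longrightarrow> Lt (x i) \<le> Lt y"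
    "\<And>i. Lt (x i) \<le> c' * Nm (x (Suc i)) powr - (849/2000)"
    by (rule minimal_sequence) auto
  interpret minimal_points \<xi> x c' by unfold_locales (rule x; assumption)+
  obtain v y u K where "regular_points \<xi> v y u K" using regular_points_exist by blast
  then show False by (rule regular_points.no_regular_points)
qed

end
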